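(* For a separable infinite dimensional Fréchet space $X$ over $\mathbb K$, the following are equivalent: (i) for each $k\in\mathbb N$, there is a mixing uniformly continuous operator group $\{T_t\}_{t\in\mathbb R^k}$ on $X$; (ii) there is a supercyclic strongly continuous operator semigroup $\{T_t\}_{t\in\mathbb R_+}$ on $X$; (iii) $X$ is non-isomorphic to $\omega$.
   Context: $\mathbb K$ is either $\mathbb R$ or $\mathbb C$; all vector spaces are over $\mathbb K$ and all topological spaces are assumed Hausdorff. A Fréchet space is a complete metrizable locally convex topological vector space. $\omega$ is the space of all sequences $\{x_n\}_{n\in\mathbb Z_+}$ in $\mathbb K$ with the coordinatewise convergence topology ($\mathbb Z_+=\{0,1,2,\dots\}$); isomorphic means linearly homeomorphic. $L(X)$ is the space of continuous linear operators on $X$. For $A=\mathbb R^k$ or $A=\mathbb R_+=[0,\infty)$, an operator semigroup (group, if $A=\mathbb R^k$) $\{T_t\}_{t\in A}$ on $X$ is a family in $L(X)$ with $T_0=I$ and $T_{s+t}=T_tT_s$ for all $s,t\in A$; $|t|$ is the Euclidean norm of $t$. It is strongly continuous if $t\mapsto T_tx$ is continuous from $A$ to $X$ for every $x\in X$. It is uniformly continuous if there is a neighborhood $U$ of zero in $X$ such that for every sequence $t_n\to t$ in $A$, $T_{t_n}x\to T_tx$ uniformly for $x\in U$. It is mixing if for any non-empty open $U,V\subseteq X$ there is $r>0$ such that $T_t(U)\cap V\ne\varnothing$ whenever $t\in A$, $|t|>r$. It is supercyclic if there is $x\in X$ such that $\{zT_tx:z\in\mathbb K,\ t\in A\}$ is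 dense in $X$. *)

theory Defs
  imports "HOL-Analysis.Analysis" "HOL-Library.Function_Algebras"
begin

(* The scalar multiplication is an explicit parameter, so that the same definitions serve
   real and complex spaces. The vector space is the whole type 'a, and its topology is the
   one given by the type class. *)

definition convex_in :: "('k::real_normed_field \<Rightarrow> 'a::ab_group_add \<Rightarrow> 'a) \<Rightarrow> 'a set \<Rightarrow> bool" where
  "convex_in mul C \<longleftrightarrow>
     (\<forall>x\<in>C. \<forall>y\<in>C. \<forall>u::real. 0 \<le> u \<and> u \<le> 1 \<longrightarrow>
        mul (of_real (1 - u)) x + mul (of_real u) y \<in> C)"

(* Completeness refers to the translation invariant uniform structure of the vector space:
   every Cauchy filter converges. *)

locale frechet_space = vector_space mul
  for mul :: "'k::real_normed_field \<Rightarrow> 'a::{topological_ab_group_add,t2_space} \<Rightarrow> 'a" +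
  assumes continuous_mul: "continuous_on UNIV (\<lambda>(c, x). mul c x)"
    and locally_convex:
      "\<And>U. open U \<Longrightarrow> 0 \<in> U \<Longrightarrow> \<exists>C. C \<subseteq> U \<and> 0 \<in> interior C \<and> convex_in mul C"
    and metrizable: "metrizable_space (euclidean :: 'a topology)"
    and complete:
      "\<And>F :: 'a filter. F \<noteq> bot \<Longrightarrow>
         (\<And>U. open U \<Longrightarrow> 0 \<in> U \<Longrightarrow> eventually (\<lambda>(x, y). x - y \<in> U) (F \<times>\<^sub>F F)) \<Longrightarrow>
         \<exists>l. F \<le> nhds l"

definition infinite_dimensional :: "('k::field \<Rightarrow> 'a::ab_group_add \<Rightarrow> 'a) \<Rightarrow> bool" where
  "infinite_dimensional mul \<longleftrightarrow> \<not> (\<exists>B. finite B \<and> module.span mul B = UNIV)"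

definition isomorphic_tvs ::
  "('k::field \<Rightarrow> 'a::{ab_group_add,topological_space} \<Rightarrow> 'a) \<Rightarrow>
   ('k \<Rightarrow> 'b::{ab_group_add,topological_space} \<Rightarrow> 'b) \<Rightarrow> bool" where
  "isomorphic_tvs mul1 mul2 \<longleftrightarrow>
     (\<exists>f. Vector_Spaces.linear mul1 mul2 f \<and> homeomorphic_map euclidean euclidean f)"

(* The space omega of all scalar sequences is the type nat => 'k: addition is pointwise, and
   the topology of the function type is the product topology. *)

definition omega_scale :: "'k::real_normed_field \<Rightarrow> (nat \<Rightarrow> 'k) \<Rightarrow> nat \<Rightarrow> 'k" where
  "omega_scale c x = (\<lambda>n. c * x n)"

(* An operator family is a total function on an index type 's; only its values on
   the carrier of the topological space A matter. *)

definition operator_semigroup ::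
  "('k::field \<Rightarrow> 'a::{ab_group_add,topological_space} \<Rightarrow> 'a) \<Rightarrow>
   's::monoid_add topology \<Rightarrow> ('s \<Rightarrow> 'a \<Rightarrow> 'a) \<Rightarrow> bool" where
  "operator_semigroup mul A T \<longleftrightarrow>
     (\<forall>t\<in>topspace A. Vector_Spaces.linear mul mul (T t) \<and> continuous_on UNIV (T t)) \<and>
     T 0 = id \<and>
     (\<forall>s\<in>topspace A. \<forall>t\<in>topspace A. T (s + t) = T t \<circ> T s)"

definition strongly_continuous ::
  "'s topology \<Rightarrow> ('s \<Rightarrow> 'a::topological_space \<Rightarrow> 'a) \<Rightarrow> bool" where
  "strongly_continuous A T \<longleftrightarrow> (\<forall>x. continuous_map A euclidean (\<lambda>t. T t x))"

definition uniformly_continuous_family ::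
  "'s topology \<Rightarrow> ('s \<Rightarrow> 'a::{ab_group_add,topological_space} \<Rightarrow> 'a) \<Rightarrow> bool" where
  "uniformly_continuous_family A T \<longleftrightarrow>
     (\<exists>U. 0 \<in> interior U \<and>
        (\<forall>t \<tau>. (\<forall>n. \<tau> n \<in> topspace A) \<and> limitin A \<tau> t sequentially \<longrightarrow>
           (\<forall>W. open W \<and> 0 \<in> W \<longrightarrow>
              (\<forall>\<^sub>F n in sequentially. \<forall>x\<in>U. T (\<tau> n) x - T t x \<in> W))))"

(* N is the norm on the index set. *)

definition mixing_family ::
  "'s topology \<Rightarrow> ('s \<Rightarrow> real) \<Rightarrow> ('s \<Rightarrow> 'a::topological_space \<Rightarrow> 'a) \<Rightarrow> bool" where
  "mixing_family A N T \<longleftrightarrow>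
     (\<forall>U V. open U \<and> U \<noteq> {} \<and> open V \<and> V \<noteq> {} \<longrightarrow>
        (\<exists>r>0. \<forall>t\<in>topspace A. N t > r \<longrightarrow> T t ` U \<inter> V \<noteq> {}))"

definition supercyclic_family ::
  "('k \<Rightarrow> 'a::topological_space \<Rightarrow> 'a) \<Rightarrow> 's topology \<Rightarrow> ('s \<Rightarrow> 'a \<Rightarrow> 'a) \<Rightarrow> bool" where
  "supercyclic_family mul A T \<longleftrightarrow>
     (\<exists>x. closure {mul z (T t x) | z t. t \<in> topspace A} = UNIV)"

(* R^k is Euclidean_space k, the sequences of reals vanishing from index k on, so that
   its Euclidean norm is the l2 norm of the first k entries. *)

definition has_mixing_groups ::
  "('k::field \<Rightarrow> 'a::{ab_group_add,topological_space} \<Rightarrow> 'a) \<Rightarrow> bool" where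
  "has_mixing_groups mul \<longleftrightarrow>
     (\<forall>k\<ge>1. \<exists>T. operator_semigroup mul (Euclidean_space k) T \<and>
        uniformly_continuous_family (Euclidean_space k) T \<and>
        mixing_family (Euclidean_space k) (\<lambda>t. L2_set t {..<k}) T)"

definition has_supercyclic_semigroup ::
  "('k::field \<Rightarrow> 'a::{ab_group_add,topological_space} \<Rightarrow> 'a) \<Rightarrow> bool" where
  "has_supercyclic_semigroup mul \<longleftrightarrow>
     (\<exists>T. operator_semigroup mul (top_of_set {0::real..}) T \<and>
        strongly_continuous (top_of_set {0..}) T \<and>
        supercyclic_family mul (top_of_set {0..}) T)"

end

theory Submission
  imports Defs "HOL-Computational_Algebra.Fundamental_Theorem_Algebra"
begin

text \<open>
  Choose increasing seminorms \<open>q\<^sub>n\<close> that define the topology. If the kernel of some \<open>q\<^sub>m\<close> has infinite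
  codimension, there are \<open>x\<^sub>n\<close> with dense span and functionals \<open>f\<^sub>n\<close>, bounded by multiples of the same
  \<open>q\<^sub>m\<close>, with \<open>f\<^sub>i (x\<^sub>j) = \<delta>\<^sub>i\<^sub>j\<close>. Translations of polynomials in \<open>k\<close> variables are unipotent
  in the monomials, with coefficients \<open>a\<^sub>n\<^sub>m(t)\<close> of polynomial growth, and
  \<open>T\<^sub>t z = z + (\<Sum>n. f\<^sub>n(z) (\<Sum>m<n. a\<^sub>n\<^sub>m(t) x\<^sub>m))\<close>, after rescaling the \<open>x\<^sub>n\<close>, is a uniformly continuous group.
  It is mixing since vectors \<open>z\<^sub>t\<close> supported on high monomials exist with \<open>z\<^sub>t\<close> close to a prescribed
  vector and \<open>T\<^sub>-\<^sub>t z\<^sub>t\<close> small. If all the kernels have finite codimension, the space is isomorphic to \<open>\<omega>\<close>.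
  A mixing group with \<open>k = 1\<close> has, by Baire's argument, a vector with dense orbit.

  For a supercyclic semigroup \<open>S\<close> on \<open>\<omega>\<close> with supercyclic vector \<open>x\<close>, the functionals \<open>F \<circ> S\<^sub>t\<close> span
  a finite-dimensional space, so \<open>S\<close> acts on a quotient of finite dimension at least \<open>3\<close>. There the
  operators \<open>S\<^sub>t\<close> have a common eigenfunctional \<open>f\<close> over the complex numbers. Quasi-periodicity of the orbit
  near \<open>x\<close>, obtained from the commutative algebra structure with unit \<open>x\<close> on the quotient, gives
  \<open>\<kappa> P(Y) \<le> |f(Y)|\<close> for the norm \<open>P\<close> of the quotient and all \<open>Y\<close> in the orbit sufficiently close to a given
  vector. But \<open>f\<close> vanishes on some non-zero vector, since real dimension \<open>3\<close> exceeds \<open>2\<close>,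
  and this contradicts density.
\<close>

section \<open>Gradings by increasing seminorms\<close>

text \<open>Uniform continuity asks for one neighbourhood on which all limits are uniform; this is
  why all the functionals are bounded by one seminorm. On the sequence space a continuous seminorm
  is dominated by finitely many coordinates, so functionals bounded by it span a finite-dimensional
  space, and the construction of the group breaks down there and only there. Hahn-Banach enters
  \<open>graded_frechet\<close> as the assumption \<open>functional_exists\<close>. Real and complex
  scalars part ways only in \<open>seminorm_functional_real\<close> and
  \<open>seminorm_functional_complex\<close>, and in the choice of the map in
  \<open>scalar_embedding\<close>. In the quotient of the sequence space no Jordan form is computed.
  For a time t one looks instead at (nearly) the last time before t at which the orbit is, up to a
  scalar, close to x. By compactness the time elapsed since then stays below a constant, and on a
  bounded time interval the norm is controlled from above and the eigenvalue from below.\<close>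

locale graded_frechet = vector_space mul
  for mul :: "'k::real_normed_field \<Rightarrow> 'a::{topological_ab_group_add,t2_space} \<Rightarrow> 'a" +
  fixes q :: "nat \<Rightarrow> 'a \<Rightarrow> real"
  assumes q_add: "q n (x + y) \<le> q n x + q n y"
    and q_scale: "q n (mul c x) = norm c * q n x"
    and q_mono: "m \<le> n \<Longrightarrow> q m x \<le> q n x"
    and q_continuous: "continuous_on UNIV (q n)"
    and q_base: "open U \<Longrightarrow> 0 \<in> U \<Longrightarrow> \<exists>n e. 0 < e \<and> {x. q n x < e} \<subseteq> U"
    and q_complete:
      "(\<And>n e. 0 < e \<Longrightarrow> \<exists>M. \<forall>i\<ge>M. \<forall>j\<ge>M. q n (s i - s j) < e) \<Longrightarrow> \<exists>l. s \<longlonglongrightarrow> l"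
    and functional_exists:
      "q n x \<noteq> 0 \<Longrightarrow>
        \<exists>f C. Vector_Spaces.linear mul (*) f \<and> (\<forall>y. norm (f y) \<le> C * q n y) \<and> f x \<noteq> 0"
begin

lemma q_zero [simp]: "q n 0 = 0"
  using q_scale[of n 0 0] by simp

lemma q_minus [simp]: "q n (- x) = q n x"
  using q_scale[of n "-1" x] by simp

lemma q_nonneg [simp]: "0 \<le> q n x"
  using q_add[of n x "- x"] by simp

lemma q_diff: "q n (x - y) \<le> q n x + q n y"
  using q_add[of n x "- y"] by simp

lemma q_minus_commute: "q n (x - y) = q n (y - x)"
  using q_minus[of n "x - y"] by simp

lemma q_triangle: "q n (x - z) \<le> q n (x - y) + q n (y - z)"
  using q_add[of n "x - y" "y - z"] by simp

lemma q_sum: "q n (sum f A) \<le> (\<Sum>i\<in>A. q n (f i))"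
proof (induction A rule: infinite_finite_induct)
  case (insert x F)
  then show ?case using q_add[of n "f x" "sum f F"] by simp
qed auto

lemma tendsto_q_iff: "(f \<longlongrightarrow> l) F \<longleftrightarrow> (\<forall>n. ((\<lambda>i. q n (f i - l)) \<longlongrightarrow> 0) F)"
proof
  assume f: "(f \<longlongrightarrow> l) F"
  show "\<forall>n. ((\<lambda>i. q n (f i - l)) \<longlongrightarrow> 0) F"
  proof
    fix n
    have "((\<lambda>i. f i - l) \<longlongrightarrow> 0) F"
      using tendsto_diff[OF f tendsto_const[of l]] by simp
    then have "((\<lambda>i. q n (f i - l)) \<longlongrightarrow> q n 0) F"
      using q_continuous[of n] by (intro continuous_on_tendsto_compose[where s=UNIV and f="q n"]) auto
    then show "((\<lambda>i. q n (f i - l)) \<longlongrightarrow> 0) F" by simp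
  qed
next
  assume *: "\<forall>n. ((\<lambda>i. q n (f i - l)) \<longlongrightarrow> 0) F"
  show "(f \<longlongrightarrow> l) F"
  proof (rule topological_tendstoI)
    fix S assume S: "open S" "l \<in> S"
    have "continuous_on UNIV (\<lambda>x. x + l)" by (intro continuous_intros)
    then have "open ((\<lambda>x. x + l) -` S)" using S by (simp add: open_vimage)
    moreover have "0 \<in> (\<lambda>x. x + l) -` S" using S by simp
    ultimately obtain n e where e: "e > 0" "{x. q n x < e} \<subseteq> (\<lambda>x. x + l) -` S"
      using q_base by blast
    have "\<forall>\<^sub>F i in F. q n (f i - l) < e"
      using * e(1) order_tendstoD(2) by blast
    then show "\<forall>\<^sub>F i in F. f i \<in> S"
    proof eventually_elim
      case (elim i)
      then have "f i - l \<in> (\<lambda>x. x + l) -` S" using e(2) by blast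
      then show ?case by simp
    qed
  qed
qed

lemma open_q_ball:
  assumes "open W" "w \<in> W"
  obtains n e where "0 < e" "\<And>x. q n (x - w) < e \<Longrightarrow> x \<in> W"
proof -
  have "continuous_on UNIV (\<lambda>x. x + w)" by (intro continuous_intros)
  then have "open ((\<lambda>x. x + w) -` W)" using assms by (simp add: open_vimage)
  moreover have "0 \<in> (\<lambda>x. x + w) -` W" using assms by simp
  ultimately obtain n e where e: "e > 0" "{x. q n x < e} \<subseteq> (\<lambda>x. x + w) -` W"
    using q_base by blast
  show thesis
  proof (rule that[OF e(1), of n])
    fix x assume "q n (x - w) < e"
    then have "x - w \<in> (\<lambda>x. x + w) -` W" using e(2) by blast
    then show "x \<in> W" by simp
  qed
qed

lemma open_q_less: "open {x. q n (x - w) < e}"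
  by (intro open_Collect_less continuous_intros continuous_on_compose2[OF q_continuous]) auto

lemma tendsto_mul:
  assumes "(c \<longlongrightarrow> c0) F" "(x \<longlongrightarrow> x0) F"
  shows "((\<lambda>i. mul (c i) (x i)) \<longlongrightarrow> mul c0 x0) F"
  unfolding tendsto_q_iff
proof
  fix n
  have x: "((\<lambda>i. q n (x i - x0)) \<longlongrightarrow> 0) F" using assms(2) tendsto_q_iff by blast
  have c: "((\<lambda>i. norm (c i - c0)) \<longlongrightarrow> 0) F" using assms(1) tendsto_norm_zero LIM_zero by blast
  have "((\<lambda>i. norm (c i) * q n (x i - x0) + norm (c i - c0) * q n x0) \<longlongrightarrow> norm c0 * 0 + 0 * q n x0) F"
    by (intro tendsto_intros assms x c)
  then have lim: "((\<lambda>i. norm (c i) * q n (x i - x0) + norm (c i - c0) * q n x0) \<longlongrightarrow> 0) F" by simp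
  show "((\<lambda>i. q n (mul (c i) (x i) - mul c0 x0)) \<longlongrightarrow> 0) F"
  proof (rule tendsto_sandwich[OF _ _ tendsto_const lim])
    show "\<forall>\<^sub>F i in F. q n (mul (c i) (x i) - mul c0 x0) \<le> norm (c i) * q n (x i - x0) + norm (c i - c0) * q n x0"
    proof (rule always_eventually, rule allI)
      fix i
      have "mul (c i) (x i) - mul c0 x0 = mul (c i) (x i - x0) + mul (c i - c0) x0"
        by (simp add: scale_right_diff_distrib scale_left_diff_distrib)
      then show "q n (mul (c i) (x i) - mul c0 x0) \<le> norm (c i) * q n (x i - x0) + norm (c i - c0) * q n x0"
        using q_add q_scale by metis
    qed
  qed auto
qed

lemma continuous_on_linear:
  assumes "Vector_Spaces.linear mul mul T" "\<And>n. \<exists>m C. \<forall>x. q n (T x) \<le> C * q m x"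
  shows "continuous_on UNIV T"
proof -
  interpret T: Vector_Spaces.linear mul mul T by fact
  show ?thesis unfolding continuous_on_def tendsto_q_iff
  proof (intro ballI allI)
    fix x n
    obtain m C where mC: "\<And>x. q n (T x) \<le> C * q m x" using assms(2) by blast
    have "((\<lambda>y. q m (y - x)) \<longlongrightarrow> 0) (at x)"
      using tendsto_q_iff[of "\<lambda>y. y" x "at x"] tendsto_ident_at by blast
    then have lim: "((\<lambda>y. C * q m (y - x)) \<longlongrightarrow> 0) (at x)" using tendsto_mult_right_zero by blast
    show "((\<lambda>i. q n (T i - T x)) \<longlongrightarrow> 0) (at x)"
      by (rule tendsto_sandwich[OF _ _ tendsto_const lim])
        (use mC in \<open>auto simp flip: T.diff\<close>)
  qed
qed

lemma continuous_on_functional: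
  assumes "Vector_Spaces.linear mul (*) f" "\<And>x. norm (f x) \<le> C * q m x"
  shows "continuous_on UNIV f"
proof -
  interpret T: Vector_Spaces.linear mul "(*)" f by fact
  show ?thesis unfolding continuous_on_def
  proof (intro ballI)
    fix x
    have "((\<lambda>y. q m (y - x)) \<longlongrightarrow> 0) (at x)"
      using tendsto_q_iff[of "\<lambda>y. y" x "at x"] tendsto_ident_at by blast
    then have lim: "((\<lambda>y. C * q m (y - x)) \<longlongrightarrow> 0) (at x)" using tendsto_mult_right_zero by blast
    have "((\<lambda>i. norm (f i - f x)) \<longlongrightarrow> 0) (at x)"
      by (rule tendsto_sandwich[OF _ _ tendsto_const lim])
        (use assms(2) in \<open>auto simp flip: T.diff\<close>)
    then show "(f \<longlongrightarrow> f x) (at x)" using Lim_null tendsto_norm_zero_iff by blast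
  qed
qed

lemma q_separates: "(\<And>n. q n x = 0) \<Longrightarrow> x = 0"
proof (rule ccontr)
  assume *: "\<And>n. q n x = 0" "x \<noteq> 0"
  have "open (- {x})" by (simp add: open_Compl)
  then obtain n e where "e > 0" "{y. q n y < e} \<subseteq> - {x}" using q_base[of "- {x}"] *(2) by auto
  moreover have "x \<in> {y. q n y < e}" using *(1)[of n] \<open>e > 0\<close> by simp
  ultimately show False by blast
qed

text \<open>Absolute convergence for each \<open>q n\<close> makes the partial sums Cauchy for each
  \<open>q n\<close>, so that \<open>q_complete\<close> applies.\<close>

lemma summable_q:
  assumes "\<And>n. summable (\<lambda>i. q n (u i))"
  shows "summable u"
proof -
  have "\<exists>l. (\<lambda>N. \<Sum>i<N. u i) \<longlonglongrightarrow> l"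
  proof (rule q_complete)
    fix n and e :: real assume "e > 0"
    then obtain M where M: "\<And>m k. m \<ge> M \<Longrightarrow> norm (\<Sum>i\<in>{m..<k}. q n (u i)) < e"
      using assms[of n] unfolding summable_Cauchy by blast
    have le: "q n ((\<Sum>i<i. u i) - (\<Sum>i<j. u i)) < e" if "M \<le> j" "j \<le> i" for i j
    proof -
      have "(\<Sum>i<i. u i) - (\<Sum>i<j. u i) = (\<Sum>i\<in>{j..<i}. u i)"
        using that(2) by (simp add: lessThan_atLeast0 sum_diff_nat_ivl)
      then have "q n ((\<Sum>i<i. u i) - (\<Sum>i<j. u i)) \<le> (\<Sum>i\<in>{j..<i}. q n (u i))"
        by (simp add: q_sum)
      also have "\<dots> \<le> norm (\<Sum>i\<in>{j..<i}. q n (u i))" by simp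
      also have "\<dots> < e" using M that by blast
      finally show ?thesis .
    qed
    show "\<exists>M. \<forall>i\<ge>M. \<forall>j\<ge>M. q n ((\<Sum>i<i. u i) - (\<Sum>i<j. u i)) < e"
    proof (intro exI[of _ M] allI impI)
      fix i j assume "M \<le> i" "M \<le> j"
      then show "q n ((\<Sum>i<i. u i) - (\<Sum>i<j. u i)) < e"
        using le[of i j] le[of j i] q_minus_commute by (metis nle_le)
    qed
  qed
  then show ?thesis unfolding summable_def sums_def by blast
qed


lemma q_sums_le:
  assumes "u sums s" "\<And>i. q n (u i) \<le> b i" "b sums B"
  shows "q n s \<le> B"
proof -
  have l: "(\<lambda>N. q n (\<Sum>i<N. u i)) \<longlonglongrightarrow> q n s"
    using assms(1) q_continuous[of n] unfolding sums_def
    by (intro continuous_on_tendsto_compose[where s=UNIV and f="q n"]) auto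
  have "q n (\<Sum>i<N. u i) \<le> B" for N
  proof -
    have "q n (\<Sum>i<N. u i) \<le> (\<Sum>i<N. q n (u i))" by (rule q_sum)
    also have "\<dots> \<le> (\<Sum>i<N. b i)" using assms(2) by (intro sum_mono)
    also have "\<dots> \<le> suminf b"
    proof (rule sum_le_suminf)
      show "summable b" using assms(3) sums_summable by blast
      show "0 \<le> b n" for n using assms(2)[of n] q_nonneg order_trans by blast
    qed auto
    also have "\<dots> = B" using assms(3) sums_unique by metis
    finally show ?thesis .
  qed
  then show ?thesis using l by (meson Lim_bounded)
qed

end

section \<open>Translation systems\<close>

text \<open>Preferred to the Euclidean norm because it splits off the last coordinate additively,
  which the induction on \<open>k\<close> uses. It dominates the Euclidean norm, so mixing transfers
  at the end.\<close>

definition l1_norm :: "nat \<Rightarrow> (nat \<Rightarrow> real) \<Rightarrow> real" where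
  "l1_norm k t = (\<Sum>i<k. \<bar>t i\<bar>)"

abbreviation l1_infinity :: "nat \<Rightarrow> (nat \<Rightarrow> real) filter" where
  "l1_infinity k \<equiv> filtercomap (l1_norm k) at_top"

lemma l1_norm_nonneg [simp]: "0 \<le> l1_norm k t"
  by (simp add: l1_norm_def sum_nonneg)

lemma l1_norm_minus [simp]: "l1_norm k (- t) = l1_norm k t"
  by (simp add: l1_norm_def)

lemma l1_norm_Suc: "l1_norm (Suc k) t = l1_norm k t + \<bar>t k\<bar>"
  by (simp add: l1_norm_def)

text \<open>With the monomials in \<open>k\<close> variables enumerated by the naturals,
  \<open>a n m t\<close> is the coefficient of monomial \<open>m\<close> in the translate of
  monomial \<open>n\<close> by \<open>t\<close>. In \<open>recovery\<close>, \<open>c\<close>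
  describes polynomials that tend to monomial \<open>n\<close> while their translates by
  \<open>- t\<close> tend to 0, even after multiplication by a power of the norm. Only the power 0
  is used for mixing; the others carry the induction on \<open>k\<close>, where they absorb the
  growth in the remaining variable.\<close>

locale translation_system =
  fixes k :: nat and a :: "nat \<Rightarrow> nat \<Rightarrow> (nat \<Rightarrow> real) \<Rightarrow> real"
  assumes diagonal: "a n n t = 1"
    and triangular: "n < m \<Longrightarrow> a n m t = 0"
    and at_0: "a n m 0 = of_bool (n = m)"
    and cocycle: "a n m (s + t) = (\<Sum>j\<le>n. a n j s * a j m t)"
    and continuous:
      "(\<And>i. i < k \<Longrightarrow> (\<lambda>l. \<tau> l i) \<longlonglongrightarrow> t i) \<Longrightarrow> (\<lambda>l. a n m (\<tau> l)) \<longlonglongrightarrow> a n m t"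
    and growth: "\<exists>C e. \<forall>m t. \<bar>a n m t\<bar> \<le> C * (1 + l1_norm k t) ^ e"
    and recovery:
      "\<exists>D c. n \<le> D \<and> (\<forall>j. (c j \<longlongrightarrow> of_bool (j = n)) (l1_infinity k)) \<and>
        (\<forall>m. ((\<lambda>t. l1_norm k t ^ e * (\<Sum>j\<le>D. c j t * a j m (- t))) \<longlongrightarrow> 0) (l1_infinity k))"

lemma translation_system_0: "translation_system 0 (\<lambda>n m t. of_bool (n = m))"
proof
  \<comment> \<open>Without coordinates the norm is constantly 0 and nothing tends to infinity, so
    \<open>recovery\<close> holds vacuously.\<close>
  have bot: "l1_infinity 0 = bot"
  proof -
    have "\<forall>\<^sub>F x in at_top. x > (0::real)" by (rule eventually_gt_at_top)
    then have "eventually (\<lambda>t. False) (l1_infinity 0)"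
      unfolding eventually_filtercomap by (intro exI[of _ "\<lambda>x. x > 0"]) (auto simp: l1_norm_def)
    then show ?thesis by (simp add: trivial_limit_def)
  qed
  fix n m e :: nat and s t :: "nat \<Rightarrow> real"
  show "of_bool (n = m) = (\<Sum>j\<le>n. of_bool (n = j) * of_bool (j = m) :: real)"
  proof -
    have "(\<Sum>j\<le>n. of_bool (n = j) * of_bool (j = m) :: real) = (\<Sum>j\<le>n. if j = n then of_bool (n = m) else 0)"
      by (rule sum.cong) auto
    then show ?thesis by simp
  qed
  show "\<exists>C e. \<forall>m t. \<bar>of_bool (n = m) :: real\<bar> \<le> C * (1 + l1_norm 0 t) ^ e"
    by (intro exI[of _ 1] exI[of _ 0]) auto
  show "\<exists>D c. n \<le> D \<and> (\<forall>j. (c j \<longlongrightarrow> of_bool (j = n)) (l1_infinity 0)) \<and>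
        (\<forall>m. ((\<lambda>t. l1_norm 0 t ^ e * (\<Sum>j\<le>D. c j t * (of_bool (j = m) :: real))) \<longlongrightarrow> 0) (l1_infinity 0))"
    unfolding bot by auto
qed auto

section \<open>Translations of polynomials in one variable\<close>

definition shift_coeff :: "nat \<Rightarrow> nat \<Rightarrow> real \<Rightarrow> real" where
  "shift_coeff n m r = real (n choose m) * r ^ (n - m)"

lemma shift_coeff_diag [simp]: "shift_coeff n n r = 1"
  by (simp add: shift_coeff_def)

lemma shift_coeff_eq_0: "n < m \<Longrightarrow> shift_coeff n m r = 0"
  by (simp add: shift_coeff_def)

lemma shift_coeff_0: "shift_coeff n m 0 = of_bool (n = m)"
  by (cases "n < m") (auto simp: shift_coeff_def power_0_left)

text \<open>Trinomial revision pulls \<open>n choose m\<close> out of the sum and leaves the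
  binomial expansion of (s + r)^(n - m).\<close>

lemma shift_coeff_add:
  "shift_coeff n m (r + s) = (\<Sum>j\<le>n. shift_coeff n j r * shift_coeff j m s)"
proof (cases "m \<le> n")
  case True
  have "(\<Sum>j\<le>n. shift_coeff n j r * shift_coeff j m s) = (\<Sum>j\<in>{m..n}. shift_coeff n j r * shift_coeff j m s)"
    by (rule sum.mono_neutral_right) (auto simp: shift_coeff_eq_0)
  also have "\<dots> = (\<Sum>j\<in>{m..n}. real (n choose m) * (real ((n - m) choose (j - m)) * s ^ (j - m) * r ^ (n - m - (j - m))))"
  proof (rule sum.cong)
    fix j assume j: "j \<in> {m..n}"
    then have "real (n choose j) * real (j choose m) = real (n choose m) * real ((n - m) choose (j - m))"
      using choose_mult[of m j n] by (metis atLeastAtMost_iff of_nat_mult)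
    moreover have "n - m - (j - m) = n - j" using j by auto
    ultimately show "shift_coeff n j r * shift_coeff j m s = real (n choose m) * (real ((n - m) choose (j - m)) * s ^ (j - m) * r ^ (n - m - (j - m)))"
      by (simp add: shift_coeff_def algebra_simps)
  qed auto
  also have "\<dots> = (\<Sum>i\<le>n - m. real (n choose m) * (real ((n - m) choose i) * s ^ i * r ^ (n - m - i)))"
    by (rule sum.reindex_bij_witness[of _ "\<lambda>i. i + m" "\<lambda>j. j - m"]) (use True in auto)
  also have "\<dots> = real (n choose m) * (s + r) ^ (n - m)"
    by (simp add: binomial_ring sum_distrib_left)
  finally show ?thesis by (simp add: shift_coeff_def add.commute)
next
  case False
  then have "shift_coeff n j r * shift_coeff j m s = 0" if "j \<le> n" for j
    using that by (simp add: shift_coeff_eq_0)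
  then show ?thesis using False by (simp add: shift_coeff_eq_0)
qed

lemma shift_coeff_growth: "\<bar>shift_coeff n m r\<bar> \<le> 2 ^ n * (1 + \<bar>r\<bar>) ^ n"
proof -
  have "\<bar>r\<bar> ^ (n - m) \<le> (1 + \<bar>r\<bar>) ^ (n - m)" by (intro power_mono) auto
  also have "\<dots> \<le> (1 + \<bar>r\<bar>) ^ n" by (intro power_increasing) auto
  finally have "\<bar>r\<bar> ^ (n - m) \<le> (1 + \<bar>r\<bar>) ^ n" .
  moreover have "real (n choose m) \<le> 2 ^ n"
    using binomial_le_pow2[of n m] by (metis of_nat_le_iff of_nat_numeral of_nat_power)
  ultimately show ?thesis
    unfolding shift_coeff_def abs_mult power_abs by (intro mult_mono) auto
qed

text \<open>Up to sign this is the N-th finite difference of a polynomial in j of degree b, which is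
  less than N. Pascal's rule, applied to both binomial coefficients, lowers \<open>N\<close> and
  \<open>b\<close> together.\<close>

lemma alternating_binomial_sum_eq_0:
  "b < N \<Longrightarrow> (\<Sum>j\<le>N. (-1) ^ j * real (N choose j) * real ((a + j) choose b)) = 0"
proof (induction N arbitrary: a b)
  case (Suc N)
  define S where "S N a b = (\<Sum>j\<le>N. (-1) ^ j * real (N choose j) * real ((a + j) choose b))" for N a b
  have split: "S (Suc N) a b = S N a b - S N (Suc a) b" for a b
  proof -
    have "S (Suc N) a b = real (a choose b) +
        (\<Sum>j\<le>N. (-1) ^ Suc j * (real (N choose Suc j) + real (N choose j)) * real ((a + Suc j) choose b))"
      unfolding S_def by (subst sum.atMost_Suc_shift) (simp add: add.commute)
    also have "\<dots> = (real (a choose b) + (\<Sum>j\<le>N. (-1) ^ Suc j * real (N choose Suc j) * real ((a + Suc j) choose b)))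
        - S N (Suc a) b"
      unfolding S_def by (simp add: algebra_simps sum.distrib sum_subtractf sum_negf)
    also have "real (a choose b) + (\<Sum>j\<le>N. (-1) ^ Suc j * real (N choose Suc j) * real ((a + Suc j) choose b))
        = (\<Sum>j\<le>Suc N. (-1) ^ j * real (N choose j) * real ((a + j) choose b))"
      by (subst sum.atMost_Suc_shift) simp
    also have "\<dots> = S N a b" unfolding S_def by simp
    finally show ?thesis .
  qed
  show ?case
  proof (cases b)
    case 0
    then show ?thesis using split[of a b] unfolding S_def by simp
  next
    case (Suc b')
    have "S N (Suc a) b - S N a b = S N a b'"
      unfolding S_def Suc by (simp add: sum_subtractf[symmetric] algebra_simps)
    moreover have "S N a b' = 0" unfolding S_def using Suc.IH[of b' a] Suc.prems Suc by simp
    ultimately show ?thesis using split[of a b] unfolding S_def by simp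
  qed
qed simp

text \<open>The choice of \<open>c\<close> comes from the polynomial \<open>(s - r)\<^sup>n (s / r)\<^sup>N\<close>: its coefficients
  tend to \<open>0\<close> as \<open>r\<close> tends to infinity, while its translate \<open>s\<^sup>n (1 + s / r)\<^sup>N\<close> tends to \<open>s\<^sup>n\<close>.\<close>

lemma shift_coeff_recovery:
  "\<exists>D c. n \<le> D \<and> (\<forall>j. (c j \<longlongrightarrow> of_bool (j = n)) at_infinity) \<and>
    (\<forall>m. ((\<lambda>r::real. \<bar>r\<bar> ^ e * (\<Sum>j\<le>D. c j r * shift_coeff j m (- r))) \<longlongrightarrow> 0) at_infinity)"
proof -
  \<comment> \<open>After translation by - r the coefficient of s^m is 0 for m < N and of order r^(n
    - m) otherwise. For m at least n + e + 1 the factor \<open>\<bar>r\<bar> ^ e\<close> therefore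
    still leaves a bound of order 1 / |r|.\<close>
  define N where "N = n + e + 1"
  define c where "c j r = (if n \<le> j then real (N choose (j - n)) * inverse r ^ (j - n) else 0)" for j and r :: real
  have inv: "((\<lambda>r::real. inverse r ^ i) \<longlongrightarrow> of_bool (i = 0)) at_infinity" for i
  proof -
    have "((\<lambda>r::real. inverse r ^ i) \<longlongrightarrow> 0 ^ i) at_infinity"
      by (intro tendsto_power tendsto_inverse_0)
    then show ?thesis by (cases "i = 0") (simp_all add: power_0_left)
  qed
  have nz: "\<forall>\<^sub>F r::real in at_infinity. r \<noteq> 0"
    unfolding eventually_at_infinity by (intro exI[of _ 1]) auto
  have 1: "(c j \<longlongrightarrow> of_bool (j = n)) at_infinity" for j
  proof (cases "n \<le> j")
    case True
    have "((\<lambda>r. real (N choose (j - n)) * inverse r ^ (j - n)) \<longlongrightarrow> real (N choose (j - n)) * of_bool (j - n = 0)) at_infinity"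
      by (intro tendsto_intros inv)
    moreover have "real (N choose (j - n)) * of_bool (j - n = 0) = of_bool (j = n)" using True by auto
    ultimately have "((\<lambda>r. real (N choose (j - n)) * inverse r ^ (j - n)) \<longlongrightarrow> of_bool (j = n)) at_infinity"
      by (simp only:)
    then show ?thesis using True by (simp add: c_def[abs_def])
  qed (auto simp: c_def[abs_def])
  have 2: "((\<lambda>r. \<bar>r\<bar> ^ e * (\<Sum>j\<le>n + N. c j r * shift_coeff j m (- r))) \<longlongrightarrow> 0) at_infinity" for m
  proof -
    have S: "(\<Sum>j\<le>n + N. c j r * shift_coeff j m (- r)) =
        (\<Sum>j\<le>N. real (N choose j) * inverse r ^ j * shift_coeff (n + j) m (- r))" for r
    proof -
      have "(\<Sum>j\<le>n + N. c j r * shift_coeff j m (- r)) = (\<Sum>j\<in>{n..n + N}. c j r * shift_coeff j m (- r))"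
        by (rule sum.mono_neutral_right) (auto simp: c_def)
      also have "\<dots> = (\<Sum>j\<le>N. real (N choose j) * inverse r ^ j * shift_coeff (n + j) m (- r))"
        by (rule sum.reindex_bij_witness[of _ "\<lambda>i. n + i" "\<lambda>j. j - n"]) (auto simp: c_def)
      finally show ?thesis .
    qed
    show ?thesis
    proof (cases "m < N")
      case True
      have "\<forall>\<^sub>F r in at_infinity. \<bar>r\<bar> ^ e * (\<Sum>j\<le>n + N. c j r * shift_coeff j m (- r)) = 0"
        using nz
      proof eventually_elim
        case (elim r)
        \<comment> \<open>Multiplication by \<open>(- r) ^ m\<close> removes the truncated exponent
          \<open>n + j - m\<close>; what remains is a finite difference.\<close>
        have t: "real (N choose j) * inverse r ^ j * shift_coeff (n + j) m (- r) * (- r) ^ m =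
            (- r) ^ n * ((-1) ^ j * real (N choose j) * real ((n + j) choose m))" for j
        proof (cases "m \<le> n + j")
          case True
          have "(- r) ^ (n + j - m) * (- r) ^ m = (- r) ^ n * (- r) ^ j"
            using True by (simp flip: power_add)
          moreover have "inverse r ^ j * (- r) ^ j = (-1) ^ j"
            using elim by (simp flip: power_mult_distrib)
          ultimately show ?thesis unfolding shift_coeff_def by (simp add: ac_simps)
        next
          case False
          then show ?thesis by (simp add: shift_coeff_def)
        qed
        have "(\<Sum>j\<le>N. real (N choose j) * inverse r ^ j * shift_coeff (n + j) m (- r)) * (- r) ^ m =
           (- r) ^ n * (\<Sum>j\<le>N. (-1) ^ j * real (N choose j) * real ((n + j) choose m))"
          unfolding sum_distrib_left sum_distrib_right t ..
        also have "\<dots> = 0" using alternating_binomial_sum_eq_0[OF True, of n] by simp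
        finally show ?case using elim S[of r] by simp
      qed
      then show ?thesis by (rule tendsto_eventually)
    next
      case False
      define K where "K = (\<Sum>j\<le>N. real (N choose j) * real ((n + j) choose m))"
      have lim: "((\<lambda>r::real. K * \<bar>inverse r\<bar>) \<longlongrightarrow> 0) at_infinity"
        using tendsto_mult_right_zero[OF tendsto_rabs_zero[OF tendsto_inverse_0]] .
      show ?thesis
      proof (rule Lim_null_comparison[OF _ lim])
        show "\<forall>\<^sub>F r in at_infinity. norm (\<bar>r\<bar> ^ e * (\<Sum>j\<le>n + N. c j r * shift_coeff j m (- r))) \<le> K * \<bar>inverse r\<bar>"
        proof (rule eventually_at_infinityI)
          fix r :: real assume "1 \<le> norm r"
          then have r: "1 \<le> \<bar>r\<bar>" by simp
          have t: "\<bar>r\<bar> ^ e * \<bar>real (N choose j) * inverse r ^ j * shift_coeff (n + j) m (- r)\<bar> \<le>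
            real (N choose j) * real ((n + j) choose m) * \<bar>inverse r\<bar>" for j
          proof (cases "m \<le> n + j")
            case True
            have "\<bar>r\<bar> ^ e * \<bar>inverse r ^ j\<bar> * \<bar>r\<bar> ^ (n + j - m) = inverse (\<bar>r\<bar> ^ j) * \<bar>r\<bar> ^ (e + (n + j - m))"
              by (simp add: power_add power_abs power_inverse abs_inverse)
            also have "\<dots> \<le> inverse (\<bar>r\<bar> ^ j) * \<bar>r\<bar> ^ (j - 1)"
            proof (intro mult_left_mono power_increasing r)
              show "e + (n + j - m) \<le> j - 1" using True False by (simp add: N_def)
            qed auto
            also have "\<dots> = inverse \<bar>r\<bar>"
            proof -
              have "j \<ge> 1" using True False by (simp add: N_def)
              then have "\<bar>r\<bar> ^ j = \<bar>r\<bar> * \<bar>r\<bar> ^ (j - 1)" by (metis Suc_pred' less_eq_Suc_le One_nat_def power_Suc)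
              then show ?thesis using r by (simp add: field_simps)
            qed
            finally have "\<bar>r\<bar> ^ e * \<bar>inverse r ^ j\<bar> * \<bar>r\<bar> ^ (n + j - m) \<le> \<bar>inverse r\<bar>" by (simp add: abs_inverse)
            then have "(real (N choose j) * real ((n + j) choose m)) * (\<bar>r\<bar> ^ e * \<bar>inverse r ^ j\<bar> * \<bar>r\<bar> ^ (n + j - m))
               \<le> (real (N choose j) * real ((n + j) choose m)) * \<bar>inverse r\<bar>"
              by (intro mult_left_mono) auto
            then show ?thesis unfolding shift_coeff_def by (simp add: abs_mult power_abs ac_simps)
          qed (auto simp: shift_coeff_eq_0)
          have "norm (\<bar>r\<bar> ^ e * (\<Sum>j\<le>n + N. c j r * shift_coeff j m (- r))) =
              \<bar>r\<bar> ^ e * \<bar>\<Sum>j\<le>N. real (N choose j) * inverse r ^ j * shift_coeff (n + j) m (- r)\<bar>"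
            unfolding S by (simp add: abs_mult)
          also have "\<dots> \<le> \<bar>r\<bar> ^ e * (\<Sum>j\<le>N. \<bar>real (N choose j) * inverse r ^ j * shift_coeff (n + j) m (- r)\<bar>)"
            by (intro mult_left_mono sum_abs) auto
          also have "\<dots> = (\<Sum>j\<le>N. \<bar>r\<bar> ^ e * \<bar>real (N choose j) * inverse r ^ j * shift_coeff (n + j) m (- r)\<bar>)"
            by (simp add: sum_distrib_left)
          also have "\<dots> \<le> (\<Sum>j\<le>N. real (N choose j) * real ((n + j) choose m) * \<bar>inverse r\<bar>)"
            by (intro sum_mono t)
          also have "\<dots> = K * \<bar>inverse r\<bar>" by (simp add: K_def sum_distrib_right)
          finally show "norm (\<bar>r\<bar> ^ e * (\<Sum>j\<le>n + N. c j r * shift_coeff j m (- r))) \<le> K * \<bar>inverse r\<bar>" .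
        qed
      qed
    qed
  qed
  show ?thesis using 1 2 by (intro exI[of _ "n + N"] exI[of _ c]) auto
qed

section \<open>From k to k + 1 variables\<close>

lemma prod_encode_mono:
  assumes "i \<le> i'" "j \<le> j'" shows "prod_encode (i, j) \<le> prod_encode (i', j')"
proof -
  have "mono triangle" by (intro mono_iff_le_Suc[THEN iffD2]) simp
  then have "triangle (i + j) \<le> triangle (i' + j')" using assms by (intro monoD[of triangle]) auto
  then show ?thesis using assms by (simp add: prod_encode_def)
qed

lemma sum_prod_decode:
  assumes "\<And>i j. D1 < i \<or> D2 < j \<Longrightarrow> F i j = 0" "prod_encode (D1, D2) \<le> N"
  shows "(\<Sum>n\<le>N. F (fst (prod_decode n)) (snd (prod_decode n))) = (\<Sum>i\<le>D1. \<Sum>j\<le>D2. F i j)"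
proof -
  have "(\<Sum>n\<le>N. F (fst (prod_decode n)) (snd (prod_decode n))) =
      (\<Sum>x\<in>prod_decode ` {..N}. F (fst x) (snd x))"
    by (subst sum.reindex) (auto simp: inj_on_def o_def)
  also have "\<dots> = (\<Sum>x\<in>{..D1} \<times> {..D2}. F (fst x) (snd x))"
  proof (rule sum.mono_neutral_right)
    show "{..D1} \<times> {..D2} \<subseteq> prod_decode ` {..N}"
    proof safe
      fix i j assume "i \<le> D1" "j \<le> D2"
      then have "prod_encode (i, j) \<le> N" using prod_encode_mono[of i D1 j D2] assms(2) by simp
      then show "(i, j) \<in> prod_decode ` {..N}" by (intro image_eqI[of _ _ "prod_encode (i, j)"]) auto
    qed
    show "\<forall>x\<in>prod_decode ` {..N} - {..D1} \<times> {..D2}. F (fst x) (snd x) = 0"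
    proof
      fix x assume "x \<in> prod_decode ` {..N} - {..D1} \<times> {..D2}"
      then have "D1 < fst x \<or> D2 < snd x" by (cases x) auto
      then show "F (fst x) (snd x) = 0" by (rule assms(1))
    qed
  qed auto
  also have "\<dots> = (\<Sum>i\<le>D1. \<Sum>j\<le>D2. F i j)"
    by (simp add: sum.cartesian_product case_prod_beta)
  finally show ?thesis .
qed

text \<open>Monomial \<open>n\<close> is monomial \<open>p n\<close> of the first \<open>k\<close>
  variables times the power \<open>r n\<close> of the new one. The Cantor pairing is monotone, so
  the product system is again triangular. For \<open>recovery\<close> the parameter space is cut
  according to which part of \<open>t\<close> is larger. On \<open>A\<close> only the first
  \<open>k\<close> variables are corrected, and decay of order \<open>e + r n\<close> there beats
  the growth of the untouched factor in the new variable; off \<open>A\<close> the roles are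
  exchanged and the order is \<open>e + e1\<close>.\<close>

lemma translation_system_Suc:
  assumes "translation_system k a"
  shows "translation_system (Suc k) (\<lambda>n m t. a (fst (prod_decode n)) (fst (prod_decode m)) t *
    shift_coeff (snd (prod_decode n)) (snd (prod_decode m)) (t k))"
proof -
  interpret translation_system k a by fact
  define p where "p n = fst (prod_decode n)" for n
  define r where "r n = snd (prod_decode n)" for n
  have enc: "prod_encode (p n, r n) = n" for n by (simp add: p_def r_def)
  have eq: "n = m \<longleftrightarrow> p n = p m \<and> r n = r m" for n m
    using enc[of n] enc[of m] by metis
  have less: "p n < p m \<or> r n < r m" if "n < m" for n m
  proof (rule ccontr)
    assume "\<not> (p n < p m \<or> r n < r m)"
    then have "prod_encode (p m, r m) \<le> prod_encode (p n, r n)" by (intro prod_encode_mono) auto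
    then show False using that unfolding enc by simp
  qed
  have "translation_system (Suc k) (\<lambda>n m t. a (p n) (p m) t * shift_coeff (r n) (r m) (t k))"
  proof
    fix n m e :: nat and s t :: "nat \<Rightarrow> real"
    show "a (p n) (p n) t * shift_coeff (r n) (r n) (t k) = 1" by (simp add: diagonal)
    show "a (p n) (p m) t * shift_coeff (r n) (r m) (t k) = 0" if "n < m"
      using less[OF that] triangular shift_coeff_eq_0 by auto
    show "a (p n) (p m) 0 * shift_coeff (r n) (r m) (0 k) = of_bool (n = m)"
      unfolding eq[of n m] by (simp add: at_0 shift_coeff_0)
    show "a (p n) (p m) (s + t) * shift_coeff (r n) (r m) ((s + t) k) =
      (\<Sum>j\<le>n. a (p n) (p j) s * shift_coeff (r n) (r j) (s k) * (a (p j) (p m) t * shift_coeff (r j) (r m) (t k)))"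
    proof -
      have "(\<Sum>j\<le>n. a (p n) (p j) s * shift_coeff (r n) (r j) (s k) * (a (p j) (p m) t * shift_coeff (r j) (r m) (t k))) =
        (\<Sum>i\<le>p n. \<Sum>j\<le>r n. a (p n) i s * shift_coeff (r n) j (s k) * (a i (p m) t * shift_coeff j (r m) (t k)))"
        unfolding p_def[of j for j] r_def[of j for j]
        by (subst sum_prod_decode[symmetric]) (auto simp: triangular shift_coeff_eq_0)
      also have "\<dots> = (\<Sum>i\<le>p n. a (p n) i s * a i (p m) t) * (\<Sum>j\<le>r n. shift_coeff (r n) j (s k) * shift_coeff j (r m) (t k))"
        by (simp add: sum_product ac_simps)
      finally show ?thesis by (simp add: cocycle shift_coeff_add)
    qed
    show "(\<lambda>l. a (p n) (p m) (\<tau> l) * shift_coeff (r n) (r m) (\<tau> l k)) \<longlonglongrightarrow>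
        a (p n) (p m) t * shift_coeff (r n) (r m) (t k)"
      if \<tau>: "\<And>i. i < Suc k \<Longrightarrow> (\<lambda>l. \<tau> l i) \<longlonglongrightarrow> t i" for \<tau>
      unfolding shift_coeff_def by (intro tendsto_intros continuous \<tau>) auto
    show "\<exists>C e. \<forall>m t. \<bar>a (p n) (p m) t * shift_coeff (r n) (r m) (t k)\<bar> \<le> C * (1 + l1_norm (Suc k) t) ^ e"
    proof -
      obtain C e where C: "\<And>m t. \<bar>a (p n) m t\<bar> \<le> C * (1 + l1_norm k t) ^ e" using growth by blast
      have C0: "C \<ge> 0" using order_trans[OF abs_ge_zero C[of 0 0]] by (simp add: l1_norm_def)
      show ?thesis
      proof (intro exI allI)
        fix m t
        have "\<bar>a (p n) (p m) t * shift_coeff (r n) (r m) (t k)\<bar> \<le> (C * (1 + l1_norm k t) ^ e) * (2 ^ r n * (1 + \<bar>t k\<bar>) ^ r n)"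
          unfolding abs_mult by (intro mult_mono C shift_coeff_growth) (use C0 in auto)
        also have "\<dots> \<le> (C * (1 + l1_norm (Suc k) t) ^ e) * (2 ^ r n * (1 + l1_norm (Suc k) t) ^ r n)"
          by (intro mult_mono power_mono) (use C0 in \<open>auto simp: l1_norm_Suc\<close>)
        finally show "\<bar>a (p n) (p m) t * shift_coeff (r n) (r m) (t k)\<bar> \<le> (C * 2 ^ r n) * (1 + l1_norm (Suc k) t) ^ (e + r n)"
          by (simp add: power_add ac_simps)
      qed
    qed
    show "\<exists>D c. n \<le> D \<and> (\<forall>j. (c j \<longlongrightarrow> of_bool (j = n)) (l1_infinity (Suc k))) \<and>
        (\<forall>m. ((\<lambda>t. l1_norm (Suc k) t ^ e * (\<Sum>j\<le>D. c j t * (a (p j) (p m) (- t) *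
           shift_coeff (r j) (r m) ((- t) k)))) \<longlongrightarrow> 0) (l1_infinity (Suc k)))"
    proof -
      obtain C1 e1 where C1: "\<And>m t. \<bar>a (p n) m t\<bar> \<le> C1 * (1 + l1_norm k t) ^ e1" using growth by blast
      have C10: "C1 \<ge> 0" using order_trans[OF abs_ge_zero C1[of 0 0]] by (simp add: l1_norm_def)
      obtain D1 c1 where c1: "p n \<le> D1" "\<And>j. (c1 j \<longlongrightarrow> of_bool (j = p n)) (l1_infinity k)"
        "\<And>m. ((\<lambda>t. l1_norm k t ^ (e + r n) * (\<Sum>j\<le>D1. c1 j t * a j m (- t))) \<longlongrightarrow> 0) (l1_infinity k)"
        using recovery by blast
      obtain D2 c2 where c2: "r n \<le> D2" "\<And>j. (c2 j \<longlongrightarrow> of_bool (j = r n)) at_infinity"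
        "\<And>m. ((\<lambda>t. \<bar>t\<bar> ^ (e + e1) * (\<Sum>j\<le>D2. c2 j t * shift_coeff j m (- t))) \<longlongrightarrow> 0) at_infinity"
        using shift_coeff_recovery by blast
      define D where "D = max (prod_encode (D1, r n)) (prod_encode (p n, D2))"
      define A where "A = {t. \<bar>t k\<bar> \<le> l1_norm k t}"
      define c where "c j t = (if t \<in> A then (if p j \<le> D1 \<and> r j = r n then c1 (p j) t else 0)
         else (if p j = p n \<and> r j \<le> D2 then c2 (r j) (t k) else 0))" for j t
      \<comment> \<open>On \<open>A\<close> the first \<open>k\<close> coordinates carry at least
        half of the norm, so they tend to infinity too; off \<open>A\<close> the last coordinate
        does.\<close>
      have FA: "inf (l1_infinity (Suc k)) (principal A) \<le> l1_infinity k"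
        unfolding le_filter_def eventually_filtercomap_at_top_linorder eventually_inf_principal
      proof (intro allI impI)
        fix P assume "\<exists>N. \<forall>x. N \<le> l1_norm k x \<longrightarrow> P x"
        then obtain N where N: "\<And>x. N \<le> l1_norm k x \<Longrightarrow> P x" by blast
        have "N \<le> l1_norm k x" if "2 * N \<le> l1_norm (Suc k) x" "x \<in> A" for x
          using that by (simp add: A_def l1_norm_Suc)
        then show "\<exists>N. \<forall>x. N \<le> l1_norm (Suc k) x \<longrightarrow> x \<in> A \<longrightarrow> P x" using N by blast
      qed
      have FB: "inf (l1_infinity (Suc k)) (principal (- A)) \<le> filtercomap (\<lambda>t. t k) at_infinity"
        unfolding le_filter_def
      proof (intro allI impI)
        fix P assume "eventually P (filtercomap (\<lambda>t :: nat \<Rightarrow> real. t k) at_infinity)"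
        then obtain N where N: "\<And>x :: nat \<Rightarrow> real. N \<le> \<bar>x k\<bar> \<Longrightarrow> P x"
          unfolding eventually_filtercomap eventually_at_infinity by auto
        have "N \<le> \<bar>x k\<bar>" if "2 * N \<le> l1_norm (Suc k) x" "x \<notin> A" for x
          using that by (simp add: A_def l1_norm_Suc)
        then show "eventually P (inf (l1_infinity (Suc k)) (principal (- A)))"
          unfolding eventually_filtercomap_at_top_linorder eventually_inf_principal using N by blast
      qed
      have lim_k: "((\<lambda>t. g (t k)) \<longlongrightarrow> l) (inf (l1_infinity (Suc k)) (principal (- A)))"
        if "(g \<longlongrightarrow> l) at_infinity" for g :: "real \<Rightarrow> real" and l
        using filterlim_compose[OF that filterlim_filtercomap] FB tendsto_mono by blast
      have 1: "(c j \<longlongrightarrow> of_bool (j = n)) (l1_infinity (Suc k))" for j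
        unfolding c_def
      proof (rule filterlim_If)
        have "((\<lambda>t. if p j \<le> D1 \<and> r j = r n then c1 (p j) t else 0) \<longlongrightarrow> of_bool (j = n)) (l1_infinity k)"
          using c1(1) c1(2)[of "p j"] unfolding eq[of j n] by (cases "p j \<le> D1 \<and> r j = r n") auto
        then show "((\<lambda>t. if p j \<le> D1 \<and> r j = r n then c1 (p j) t else 0) \<longlongrightarrow> of_bool (j = n))
          (inf (l1_infinity (Suc k)) (principal {x. x \<in> A}))"
          unfolding Collect_mem_eq by (rule tendsto_mono[OF FA])
        have "((\<lambda>t. if p j = p n \<and> r j \<le> D2 then c2 (r j) t else 0) \<longlongrightarrow> of_bool (j = n)) at_infinity"
          using c2(1) c2(2)[of "r j"] unfolding eq[of j n] by (cases "p j = p n \<and> r j \<le> D2") auto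
        then show "((\<lambda>t. if p j = p n \<and> r j \<le> D2 then c2 (r j) (t k) else 0) \<longlongrightarrow> of_bool (j = n))
          (inf (l1_infinity (Suc k)) (principal {x. x \<notin> A}))"
          unfolding Compl_eq[symmetric] by (rule lim_k)
      qed
      have 2: "((\<lambda>t. l1_norm (Suc k) t ^ e * (\<Sum>j\<le>D. c j t * (a (p j) (p m) (- t) *
           shift_coeff (r j) (r m) ((- t) k)))) \<longlongrightarrow> 0) (l1_infinity (Suc k))" for m
      proof -
        define S1 where "S1 t = (\<Sum>j\<le>D1. c1 j t * a j (p m) (- t))" for t
        define S2 where "S2 u = (\<Sum>j\<le>D2. c2 j u * shift_coeff j (r m) (- u))" for u
        have SA: "(\<Sum>j\<le>D. c j t * (a (p j) (p m) (- t) * shift_coeff (r j) (r m) ((- t) k))) =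
            S1 t * shift_coeff (r n) (r m) (- t k)" if "t \<in> A" for t
        proof -
          have "(\<Sum>j\<le>D. c j t * (a (p j) (p m) (- t) * shift_coeff (r j) (r m) ((- t) k))) =
             (\<Sum>i\<le>D1. \<Sum>j\<le>r n. (if i \<le> D1 \<and> j = r n then c1 i t else 0) *
               (a i (p m) (- t) * shift_coeff j (r m) (- t k)))"
            unfolding p_def[of j for j] r_def[of j for j] using that
            by (subst sum_prod_decode[symmetric, where N = D])
              (auto simp: c_def p_def r_def D_def intro!: sum.cong)
          also have "\<dots> = (\<Sum>i\<le>D1. \<Sum>j\<le>r n. if j = r n then c1 i t * (a i (p m) (- t) * shift_coeff j (r m) (- t k)) else 0)"
            by (intro sum.cong) auto
          also have "\<dots> = (\<Sum>i\<le>D1. c1 i t * (a i (p m) (- t) * shift_coeff (r n) (r m) (- t k)))"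
            by (simp add: sum.delta)
          finally show ?thesis by (simp add: S1_def sum_distrib_right mult.assoc)
        qed
        have SB: "(\<Sum>j\<le>D. c j t * (a (p j) (p m) (- t) * shift_coeff (r j) (r m) ((- t) k))) =
            a (p n) (p m) (- t) * S2 (t k)" if "t \<notin> A" for t
        proof -
          have "(\<Sum>j\<le>D. c j t * (a (p j) (p m) (- t) * shift_coeff (r j) (r m) ((- t) k))) =
             (\<Sum>i\<le>p n. \<Sum>j\<le>D2. (if i = p n \<and> j \<le> D2 then c2 j (t k) else 0) *
               (a i (p m) (- t) * shift_coeff j (r m) (- t k)))"
            unfolding p_def[of j for j] r_def[of j for j] using that
            by (subst sum_prod_decode[symmetric, where N = D])
              (auto simp: c_def p_def r_def D_def intro!: sum.cong)
          also have "\<dots> = (\<Sum>i\<le>p n. if i = p n then (\<Sum>j\<le>D2. c2 j (t k) * (a i (p m) (- t) * shift_coeff j (r m) (- t k))) else 0)"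
            by (intro sum.cong) auto
          also have "\<dots> = (\<Sum>j\<le>D2. c2 j (t k) * (a (p n) (p m) (- t) * shift_coeff j (r m) (- t k)))"
            by (simp add: sum.delta)
          finally show ?thesis by (simp add: S2_def sum_distrib_left mult_ac)
        qed
        \<comment> \<open>\<open>x\<close> will be the larger part of the norm \<open>X\<close> and
          \<open>y\<close> the smaller one, so \<open>X\<close> and \<open>1 + y\<close> are at most
          \<open>2 * x\<close>. The condition \<open>1 \<le> x\<close> holds as soon as the norm is
          at least 2.\<close>
        have bound: "\<bar>X ^ e * (u * v)\<bar> \<le> (2 ^ e * C * 2 ^ d) * \<bar>x ^ (e + d) * u\<bar>"
          if "0 \<le> X" "X \<le> 2 * x" "1 \<le> x" "\<bar>v\<bar> \<le> C * (1 + y) ^ d" "0 \<le> y" "y \<le> x" "0 \<le> C"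
          for X x u v C y :: real and d
        proof -
          have "\<bar>X ^ e * (u * v)\<bar> = X ^ e * (\<bar>u\<bar> * \<bar>v\<bar>)" using that by (simp add: abs_mult)
          also have "\<dots> \<le> (2 * x) ^ e * (\<bar>u\<bar> * (C * (2 * x) ^ d))"
          proof (intro mult_mono power_mono mult_left_mono)
            have "C * (1 + y) ^ d \<le> C * (2 * x) ^ d" by (intro mult_left_mono power_mono) (use that in auto)
            then show "\<bar>v\<bar> \<le> C * (2 * x) ^ d" using that by linarith
          qed (use that in auto)
          also have "\<dots> = (2 ^ e * C * 2 ^ d) * \<bar>x ^ (e + d) * u\<bar>"
            using that by (simp add: abs_mult power_mult_distrib power_add)
          finally show ?thesis .
        qed
        have "((\<lambda>t. l1_norm (Suc k) t ^ e * (if t \<in> A then S1 t * shift_coeff (r n) (r m) (- t k)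
            else a (p n) (p m) (- t) * S2 (t k))) \<longlongrightarrow> 0) (l1_infinity (Suc k))"
          unfolding if_distrib[where f = "\<lambda>x. _ * x"]
        proof (rule filterlim_If)
          have "((\<lambda>t. (2 ^ e * 2 ^ r n * 2 ^ r n) * \<bar>l1_norm k t ^ (e + r n) * S1 t\<bar>) \<longlongrightarrow> 0) (l1_infinity k)"
            using c1(3)[of "p m"] unfolding S1_def by (intro tendsto_mult_right_zero tendsto_rabs_zero)
          then have lim: "((\<lambda>t. (2 ^ e * 2 ^ r n * 2 ^ r n) * \<bar>l1_norm k t ^ (e + r n) * S1 t\<bar>) \<longlongrightarrow> 0)
              (inf (l1_infinity (Suc k)) (principal {t. t \<in> A}))"
            unfolding Collect_mem_eq by (rule tendsto_mono[OF FA])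
          show "((\<lambda>t. l1_norm (Suc k) t ^ e * (S1 t * shift_coeff (r n) (r m) (- t k))) \<longlongrightarrow> 0)
              (inf (l1_infinity (Suc k)) (principal {t. t \<in> A}))"
          proof (rule Lim_null_comparison[OF _ lim])
            show "\<forall>\<^sub>F t in inf (l1_infinity (Suc k)) (principal {t. t \<in> A}).
               norm (l1_norm (Suc k) t ^ e * (S1 t * shift_coeff (r n) (r m) (- t k))) \<le>
               (2 ^ e * 2 ^ r n * 2 ^ r n) * \<bar>l1_norm k t ^ (e + r n) * S1 t\<bar>"
              unfolding eventually_inf_principal eventually_filtercomap_at_top_linorder
            proof (intro exI[of _ 2] allI impI)
              fix t assume t: "2 \<le> l1_norm (Suc k) t" "t \<in> {t. t \<in> A}"
              have le: "\<bar>t k\<bar> \<le> l1_norm k t" using t by (simp add: A_def)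
              show "norm (l1_norm (Suc k) t ^ e * (S1 t * shift_coeff (r n) (r m) (- t k))) \<le>
               (2 ^ e * 2 ^ r n * 2 ^ r n) * \<bar>l1_norm k t ^ (e + r n) * S1 t\<bar>"
                unfolding real_norm_def
                by (rule bound[where y = "\<bar>t k\<bar>"])
                  (use t(1) le shift_coeff_growth[of "r n" "r m" "- t k"] in \<open>auto simp: l1_norm_Suc\<close>)
            qed
          qed
        next
          have "((\<lambda>u. (2 ^ e * C1 * 2 ^ e1) * \<bar>\<bar>u\<bar> ^ (e + e1) * S2 u\<bar>) \<longlongrightarrow> 0) at_infinity"
            using c2(3)[of "r m"] unfolding S2_def by (intro tendsto_mult_right_zero tendsto_rabs_zero)
          from lim_k[OF this]
          have lim: "((\<lambda>t. (2 ^ e * C1 * 2 ^ e1) * \<bar>\<bar>t k\<bar> ^ (e + e1) * S2 (t k)\<bar>) \<longlongrightarrow> 0)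
              (inf (l1_infinity (Suc k)) (principal {t. t \<notin> A}))"
            by (simp add: Compl_eq)
          show "((\<lambda>t. l1_norm (Suc k) t ^ e * (a (p n) (p m) (- t) * S2 (t k))) \<longlongrightarrow> 0)
              (inf (l1_infinity (Suc k)) (principal {t. t \<notin> A}))"
          proof (rule Lim_null_comparison[OF _ lim])
            show "\<forall>\<^sub>F t in inf (l1_infinity (Suc k)) (principal {t. t \<notin> A}).
               norm (l1_norm (Suc k) t ^ e * (a (p n) (p m) (- t) * S2 (t k))) \<le>
               (2 ^ e * C1 * 2 ^ e1) * \<bar>\<bar>t k\<bar> ^ (e + e1) * S2 (t k)\<bar>"
              unfolding eventually_inf_principal eventually_filtercomap_at_top_linorder
            proof (intro exI[of _ 2] allI impI)
              fix t assume t: "2 \<le> l1_norm (Suc k) t" "t \<in> {t. t \<notin> A}"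
              have le: "l1_norm k t \<le> \<bar>t k\<bar>" using t by (simp add: A_def)
              show "norm (l1_norm (Suc k) t ^ e * (a (p n) (p m) (- t) * S2 (t k))) \<le>
               (2 ^ e * C1 * 2 ^ e1) * \<bar>\<bar>t k\<bar> ^ (e + e1) * S2 (t k)\<bar>"
                unfolding real_norm_def mult.commute[of "a (p n) (p m) (- t)"]
                by (rule bound[where y = "l1_norm k t"])
                  (use t(1) le C1[of "p m" "- t"] C10 in \<open>auto simp: l1_norm_Suc\<close>)
            qed
          qed
        qed
        moreover have "(\<Sum>j\<le>D. c j t * (a (p j) (p m) (- t) * shift_coeff (r j) (r m) ((- t) k))) =
            (if t \<in> A then S1 t * shift_coeff (r n) (r m) (- t k) else a (p n) (p m) (- t) * S2 (t k))" for t
          using SA SB by simp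
        ultimately show ?thesis by simp
      qed
      have "prod_encode (p n, r n) \<le> prod_encode (D1, r n)" using c1(1) by (intro prod_encode_mono) auto
      then have "n \<le> D" unfolding enc D_def by simp
      then show ?thesis using 1 2 by blast
    qed
  qed
  then show ?thesis unfolding p_def r_def .
qed

lemma translation_system_exists: "\<exists>a. translation_system k a"
  by (induction k) (use translation_system_0 translation_system_Suc in blast)+

section \<open>Mixing groups built from a biorthogonal sequence\<close>

text \<open>One index \<open>m0\<close> serves all \<open>n\<close>. Hence on the neighbourhood
  \<open>q m0 z < 1\<close> the coefficients of the series for \<open>T\<close> have bounds that do
  not depend on \<open>z\<close>.\<close>

locale translation_group = graded_frechet mul q + ts: translation_system k a
  for mul :: "'k::real_normed_field \<Rightarrow> 'a::{topological_ab_group_add,t2_space} \<Rightarrow> 'a"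
    and q k a +
  fixes m0 :: nat and x :: "nat \<Rightarrow> 'a" and f :: "nat \<Rightarrow> 'a \<Rightarrow> 'k" and C :: "nat \<Rightarrow> real"
  assumes f_linear: "Vector_Spaces.linear mul (*) (f n)"
    and f_bound: "norm (f n z) \<le> C n * q m0 z"
    and biorthogonal: "f n (x m) = of_bool (n = m)"
    and dense: "closure (span (range x)) = UNIV"
begin

section \<open>Weights and convergence of the series\<close>

lemma C_nonneg: "0 \<le> C n"
proof (rule ccontr)
  assume "\<not> 0 \<le> C n"
  then have "C n * q m0 (x n) \<le> 0" by (simp add: mult_nonpos_nonneg)
  then show False using f_bound[of n "x n"] biorthogonal[of n n] by simp
qed

definition coeff_bound :: "nat \<Rightarrow> real \<Rightarrow> real" where
  "coeff_bound = (SOME B. \<forall>n R m t. l1_norm k t \<le> R \<longrightarrow> \<bar>a n m t\<bar> \<le> B n R)"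

lemma coeff_bound: "l1_norm k t \<le> R \<Longrightarrow> \<bar>a n m t\<bar> \<le> coeff_bound n R"
proof -
  obtain K e where K: "\<And>n m t. \<bar>a n m t\<bar> \<le> K n * (1 + l1_norm k t) ^ e n"
    using ts.growth by metis
  have K0: "K n \<ge> 0" for n
  proof (rule ccontr)
    assume "\<not> K n \<ge> 0"
    then have "K n * (1 + l1_norm k 0) ^ e n < 0" by (simp add: mult_neg_pos l1_norm_def)
    then show False using K[of n n 0] by simp
  qed
  have "\<bar>a n m t\<bar> \<le> K n * (1 + R) ^ e n" if "l1_norm k t \<le> R" for n R m t
  proof -
    have "K n * (1 + l1_norm k t) ^ e n \<le> K n * (1 + R) ^ e n"
      using that K0 by (intro mult_left_mono power_mono) auto
    then show ?thesis using K order_trans by blast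
  qed
  then have "\<exists>B. \<forall>n R m t. l1_norm k t \<le> R \<longrightarrow> \<bar>a n m t\<bar> \<le> B n R"
    by (intro exI[of _ "\<lambda>n R. K n * (1 + R) ^ e n"]) blast
  from someI_ex[OF this] show "l1_norm k t \<le> R \<Longrightarrow> \<bar>a n m t\<bar> \<le> coeff_bound n R"
    unfolding coeff_bound_def by blast
qed

lemma coeff_bound_nonneg: "0 \<le> R \<Longrightarrow> 0 \<le> coeff_bound n R"
  using order_trans[OF abs_ge_zero coeff_bound[of 0 R n 0]] by (simp add: l1_norm_def)

text \<open>A diagonal choice: \<open>n\<close> is at the same time the index of the term, of the
  seminorm and the radius for \<open>t\<close>. Any fixed seminorm and any bounded set of parameters
  are thus covered from some \<open>n\<close> on.\<close>

definition gain :: "nat \<Rightarrow> real" where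
  "gain n = (\<Sum>m<n. C n * coeff_bound n (real n) * q n (x m))"

text \<open>Dividing \<open>f\<^sub>n\<close> and multiplying \<open>x\<^sub>n\<close> by a rapidly growing weight
  makes the series below converge.\<close>

definition weight :: "nat \<Rightarrow> real" where
  "weight n = (\<Prod>i\<le>n. 1 + 2 ^ i * gain i)"

definition y :: "nat \<Rightarrow> 'a" where
  "y n = mul (of_real (weight n)) (x n)"

definition g :: "nat \<Rightarrow> (nat \<Rightarrow> real) \<Rightarrow> 'a" where
  "g n t = (\<Sum>m<n. mul (of_real (a n m t)) (y m))"

definition \<phi> :: "nat \<Rightarrow> 'a \<Rightarrow> 'k" where
  "\<phi> n z = f n z / of_real (weight n)"

definition T :: "(nat \<Rightarrow> real) \<Rightarrow> 'a \<Rightarrow> 'a" where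
  "T t z = z + (\<Sum>n. mul (\<phi> n z) (g n t))"

lemma gain_nonneg: "0 \<le> gain n"
  unfolding gain_def by (intro sum_nonneg mult_nonneg_nonneg C_nonneg coeff_bound_nonneg) auto

lemma weight_factor_ge_1: "1 \<le> 1 + 2 ^ i * gain i"
  using mult_nonneg_nonneg[OF zero_le_power[of 2 i] gain_nonneg[of i]] by auto

lemma weight_ge_1: "1 \<le> weight n"
  unfolding weight_def by (rule prod_ge_1) (rule weight_factor_ge_1)

lemma weight_mono: "m \<le> n \<Longrightarrow> weight m \<le> weight n"
  unfolding weight_def
  by (rule prod_mono2) (auto intro!: add_nonneg_nonneg simp: gain_nonneg)

text \<open>\<open>g n\<close> contains only \<open>y m\<close> with m < n, hence weights up to
  \<open>weight (n - 1)\<close>, whereas \<open>\<phi> n\<close> divides by \<open>weight n\<close>.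
  This ratio of consecutive weights gives the geometric decay in \<open>g_decay\<close>.\<close>

lemma weight_gain: "0 < n \<Longrightarrow> 2 ^ n * (weight (n - 1) * gain n) \<le> weight n"
proof -
  assume "0 < n"
  then obtain m where m: "n = Suc m" by (cases n) auto
  have "weight n = weight m * (1 + 2 ^ n * gain n)" unfolding weight_def m by simp
  moreover have "weight m \<ge> 0" using weight_ge_1[of m] by simp
  ultimately show ?thesis using m by (simp add: algebra_simps)
qed

lemma q_g_le: "l1_norm k t \<le> R \<Longrightarrow> q j (g n t) \<le> (\<Sum>m<n. coeff_bound n R * q j (y m))"
proof -
  assume R: "l1_norm k t \<le> R"
  have "q j (g n t) \<le> (\<Sum>m<n. q j (mul (of_real (a n m t)) (y m)))"
    unfolding g_def by (rule q_sum)
  also have "\<dots> \<le> (\<Sum>m<n. coeff_bound n R * q j (y m))"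
    using coeff_bound[OF R] by (intro sum_mono) (auto simp: q_scale intro!: mult_right_mono)
  finally show ?thesis .
qed

lemma g_decay:
  assumes "j \<le> n" "l1_norm k t \<le> real n"
  shows "C n / weight n * q j (g n t) \<le> (1 / 2) ^ n"
proof (cases "n = 0")
  case False
  have w0: "weight n > 0" for n using weight_ge_1[of n] by simp
  have "q j (g n t) \<le> (\<Sum>m<n. coeff_bound n (real n) * q j (y m))" by (rule q_g_le) fact
  also have "\<dots> \<le> (\<Sum>m<n. weight (n - 1) * (coeff_bound n (real n) * q n (x m)))"
  proof (rule sum_mono)
    fix m assume "m \<in> {..<n}"
    then have "weight m \<le> weight (n - 1)" by (intro weight_mono) auto
    moreover have "q j (x m) \<le> q n (x m)" by (intro q_mono assms)
    ultimately have "weight m * q j (x m) \<le> weight (n - 1) * q n (x m)"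
      using w0[of "n - 1"] by (intro mult_mono) auto
    then have "coeff_bound n (real n) * (weight m * q j (x m)) \<le> coeff_bound n (real n) * (weight (n - 1) * q n (x m))"
      by (intro mult_left_mono coeff_bound_nonneg) auto
    then show "coeff_bound n (real n) * q j (y m) \<le> weight (n - 1) * (coeff_bound n (real n) * q n (x m))"
      using w0[of m] by (simp add: y_def q_scale ac_simps)
  qed
  finally have "C n * q j (g n t) \<le> C n * (\<Sum>m<n. weight (n - 1) * (coeff_bound n (real n) * q n (x m)))"
    by (intro mult_left_mono C_nonneg)
  also have "\<dots> = weight (n - 1) * gain n"
    by (simp add: gain_def sum_distrib_left ac_simps)
  finally have "2 ^ n * (C n * q j (g n t)) \<le> 2 ^ n * (weight (n - 1) * gain n)" by simp
  also have "\<dots> \<le> weight n" using False by (intro weight_gain) auto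
  finally show ?thesis using w0[of n] by (simp add: field_simps power_divide)
qed (auto simp: g_def)

lemma norm_\<phi>_le: "norm (\<phi> n z) \<le> C n / weight n * q m0 z"
  using f_bound[of n z] weight_ge_1[of n] by (simp add: \<phi>_def norm_divide divide_right_mono)

lemma \<phi>_linear: "Vector_Spaces.linear mul (*) (\<phi> n)"
proof -
  interpret f: Vector_Spaces.linear mul "(*)" "f n" by (rule f_linear)
  show ?thesis
    by unfold_locales (auto simp: \<phi>_def f.add f.scale add_divide_distrib)
qed

lemma summable_\<phi>: 
  assumes "\<And>j. summable (\<lambda>n. C n / weight n * q j (u n))"
  shows "summable (\<lambda>n. mul (\<phi> n z) (u n))"
proof (rule summable_q)
  fix j
  have "q j (mul (\<phi> n z) (u n)) \<le> q m0 z * (C n / weight n * q j (u n))" for n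
    using mult_right_mono[OF norm_\<phi>_le q_nonneg, of n z j "u n"] by (simp add: q_scale ac_simps)
  then show "summable (\<lambda>n. q j (mul (\<phi> n z) (u n)))"
    by (intro summable_comparison_test'[OF summable_mult[OF assms[of j], of "q m0 z"], of 0]) simp
qed

lemma summable_g: "summable (\<lambda>n. C n / weight n * q j (g n t))"
proof (rule summable_comparison_test')
  show "summable (\<lambda>n. (1 / 2 :: real) ^ n)" by (simp add: summable_geometric)
  fix n assume n: "n \<ge> max j (nat \<lceil>l1_norm k t\<rceil>)"
  then have "l1_norm k t \<le> real n" by linarith
  then have "C n / weight n * q j (g n t) \<le> (1 / 2) ^ n" using n by (intro g_decay) auto
  moreover have "0 \<le> C n / weight n * q j (g n t)" using C_nonneg weight_ge_1[of n] by simp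
  ultimately show "norm (C n / weight n * q j (g n t)) \<le> (1 / 2) ^ n" by simp
qed

text \<open>A bound for the operator norm of \<open>T s - T t\<close> from the seminorm
  \<open>q m0\<close> to the seminorm \<open>q j\<close>; see \<open>q_T_diff_le\<close>.\<close>

definition \<Delta> :: "nat \<Rightarrow> (nat \<Rightarrow> real) \<Rightarrow> (nat \<Rightarrow> real) \<Rightarrow> real" where
  "\<Delta> j s t = (\<Sum>n. C n / weight n * q j (g n s - g n t))"

lemma \<Delta>_term_le:
  "norm (C n / weight n * q j (g n s - g n t)) \<le> C n / weight n * q j (g n s) + C n / weight n * q j (g n t)"
proof -
  have "C n / weight n * q j (g n s - g n t) \<le> C n / weight n * (q j (g n s) + q j (g n t))"
    using C_nonneg weight_ge_1[of n] by (intro mult_left_mono q_diff) auto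
  moreover have "0 \<le> C n / weight n * q j (g n s - g n t)" using C_nonneg weight_ge_1[of n] by simp
  ultimately show ?thesis by (simp add: distrib_left)
qed

lemma summable_\<Delta>: "summable (\<lambda>n. C n / weight n * q j (g n s - g n t))"
  by (rule summable_comparison_test'[OF summable_add[OF summable_g summable_g] \<Delta>_term_le])

lemma T_sums: "(\<lambda>n. mul (\<phi> n z) (g n t)) sums (T t z - z)"
  using summable_\<phi>[OF summable_g] by (simp add: T_def summable_sums)

lemma q_T_diff_le: "q j (T s z - T t z) \<le> \<Delta> j s t * q m0 z"
proof (rule q_sums_le)
  have "(\<lambda>n. mul (\<phi> n z) (g n s) + (- mul (\<phi> n z) (g n t))) sums ((T s z - z) + (- (T t z - z)))"
    using T_sums[of z t] tendsto_minus unfolding sums_def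
    by (intro sums_add[unfolded sums_def] T_sums[unfolded sums_def]) (fastforce simp: sum_negf)
  then show "(\<lambda>n. mul (\<phi> n z) (g n s - g n t)) sums (T s z - T t z)"
    by (simp add: scale_right_diff_distrib)
  show "(\<lambda>n. C n / weight n * q j (g n s - g n t) * q m0 z) sums (\<Delta> j s t * q m0 z)"
    unfolding \<Delta>_def by (intro sums_mult2 summable_sums summable_\<Delta>)
  show "q j (mul (\<phi> n z) (g n s - g n t)) \<le> C n / weight n * q j (g n s - g n t) * q m0 z" for n
    using mult_right_mono[OF norm_\<phi>_le q_nonneg, of n z j "g n s - g n t"] by (simp add: q_scale ac_simps)
qed

lemma g_0: "g n 0 = 0"
  unfolding g_def by (intro sum.neutral) (auto simp: ts.at_0)

lemma T_0: "T 0 = id"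
  by (rule ext) (simp add: T_def g_0)

lemma \<Delta>_nonneg: "0 \<le> \<Delta> j s t"
  unfolding \<Delta>_def
  by (intro suminf_nonneg summable_\<Delta> mult_nonneg_nonneg divide_nonneg_nonneg C_nonneg q_nonneg
      order_trans[OF zero_le_one weight_ge_1])

lemma T_linear: "Vector_Spaces.linear mul mul (T t)"
proof unfold_locales
  fix u v c
  interpret \<phi>: Vector_Spaces.linear mul "(*)" "\<phi> n" for n by (rule \<phi>_linear)
  have "(\<lambda>n. mul (\<phi> n (u + v)) (g n t)) sums (T t u - u + (T t v - v))"
    unfolding \<phi>.add scale_left_distrib by (intro sums_add T_sums)
  then have "T t u - u + (T t v - v) = T t (u + v) - (u + v)" using T_sums sums_unique2 by blast
  then show "T t (u + v) = T t u + T t v" by (simp add: algebra_simps)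
  have "(\<lambda>n. mul (\<phi> n (mul c u)) (g n t)) sums mul c (T t u - u)"
  proof -
    have "(\<lambda>N. mul c (\<Sum>n<N. mul (\<phi> n u) (g n t))) \<longlonglongrightarrow> mul c (T t u - u)"
      by (intro tendsto_mul tendsto_const T_sums[unfolded sums_def])
    then show ?thesis unfolding sums_def by (simp add: scale_sum_right \<phi>.scale)
  qed
  then have "mul c (T t u - u) = T t (mul c u) - mul c u" using T_sums sums_unique2 by blast
  then show "T t (mul c u) = mul c (T t u)" by (simp add: scale_right_diff_distrib)
qed

lemma T_continuous: "continuous_on UNIV (T t)"
proof (rule continuous_on_linear[OF T_linear])
  fix j
  show "\<exists>m K. \<forall>z. q j (T t z) \<le> K * q m z"
  proof (intro exI allI)
    fix z
    have "q j (T t z) \<le> q j (T t z - T 0 z) + q j z" using q_add[of j "T t z - T 0 z" z] by (simp add: T_0)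
    also have "\<dots> \<le> \<Delta> j t 0 * q m0 z + q j z" using q_T_diff_le by simp
    also have "\<dots> \<le> \<Delta> j t 0 * q (max j m0) z + q (max j m0) z"
      by (intro add_mono mult_left_mono q_mono \<Delta>_nonneg) auto
    finally show "q j (T t z) \<le> (\<Delta> j t 0 + 1) * q (max j m0) z" by (simp add: distrib_right)
  qed
qed

lemma weight_nz [simp]: "weight n \<noteq> 0"
  using weight_ge_1[of n] by auto

text \<open>The weights cancel in \<open>\<phi> m (y n)\<close>, so only the term of index
  \<open>n\<close> survives, and the \<open>y n\<close> behave like monomials under translation. The
  summand \<open>z\<close> of \<open>T t z\<close> supplies the diagonal coefficient 1.\<close>

lemma T_y: "T t (y n) = (\<Sum>m\<le>n. mul (of_real (a n m t)) (y m))"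
proof -
  have "\<phi> m (y n) = of_bool (m = n)" for m
  proof -
    interpret f: Vector_Spaces.linear mul "(*)" "f m" by (rule f_linear)
    show ?thesis unfolding \<phi>_def y_def by (simp add: f.scale biorthogonal)
  qed
  then have "(\<lambda>m. mul (\<phi> m (y n)) (g m t)) = (\<lambda>m. if m = n then g m t else 0)" by auto
  then have "(\<lambda>m. mul (\<phi> m (y n)) (g m t)) sums g n t" using sums_single[of n "\<lambda>m. g m t"] by simp
  from sums_unique2[OF T_sums this] have "T t (y n) = g n t + y n" by (simp add: diff_eq_eq)
  also have "\<dots> = (\<Sum>m<Suc n. mul (of_real (a n m t)) (y m))" by (simp add: g_def ts.diagonal)
  finally show ?thesis by (simp only: lessThan_Suc_atMost)
qed

lemma span_y: "span (range y) = span (range x)"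
proof (rule span_eq[THEN iffD2], safe)
  fix n
  show "y n \<in> span (range x)" unfolding y_def by (intro span_scale span_base) auto
  have "x n = mul (of_real (1 / weight n)) (y n)" by (simp add: y_def flip: of_real_mult)
  then show "x n \<in> span (range y)" by (metis span_scale span_base rangeI)
qed

text \<open>On the span of the \<open>y n\<close> this is \<open>ts.cocycle\<close>; density and
  continuity of both sides do the rest.\<close>

lemma T_add: "T (s + t) = T t \<circ> T s"
proof -
  interpret T: Vector_Spaces.linear mul mul "T r" for r by (rule T_linear)
  interpret P: vector_space_pair mul mul ..
  have on_y: "T (s + t) (y n) = (T t \<circ> T s) (y n)" for n
  proof -
    have "(T t \<circ> T s) (y n) = (\<Sum>j\<le>n. mul (of_real (a n j s)) (\<Sum>m\<le>j. mul (of_real (a j m t)) (y m)))"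
      by (simp add: T_y T.sum T.scale)
    also have "\<dots> = (\<Sum>j\<le>n. \<Sum>m\<le>n. mul (of_real (a n j s * a j m t)) (y m))"
    proof (rule sum.cong)
      fix j assume "j \<in> {..n}"
      then have "(\<Sum>m\<le>j. mul (of_real (a j m t)) (y m)) = (\<Sum>m\<le>n. mul (of_real (a j m t)) (y m))"
        by (intro sum.mono_neutral_left) (auto simp: ts.triangular)
      then show "mul (of_real (a n j s)) (\<Sum>m\<le>j. mul (of_real (a j m t)) (y m)) =
          (\<Sum>m\<le>n. mul (of_real (a n j s * a j m t)) (y m))" by (simp add: scale_sum_right)
    qed auto
    also have "\<dots> = (\<Sum>m\<le>n. mul (of_real (a n m (s + t))) (y m))"
      by (subst sum.swap) (simp add: ts.cocycle scale_sum_left)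
    finally show ?thesis by (simp add: T_y)
  qed
  have comp: "Vector_Spaces.linear mul mul (T t \<circ> T s)"
    by unfold_locales (auto simp: T.add T.scale)
  have "T (s + t) z = (T t \<circ> T s) z" if "z \<in> span (range y)" for z
    using that by (rule P.linear_eq_on_span[OF T_linear comp, rotated]) (use on_y in auto)
  then have "span (range y) \<subseteq> {z. T (s + t) z = (T t \<circ> T s) z}" by blast
  moreover have "closed {z. T (s + t) z = (T t \<circ> T s) z}"
    using T_continuous by (intro closed_Collect_eq continuous_on_compose continuous_on_subset[OF T_continuous]) auto
  ultimately have "closure (span (range y)) \<subseteq> {z. T (s + t) z = (T t \<circ> T s) z}" by (rule closure_minimal)
  then have "T (s + t) z = (T t \<circ> T s) z" for z unfolding span_y dense by blast
  then show ?thesis by (intro ext) simp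
qed

text \<open>Tannery's theorem. Each term tends to 0 by continuity of the coefficients, and from
  \<open>N\<close> on \<open>g_decay\<close> dominates the terms for \<open>t\<close> and for almost
  all \<open>\<tau> l\<close> at once.\<close>

lemma \<Delta>_tendsto_0:
  assumes "\<And>i. i < k \<Longrightarrow> (\<lambda>l. \<tau> l i) \<longlonglongrightarrow> t i"
  shows "(\<lambda>l. \<Delta> j (\<tau> l) t) \<longlonglongrightarrow> 0"
proof -
  have l1: "(\<lambda>l. l1_norm k (\<tau> l)) \<longlonglongrightarrow> l1_norm k t"
    unfolding l1_norm_def by (intro tendsto_sum tendsto_rabs assms) auto
  define N where "N = max j (nat \<lceil>l1_norm k t + 1\<rceil>)"
  have "\<forall>\<^sub>F l in sequentially. l1_norm k (\<tau> l) < l1_norm k t + 1"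
    using order_tendstoD(2)[OF l1] by simp
  then have ev: "\<forall>\<^sub>F l in sequentially. l1_norm k (\<tau> l) \<le> real N"
    by eventually_elim (simp add: N_def, linarith)
  have "l1_norm k t \<le> real N" unfolding N_def by linarith
  have "(\<lambda>l. \<Sum>n. C n / weight n * q j (g n (\<tau> l) - g n t)) \<longlonglongrightarrow> (\<Sum>n. 0)"
  proof (rule conjunct2[OF conjunct2[OF tannerys_theorem]])
    show "summable (\<lambda>n. 2 * (1 / 2 :: real) ^ n)" by (intro summable_mult summable_geometric) auto
    show "(\<lambda>l. C n / weight n * q j (g n (\<tau> l) - g n t)) \<longlonglongrightarrow> 0" for n
    proof -
      have "(\<lambda>l. g n (\<tau> l)) \<longlonglongrightarrow> g n t"
        unfolding g_def by (intro tendsto_sum tendsto_mul tendsto_of_real ts.continuous assms) auto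
      then show ?thesis using tendsto_q_iff[of "\<lambda>l. g n (\<tau> l)"] by (intro tendsto_mult_right_zero) blast
    qed
    show "\<forall>\<^sub>F (n, l) in at_top \<times>\<^sub>F sequentially. norm (C n / weight n * q j (g n (\<tau> l) - g n t)) \<le> 2 * (1 / 2) ^ n"
      unfolding eventually_prod_filter
    proof (intro exI conjI allI impI)
      show "\<forall>\<^sub>F n in at_top. n \<ge> N" by (rule eventually_ge_at_top)
      show "\<forall>\<^sub>F l in sequentially. l1_norm k (\<tau> l) \<le> real N" by (rule ev)
      fix n l assume nl: "N \<le> n" "l1_norm k (\<tau> l) \<le> real N"
      have "norm (C n / weight n * q j (g n (\<tau> l) - g n t)) \<le>
          C n / weight n * q j (g n (\<tau> l)) + C n / weight n * q j (g n t)" by (rule \<Delta>_term_le)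
      also have "\<dots> \<le> (1 / 2) ^ n + (1 / 2) ^ n"
        using nl \<open>l1_norm k t \<le> real N\<close> by (intro add_mono g_decay) (auto simp: N_def)
      finally show "case (n, l) of (n, l) \<Rightarrow> norm (C n / weight n * q j (g n (\<tau> l) - g n t)) \<le> 2 * (1 / 2) ^ n" by simp
    qed
  qed auto
  then show ?thesis unfolding \<Delta>_def by simp
qed

text \<open>\<open>ts.recovery\<close> with exponent 0 settles a single \<open>y n\<close>, and
  linear combinations follow by linearity of \<open>T (- t)\<close>.\<close>

lemma recover:
  assumes "v \<in> span (range y)"
  shows "\<exists>z. (z \<longlongrightarrow> v) (l1_infinity k) \<and> ((\<lambda>t. T (- t) (z t)) \<longlongrightarrow> 0) (l1_infinity k)"
  using assms
proof (induction rule: span_induct_alt)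
  case base
  interpret T: Vector_Spaces.linear mul mul "T r" for r by (rule T_linear)
  show ?case by (intro exI[of _ "\<lambda>t. 0"]) (auto simp: T.zero)
next
  case (step c u v)
  interpret T: Vector_Spaces.linear mul mul "T r" for r by (rule T_linear)
  obtain n where u: "u = y n" using step by blast
  obtain D b where b: "n \<le> D" "\<And>j. (b j \<longlongrightarrow> of_bool (j = n)) (l1_infinity k)"
    "\<And>m. ((\<lambda>t. l1_norm k t ^ 0 * (\<Sum>j\<le>D. b j t * a j m (- t))) \<longlongrightarrow> 0) (l1_infinity k)"
    using ts.recovery by blast
  obtain z where z: "(z \<longlongrightarrow> v) (l1_infinity k)" "((\<lambda>t. T (- t) (z t)) \<longlongrightarrow> 0) (l1_infinity k)"
    using step by blast
  define w where "w t = (\<Sum>j\<le>D. mul (of_real (b j t)) (y j))" for t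
  have "(w \<longlongrightarrow> (\<Sum>j\<le>D. mul (of_real (of_bool (j = n))) (y j))) (l1_infinity k)"
    unfolding w_def[abs_def] by (intro tendsto_sum tendsto_mul tendsto_of_real b tendsto_const)
  moreover have "(\<Sum>j\<le>D. mul (of_real (of_bool (j = n))) (y j)) = (\<Sum>j\<le>D. if j = n then y j else 0)"
    by (intro sum.cong) auto
  moreover have "\<dots> = u" using b(1) u by simp
  ultimately have w1: "(w \<longlongrightarrow> u) (l1_infinity k)" by simp
  have "T (- t) (w t) = (\<Sum>m\<le>D. mul (of_real (\<Sum>j\<le>D. b j t * a j m (- t))) (y m))" for t
  proof -
    have "T (- t) (w t) = (\<Sum>j\<le>D. mul (of_real (b j t)) (\<Sum>m\<le>j. mul (of_real (a j m (- t))) (y m)))"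
      by (simp add: w_def T_y T.sum T.scale)
    also have "\<dots> = (\<Sum>j\<le>D. \<Sum>m\<le>D. mul (of_real (b j t * a j m (- t))) (y m))"
    proof (rule sum.cong)
      fix j assume "j \<in> {..D}"
      then have "(\<Sum>m\<le>j. mul (of_real (a j m (- t))) (y m)) = (\<Sum>m\<le>D. mul (of_real (a j m (- t))) (y m))"
        by (intro sum.mono_neutral_left) (auto simp: ts.triangular)
      then show "mul (of_real (b j t)) (\<Sum>m\<le>j. mul (of_real (a j m (- t))) (y m)) =
          (\<Sum>m\<le>D. mul (of_real (b j t * a j m (- t))) (y m))" by (simp add: scale_sum_right)
    qed auto
    finally show ?thesis by (subst (asm) sum.swap) (simp add: scale_sum_left)
  qed
  moreover have "((\<lambda>t. \<Sum>m\<le>D. mul (of_real (\<Sum>j\<le>D. b j t * a j m (- t))) (y m)) \<longlongrightarrow>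
      (\<Sum>m\<le>D. mul (of_real 0) (y m))) (l1_infinity k)"
    using b(3) by (intro tendsto_sum tendsto_mul tendsto_of_real tendsto_const) simp
  ultimately have w2: "((\<lambda>t. T (- t) (w t)) \<longlongrightarrow> 0) (l1_infinity k)" by simp
  have "((\<lambda>t. mul c (w t) + z t) \<longlongrightarrow> mul c u + v) (l1_infinity k)"
    by (intro tendsto_add tendsto_mul tendsto_const w1 z)
  moreover have "((\<lambda>t. mul c (T (- t) (w t)) + T (- t) (z t)) \<longlongrightarrow> mul c 0 + 0) (l1_infinity k)"
    by (intro tendsto_add tendsto_mul tendsto_const w2 z)
  ultimately show ?case
    by (intro exI[of _ "\<lambda>t. mul c (w t) + z t"] conjI)
      (simp_all only: T.add T.scale u scale_zero_right add_0_left)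
qed

section \<open>Group law, uniform continuity and mixing\<close>

lemma group: "operator_semigroup mul (Euclidean_space k) T"
  unfolding operator_semigroup_def by (intro conjI ballI T_linear T_continuous T_0 T_add)

lemma group_uniformly_continuous: "uniformly_continuous_family (Euclidean_space k) T"
  unfolding uniformly_continuous_family_def
proof (intro exI[of _ "{z. q m0 (z - 0) < 1}"] conjI allI impI)
  show "0 \<in> interior {z. q m0 (z - 0) < 1}" unfolding interior_open[OF open_q_less] by simp
  fix t \<tau> W
  assume "(\<forall>n. \<tau> n \<in> topspace (Euclidean_space k)) \<and> limitin (Euclidean_space k) \<tau> t sequentially"
    and W: "open W \<and> (0::'a) \<in> W"
  then have "limitin (product_topology (\<lambda>i. euclideanreal) UNIV) \<tau> t sequentially"
    unfolding Euclidean_space_def limitin_subtopology by blast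
  then have lim: "(\<lambda>l. \<tau> l i) \<longlonglongrightarrow> t i" for i
    unfolding limitin_componentwise by simp
  obtain j e where e: "0 < e" "\<And>z. q j (z - 0) < e \<Longrightarrow> z \<in> W" 
    by (rule open_q_ball[of W 0]) (use W that in blast)+
  have "\<forall>\<^sub>F l in sequentially. \<Delta> j (\<tau> l) t < e"
    using order_tendstoD(2)[OF \<Delta>_tendsto_0[OF lim] e(1)] .
  then show "\<forall>\<^sub>F n in sequentially. \<forall>z\<in>{z. q m0 (z - 0) < 1}. T (\<tau> n) z - T t z \<in> W"
  proof eventually_elim
    case (elim l)
    show ?case
    proof
      fix z assume "z \<in> {z. q m0 (z - 0) < 1}"
      then have "\<Delta> j (\<tau> l) t * q m0 z \<le> \<Delta> j (\<tau> l) t * 1"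
        by (intro mult_left_mono \<Delta>_nonneg) auto
      then have "q j (T (\<tau> l) z - T t z) < e" using q_T_diff_le[of j "\<tau> l" z t] elim by linarith
      then show "T (\<tau> l) z - T t z \<in> W" using e(2) by simp
    qed
  qed
qed

lemma group_mixing: "mixing_family (Euclidean_space k) (\<lambda>t. L2_set t {..<k}) T"
  unfolding mixing_family_def
proof (intro allI impI)
  fix U V :: "'a set" assume UV: "open U \<and> U \<noteq> {} \<and> open V \<and> V \<noteq> {}"
  interpret T: Vector_Spaces.linear mul mul "T r" for r by (rule T_linear)
  have dense_meets: "\<exists>u\<in>W. u \<in> span (range y)" if "open W" "W \<noteq> {}" for W
    using open_Int_closure_eq_empty[OF that(1), of "span (range y)"] that(2) dense span_y by auto
  obtain u v where u: "u \<in> U" "u \<in> span (range y)" and v: "v \<in> V" "v \<in> span (range y)"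
    using dense_meets UV by metis
  obtain z1 where z1: "(z1 \<longlongrightarrow> v) (l1_infinity k)" "((\<lambda>t. T (- t) (z1 t)) \<longlongrightarrow> 0) (l1_infinity k)"
    using recover v by blast
  obtain z2 where z2: "(z2 \<longlongrightarrow> u) (l1_infinity k)" "((\<lambda>t. T (- t) (z2 t)) \<longlongrightarrow> 0) (l1_infinity k)"
    using recover u by blast
  have minus: "filterlim uminus (l1_infinity k) (l1_infinity k)"
    unfolding filterlim_filtercomap_iff by (simp add: o_def filterlim_filtercomap)
  \<comment> \<open>The first summand is small and \<open>T t\<close> carries it close to
    \<open>v\<close>; the second is close to \<open>u\<close> and \<open>T t\<close> makes it small.
    The second uses \<open>recover\<close> at \<open>- t\<close>, which is harmless as
    \<open>l1_infinity\<close> is symmetric.\<close>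
  define w where "w t = T (- t) (z1 t) + z2 (- t)" for t
  have w: "(w \<longlongrightarrow> 0 + u) (l1_infinity k)"
    unfolding w_def[abs_def] by (intro tendsto_add z1 filterlim_compose[OF z2(1) minus])
  have Tw: "T t (w t) = z1 t + T t (z2 (- t))" for t
  proof -
    have "T t (T (- t) (z1 t)) = z1 t"
      using fun_cong[OF T_add[of "- t" t], of "z1 t"] unfolding left_minus T_0 by (simp only: o_apply id_apply)
    then show ?thesis unfolding w_def T.add by (simp only:)
  qed
  have "((\<lambda>t. T (- (- t)) (z2 (- t))) \<longlongrightarrow> 0) (l1_infinity k)"
    using filterlim_compose[OF z2(2) minus] .
  then have "((\<lambda>t. z1 t + T t (z2 (- t))) \<longlongrightarrow> v + 0) (l1_infinity k)"
    unfolding minus_minus by (intro tendsto_add z1)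
  then have "\<forall>\<^sub>F t in l1_infinity k. T t (w t) \<in> V"
    unfolding Tw[symmetric] add_0_right using UV v topological_tendstoD by blast
  moreover have "\<forall>\<^sub>F t in l1_infinity k. w t \<in> U" using w UV u topological_tendstoD unfolding add_0_left by blast
  ultimately have "\<forall>\<^sub>F t in l1_infinity k. T t ` U \<inter> V \<noteq> {}" by eventually_elim blast
  then obtain r where r: "\<And>t. l1_norm k t > r \<Longrightarrow> T t ` U \<inter> V \<noteq> {}"
    unfolding eventually_filtercomap_at_top_dense by blast
  show "\<exists>r>0. \<forall>t\<in>topspace (Euclidean_space k). L2_set t {..<k} > r \<longrightarrow> T t ` U \<inter> V \<noteq> {}"
  proof (intro exI[of _ "max 1 r"] conjI ballI impI)
    fix t assume "L2_set t {..<k} > max 1 r"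
    moreover have "L2_set t {..<k} \<le> l1_norm k t" unfolding l1_norm_def by (rule L2_set_le_sum_abs)
    ultimately show "T t ` U \<inter> V \<noteq> {}" by (intro r) simp
  qed auto
qed

end

section \<open>Biorthogonal sequences and the space of all sequences\<close>

context vector_space
begin

lemma biorthogonal_card_le:
  fixes n :: nat
  assumes "finite B" "\<And>i. i < n \<Longrightarrow> b i \<in> span B"
    and f: "\<And>i. i < n \<Longrightarrow> Vector_Spaces.linear scale (*) (f i)"
    and bi: "\<And>i j. i < n \<Longrightarrow> j < n \<Longrightarrow> f i (b j) = of_bool (i = j)"
  shows "n \<le> card B"
proof -
  have inj: "inj_on b {..<n}"
  proof (rule inj_onI)
    fix i j assume "i \<in> {..<n}" "j \<in> {..<n}" "b i = b j"
    then show "i = j" using bi[of i i] bi[of i j] by (auto split: if_splits)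
  qed
  have "independent (b ` {..<n})"
  proof
    assume "dependent (b ` {..<n})"
    then obtain u j where u: "(\<Sum>v\<in>b ` {..<n}. scale (u v) v) = 0" and j: "j < n" "u (b j) \<noteq> 0"
      using dependent_finite[of "b ` {..<n}"] by auto
    interpret f: Vector_Spaces.linear scale "(*)" "f j" using f j by blast
    have "0 = f j (\<Sum>i<n. scale (u (b i)) (b i))"
      using u by (simp add: sum.reindex[OF inj] f.zero)
    also have "\<dots> = (\<Sum>i<n. u (b i) * f j (b i))" by (simp add: f.sum f.scale)
    also have "\<dots> = (\<Sum>i<n. if i = j then u (b i) else 0)"
      by (rule sum.cong) (use bi j in auto)
    also have "\<dots> = u (b j)" using j by simp
    finally show False using j by simp
  qed
  moreover have "b ` {..<n} \<subseteq> span B" using assms(2) by auto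
  ultimately have "card (b ` {..<n}) \<le> card B" using independent_span_bound assms(1) by blast
  then show ?thesis by (simp add: card_image[OF inj])
qed

end

context graded_frechet
begin

text \<open>A functional \<open>h\<close> with \<open>h z \<noteq> 0\<close> is made to vanish at
  the \<open>x i\<close> by subtracting multiples of the \<open>f i\<close>. These vanish at
  \<open>z\<close>, so the value at \<open>z\<close> survives, and all bounds are by the same
  \<open>q m\<close>.\<close>

lemma functional_extend:
  fixes n :: nat
  assumes z: "q m z \<noteq> 0" "\<And>i. i < n \<Longrightarrow> f i z = 0"
    and f: "\<And>i. i < n \<Longrightarrow> Vector_Spaces.linear mul (*) (f i)"
    and bound: "\<And>i. i < n \<Longrightarrow> \<exists>C. \<forall>y. norm (f i y) \<le> C * q m y"
    and bi: "\<And>i j. i < n \<Longrightarrow> j < n \<Longrightarrow> f i (x j) = of_bool (i = j)"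
  shows "\<exists>g. Vector_Spaces.linear mul (*) g \<and> (\<exists>C. \<forall>y. norm (g y) \<le> C * q m y) \<and>
    g z = 1 \<and> (\<forall>i<n. g (x i) = 0)"
proof -
  obtain h C where h: "Vector_Spaces.linear mul (*) h" "\<And>y. norm (h y) \<le> C * q m y" "h z \<noteq> 0"
    using functional_exists[OF z(1)] by blast
  interpret h: Vector_Spaces.linear mul "(*)" h by fact
  obtain K where K: "\<And>i y. i < n \<Longrightarrow> norm (f i y) \<le> K i * q m y" using bound by metis
  define g where "g y = (h y - (\<Sum>i<n. h (x i) * f i y)) / h z" for y
  have "Vector_Spaces.linear mul (*) g"
  proof unfold_locales
    fix u v c
    have "f i (u + v) = f i u + f i v" "f i (mul c u) = c * f i u" if "i < n" for i
    proof -
      interpret fi: Vector_Spaces.linear mul "(*)" "f i" using f that by blast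
      show "f i (u + v) = f i u + f i v" "f i (mul c u) = c * f i u" by (rule fi.add, rule fi.scale)
    qed
    then show "g (u + v) = g u + g v" "g (mul c u) = c * g u"
      using h(3) by (simp_all add: g_def h.add h.scale distrib_left sum.distrib field_simps sum_distrib_left)
  qed
  moreover have "norm (g y) \<le> (C + (\<Sum>i<n. norm (h (x i)) * K i)) / norm (h z) * q m y" for y
  proof -
    have "norm (h y - (\<Sum>i<n. h (x i) * f i y)) \<le> norm (h y) + (\<Sum>i<n. norm (h (x i)) * norm (f i y))"
      by (intro order_trans[OF norm_triangle_ineq4] add_left_mono order_trans[OF norm_sum] sum_mono)
        (simp add: norm_mult)
    also have "\<dots> \<le> C * q m y + (\<Sum>i<n. norm (h (x i)) * (K i * q m y))"
      by (intro add_mono h sum_mono mult_left_mono K) auto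
    also have "\<dots> = (C + (\<Sum>i<n. norm (h (x i)) * K i)) * q m y"
      by (simp add: distrib_right sum_distrib_right mult.assoc)
    finally show ?thesis unfolding g_def norm_divide times_divide_eq_left by (rule divide_right_mono) simp
  qed
  moreover have "g z = 1" unfolding g_def using z(2) h(3) by simp
  moreover have "g (x j) = 0" if "j < n" for j
  proof -
    have "(\<Sum>i<n. h (x i) * f i (x j)) = (\<Sum>i<n. if i = j then h (x i) else 0)"
      by (rule sum.cong) (use bi that in auto)
    then show ?thesis using that by (simp add: g_def)
  qed
  ultimately show ?thesis by blast
qed

lemma project_kernel:
  fixes n :: nat
  assumes f: "\<And>i. i < n \<Longrightarrow> Vector_Spaces.linear mul (*) (f i)"
    and bi: "\<And>i j. i < n \<Longrightarrow> j < n \<Longrightarrow> f i (x j) = of_bool (i = j)"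
    and "j < n"
  shows "f j (w - (\<Sum>i<n. mul (f i w) (x i))) = 0"
proof -
  interpret fj: Vector_Spaces.linear mul "(*)" "f j" using f assms(3) by blast
  have "f j (\<Sum>i<n. mul (f i w) (x i)) = (\<Sum>i<n. f i w * f j (x i))"
    by (simp add: fj.sum fj.scale)
  also have "\<dots> = (\<Sum>i<n. if i = j then f i w else 0)"
    by (rule sum.cong) (use bi assms(3) in auto)
  finally show ?thesis using assms(3) by (simp add: fj.diff)
qed

lemma biorthogonal_of_pairs:
  fixes n m :: nat
  assumes "\<And>n. f n (x n) = (1 :: 'k)" "\<And>n i. i < n \<Longrightarrow> f n (x i) = 0" "\<And>n i. i < n \<Longrightarrow> f i (x n) = 0"
  shows "f n (x m) = of_bool (n = m)"
  using assms by (cases n m rule: linorder_cases) auto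

text \<open>Gram-Schmidt with functionals in place of an inner product: \<open>x n\<close> is
  \<open>d n\<close> minus its component \<open>s (d n)\<close> in the span of the earlier vectors,
  perturbed if \<open>q m0\<close> does not see it. So \<open>d n\<close> is nearly in the span of
  the vectors up to \<open>x n\<close>.\<close>

lemma dense_biorthogonal_exists:
  assumes inf: "\<not> (\<exists>B. finite B \<and> (\<forall>w. \<exists>b\<in>span B. q m0 (w - b) = 0))"
    and sep: "separable_space (euclidean :: 'a topology)"
  shows "\<exists>(x :: nat \<Rightarrow> 'a) f C. (\<forall>n. Vector_Spaces.linear mul (*) (f n)) \<and>
    (\<forall>n y. norm (f n y) \<le> C n * q m0 y) \<and> (\<forall>n m. f n (x m) = of_bool (n = m)) \<and>
    closure (span (range x)) = UNIV"
proof -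
  obtain D :: "'a set" where D: "countable D" "closure D = UNIV"
    using sep unfolding separable_space_def by auto
  \<comment> \<open>Every point of \<open>D\<close> is listed infinitely often, hence approximated
    for larger and larger seminorms with errors tending to 0.\<close>
  define d where "d n = from_nat_into D (fst (prod_decode n))" for n
  define P :: "(nat \<Rightarrow> 'a \<times> ('a \<Rightarrow> 'k)) \<Rightarrow> nat \<Rightarrow> 'a \<times> ('a \<Rightarrow> 'k) \<Rightarrow> bool"
    where "P u n r \<longleftrightarrow> Vector_Spaces.linear mul (*) (snd r) \<and> (\<exists>C. \<forall>y. norm (snd r y) \<le> C * q m0 y) \<and>
      snd r (fst r) = 1 \<and> (\<forall>i<n. snd r (fst (u i)) = 0) \<and> (\<forall>i<n. snd (u i) (fst r) = 0) \<and>
      (\<exists>b\<in>span ((\<lambda>i. fst (u i)) ` {..<n}). q n (fst r + b - d n) < 1 / real (Suc n))" for u n r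
  have "\<exists>u. \<forall>n. P u n (u n)"
  proof (rule dependent_wellorder_choice)
    fix r n and u v :: "nat \<Rightarrow> 'a \<times> ('a \<Rightarrow> 'k)"
    assume "\<And>y. y < n \<Longrightarrow> u y = v y"
    then have "(\<lambda>i. fst (u i)) ` {..<n} = (\<lambda>i. fst (v i)) ` {..<n}"
      "\<And>i. i < n \<Longrightarrow> u i = v i" by auto
    then show "P u n r = P v n r" unfolding P_def by simp
  next
    fix n and u :: "nat \<Rightarrow> 'a \<times> ('a \<Rightarrow> 'k)"
    assume IH: "\<And>i. i < n \<Longrightarrow> P u i (u i)"
    define x where "x i = fst (u i)" for i
    define f where "f i = snd (u i)" for i
    have lin: "\<And>i. i < n \<Longrightarrow> Vector_Spaces.linear mul (*) (f i)"
      and bound: "\<And>i. i < n \<Longrightarrow> \<exists>C. \<forall>y. norm (f i y) \<le> C * q m0 y"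
      and one: "\<And>i. i < n \<Longrightarrow> f i (x i) = 1"
      and zero: "\<And>i j. i < n \<Longrightarrow> j < i \<Longrightarrow> f i (x j) = 0"
        "\<And>i j. i < n \<Longrightarrow> j < i \<Longrightarrow> f j (x i) = 0"
      using IH unfolding P_def x_def f_def by blast+
    have bi: "f i (x j) = of_bool (i = j)" if "i < n" "j < n" for i j
      using one zero that by (cases i j rule: linorder_cases) auto
    define s where "s w = (\<Sum>i<n. mul (f i w) (x i))" for w
    have s_span: "s w \<in> span (x ` {..<n})" for w
      unfolding s_def by (intro span_sum span_scale span_base) auto
    have s_ker: "f j (w - s w) = 0" if "j < n" for j w
      unfolding s_def by (rule project_kernel[OF lin bi that])
    obtain w where w: "\<And>b. b \<in> span (x ` {..<n}) \<Longrightarrow> q m0 (w - b) \<noteq> 0"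
      using inf by (metis finite_imageI finite_lessThan)
    define v where "v = w - s w"
    have v: "q m0 v \<noteq> 0" "\<And>j. j < n \<Longrightarrow> f j v = 0"
      unfolding v_def using w s_span s_ker by auto
    have "\<exists>z. q m0 z \<noteq> 0 \<and> (\<forall>j<n. f j z = 0) \<and> q n (z + s (d n) - d n) < 1 / real (Suc n)"
    proof (cases "q m0 (d n - s (d n)) = 0")
      case False
      then show ?thesis by (intro exI[of _ "d n - s (d n)"]) (simp add: s_ker)
    next
      case True
      \<comment> \<open>Here the projection of \<open>d n\<close> is invisible to
        \<open>q m0\<close>. A multiple of \<open>v\<close>, which \<open>q m0\<close> sees since
        its kernel has infinite codimension, is added; \<open>e\<close> keeps the error below the
        tolerance for index \<open>n\<close>.\<close>
      define e where "e = 1 / real (Suc n) / (q n v + 1)"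
      have "e > 0" by (simp add: e_def add_nonneg_pos)
      have "e * q n v < e * (q n v + 1)" using \<open>e > 0\<close> by simp
      also have "\<dots> = 1 / real (Suc n)" using q_nonneg[of n v] by (simp add: e_def add_nonneg_eq_0_iff)
      finally have e: "e * q n v < 1 / real (Suc n)" .
      define z where "z = (d n - s (d n)) + mul (of_real e) v"
      have "q m0 (mul (of_real e) v) \<le> q m0 z + q m0 (d n - s (d n))"
        using q_diff[of m0 z "d n - s (d n)"] by (simp add: z_def)
      moreover have "q m0 (mul (of_real e) v) = e * q m0 v" using \<open>e > 0\<close> by (simp add: q_scale)
      moreover have "e * q m0 v > 0" using \<open>e > 0\<close> v(1) q_nonneg[of m0 v] by (simp add: less_le)
      ultimately have "q m0 z \<noteq> 0" using True by linarith
      moreover have "f j z = 0" if "j < n" for j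
      proof -
        interpret fj: Vector_Spaces.linear mul "(*)" "f j" using lin that by blast
        show ?thesis unfolding z_def fj.add fj.scale using s_ker[OF that] v(2)[OF that] by simp
      qed
      moreover have "q n (z + s (d n) - d n) < 1 / real (Suc n)"
        using e \<open>e > 0\<close> by (simp add: z_def q_scale)
      ultimately show ?thesis by blast
    qed
    then obtain z where z: "q m0 z \<noteq> 0" "\<And>j. j < n \<Longrightarrow> f j z = 0" "q n (z + s (d n) - d n) < 1 / real (Suc n)"
      by blast
    obtain g where "Vector_Spaces.linear mul (*) g" "\<exists>C. \<forall>y. norm (g y) \<le> C * q m0 y" "g z = 1" "\<forall>i<n. g (x i) = 0"
      using functional_extend[OF z(1,2) lin bound bi] by blast
    then have "P u n (z, g)"
      unfolding P_def using z s_span[of "d n"] unfolding x_def f_def by auto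
    then show "\<exists>r. P u n r" by blast
  qed
  then obtain u where u: "\<And>n. P u n (u n)" by blast
  define x where "x i = fst (u i)" for i
  define f where "f i = snd (u i)" for i
  have "\<exists>C. \<forall>y. norm (f n y) \<le> C * q m0 y" for n using u[of n] unfolding P_def f_def by blast
  then obtain C where C: "\<And>n y. norm (f n y) \<le> C n * q m0 y" by metis
  have lin: "Vector_Spaces.linear mul (*) (f n)" for n using u[of n] unfolding P_def f_def by blast
  have bi: "f n (x m) = of_bool (n = m)" for n m
  proof (rule biorthogonal_of_pairs[of f x])
    fix n i
    show "f n (x n) = 1" using u[of n] unfolding P_def x_def f_def by blast
    assume "i < n"
    then show "f n (x i) = 0" "f i (x n) = 0" using u[of n] unfolding P_def x_def f_def by blast+
  qed
  have "W \<inter> span (range x) \<noteq> {}" if W: "open W" "W \<noteq> {}" for W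
  proof -
    obtain w where "w \<in> W" using W by blast
    then obtain n0 e where e: "0 < e" "\<And>z. q n0 (z - w) < e \<Longrightarrow> z \<in> W" using open_q_ball W(1) by blast
    have "open {z. q n0 (z - w) < e / 2}" by (rule open_q_less)
    moreover have "w \<in> {z. q n0 (z - w) < e / 2}" using e(1) by simp
    ultimately have "{z. q n0 (z - w) < e / 2} \<inter> D \<noteq> {}"
      using D(2) open_Int_closure_eq_empty[of "{z. q n0 (z - w) < e / 2}" D] by blast
    then obtain d0 where d0: "d0 \<in> D" "q n0 (d0 - w) < e / 2" by blast
    then obtain i where i: "from_nat_into D i = d0" using from_nat_into_surj[OF D(1)] by blast
    define n where "n = prod_encode (i, max n0 (nat \<lceil>2 / e\<rceil>))"
    have "max n0 (nat \<lceil>2 / e\<rceil>) \<le> n" unfolding n_def by (rule le_prod_encode_2)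
    then have n: "n0 \<le> n" "2 / e \<le> real n" by (auto simp: nat_le_iff ceiling_le_iff)
    have dn: "d n = d0" unfolding d_def n_def using i by simp
    obtain b where b: "b \<in> span (x ` {..<n})" "q n (x n + b - d n) < 1 / real (Suc n)"
      using u[of n] unfolding P_def x_def by blast
    have "1 / real (Suc n) \<le> e / 2" using n(2) e(1) by (simp add: field_simps)
    then have "q n0 (x n + b - d0) < e / 2" using b(2) q_mono[OF n(1), of "x n + b - d n"] dn by simp
    then have "q n0 (x n + b - w) < e" using d0(2) q_triangle[of n0 "x n + b" w d0] by linarith
    then have "x n + b \<in> W" by (rule e(2))
    moreover have "x n + b \<in> span (range x)"
      using b(1) span_mono[of "x ` {..<n}" "range x"] span_base[of "x n" "range x"] by (intro span_add) auto
    ultimately show ?thesis by blast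
  qed
  then have dense: "closure (span (range x)) = UNIV"
    by (metis Compl_empty_eq closed_closure closure_subset disjoint_eq_subset_Compl double_complement inf_commute open_Compl)
  show ?thesis
    by (intro exI[of _ x] exI[of _ f] exI[of _ C] conjI allI lin C bi dense)
qed

text \<open>At each stage the seminorm index is the least one not vanishing on the common kernel of
  the functionals found so far. Thus all smaller seminorms are controlled by finitely many
  functionals. The indices are unbounded, so this eventually applies to every seminorm, and the
  sequence of functionals gives the coordinates of an isomorphism.\<close>

lemma isomorphic_omega:
  assumes fin: "\<And>m. \<exists>B. finite B \<and> (\<forall>w. \<exists>b\<in>span B. q m (w - b) = 0)"
    and inf: "infinite_dimensional mul"
  shows "isomorphic_tvs mul (omega_scale :: 'k \<Rightarrow> (nat \<Rightarrow> 'k) \<Rightarrow> nat \<Rightarrow> 'k)"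
proof -
  define P :: "(nat \<Rightarrow> 'a \<times> ('a \<Rightarrow> 'k) \<times> nat) \<Rightarrow> nat \<Rightarrow> 'a \<times> ('a \<Rightarrow> 'k) \<times> nat \<Rightarrow> bool"
    where "P u n r \<longleftrightarrow> (case r of (x, f, m) \<Rightarrow> Vector_Spaces.linear mul (*) f \<and>
      (\<exists>C. \<forall>y. norm (f y) \<le> C * q m y) \<and> f x = 1 \<and> (\<forall>i<n. f (fst (u i)) = 0) \<and>
      (\<forall>i<n. fst (snd (u i)) x = 0) \<and>
      (\<forall>j<m. \<forall>z. (\<forall>i<n. fst (snd (u i)) z = 0) \<longrightarrow> q j z = 0) \<and> q m x \<noteq> 0)" for u n r
  have "\<exists>u. \<forall>n. P u n (u n)"
  proof (rule dependent_wellorder_choice)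
    fix r n and u v :: "nat \<Rightarrow> 'a \<times> ('a \<Rightarrow> 'k) \<times> nat"
    assume "\<And>y. y < n \<Longrightarrow> u y = v y"
    then show "P u n r = P v n r" unfolding P_def by simp
  next
    fix n and u :: "nat \<Rightarrow> 'a \<times> ('a \<Rightarrow> 'k) \<times> nat"
    assume IH: "\<And>i. i < n \<Longrightarrow> P u i (u i)"
    define x where "x i = fst (u i)" for i
    define f where "f i = fst (snd (u i))" for i
    define m where "m i = snd (snd (u i))" for i
    have u: "u i = (x i, f i, m i)" for i by (simp add: x_def f_def m_def)
    have IH': "P u i (x i, f i, m i)" if "i < n" for i using IH[OF that] u by simp
    have lin: "\<And>i. i < n \<Longrightarrow> Vector_Spaces.linear mul (*) (f i)"
      and bound: "\<And>i. i < n \<Longrightarrow> \<exists>C. \<forall>y. norm (f i y) \<le> C * q (m i) y"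
      and one: "\<And>i. i < n \<Longrightarrow> f i (x i) = 1"
      and zero: "\<And>i j. i < n \<Longrightarrow> j < i \<Longrightarrow> f i (x j) = 0"
        "\<And>i j. i < n \<Longrightarrow> j < i \<Longrightarrow> f j (x i) = 0"
      and vanish: "\<And>i j z. i < n \<Longrightarrow> j < m i \<Longrightarrow> (\<forall>l<i. f l z = 0) \<Longrightarrow> q j z = 0"
      using IH' unfolding P_def x_def[symmetric] f_def[symmetric] by blast+
    have bi: "f i (x j) = of_bool (i = j)" if "i < n" "j < n" for i j
      using one zero that by (cases i j rule: linorder_cases) auto
    define s where "s w = (\<Sum>i<n. mul (f i w) (x i))" for w
    have s_span: "s w \<in> span (x ` {..<n})" for w
      unfolding s_def by (intro span_sum span_scale span_base) auto
    have s_ker: "f j (w - s w) = 0" if "j < n" for j w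
      unfolding s_def by (rule project_kernel[OF lin bi that])
    have "span (x ` {..<n}) \<noteq> UNIV"
      using inf unfolding infinite_dimensional_def by (metis finite_imageI finite_lessThan)
    then obtain w where "w \<notin> span (x ` {..<n})" by blast
    then have "w - s w \<noteq> 0" using s_span[of w] by auto
    then obtain m1 where "q m1 (w - s w) \<noteq> 0" using q_separates by blast
    then have ex: "\<exists>m z. (\<forall>i<n. f i z = 0) \<and> q m z \<noteq> 0" using s_ker by blast
    define M where "M = (LEAST m. \<exists>z. (\<forall>i<n. f i z = 0) \<and> q m z \<noteq> 0)"
    obtain z where z: "\<And>i. i < n \<Longrightarrow> f i z = 0" "q M z \<noteq> 0"
      using LeastI_ex[OF ex] unfolding M_def by blast
    have least: "q j z = 0" if "j < M" "\<forall>i<n. f i z = 0" for j z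
      using not_less_Least[of j] that unfolding M_def by blast
    have m_le: "m i \<le> M" if "i < n" for i
    proof (rule ccontr)
      assume "\<not> m i \<le> M"
      then have "q M z = 0" using vanish[of i M z] z(1) that by simp
      then show False using z by simp
    qed
    then have bound': "\<exists>C. \<forall>y. norm (f i y) \<le> C * q M y" if i: "i < n" for i
    proof -
      obtain C where C: "\<And>y. norm (f i y) \<le> C * q (m i) y" using bound[OF i] by blast
      have "C * q (m i) y \<le> \<bar>C\<bar> * q M y" for y
        using q_mono[OF m_le[OF i], of y] by (intro mult_mono) auto
      then show ?thesis using C order_trans by blast
    qed
    obtain g where "Vector_Spaces.linear mul (*) g" "\<exists>C. \<forall>y. norm (g y) \<le> C * q M y" "g z = 1" "\<forall>i<n. g (x i) = 0"
      using functional_extend[OF z(2,1) lin bound' bi] by blast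
    then have "P u n (z, g, M)"
      unfolding P_def using z least unfolding x_def f_def by auto
    then show "\<exists>r. P u n r" by blast
  qed
  then obtain u where u: "\<And>n. P u n (u n)" by blast
  define x where "x i = fst (u i)" for i
  define f where "f i = fst (snd (u i))" for i
  define m where "m i = snd (snd (u i))" for i
  have "u i = (x i, f i, m i)" for i by (simp add: x_def f_def m_def)
  then have P: "P u i (x i, f i, m i)" for i using u[of i] by simp
  have lin: "\<And>i. Vector_Spaces.linear mul (*) (f i)"
    and bound: "\<And>i. \<exists>C. \<forall>y. norm (f i y) \<le> C * q (m i) y"
    and one: "\<And>i. f i (x i) = 1"
    and zero: "\<And>i j. j < i \<Longrightarrow> f i (x j) = 0" "\<And>i j. j < i \<Longrightarrow> f j (x i) = 0"
    and vanish: "\<And>i j z. j < m i \<Longrightarrow> (\<forall>l<i. f l z = 0) \<Longrightarrow> q j z = 0"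
    using P unfolding P_def x_def[symmetric] f_def[symmetric] by blast+
  have bi: "f i (x j) = of_bool (i = j)" for i j
    by (rule biorthogonal_of_pairs[of f x]) (use one zero in auto)
  obtain C where C: "\<And>n y. norm (f n y) \<le> C n * q (m n) y" using bound by metis
  \<comment> \<open>If \<open>j\<close> bounded all indices, every \<open>f i\<close> would vanish
    on the kernel of \<open>q j\<close>. The vectors \<open>x n\<close> could then be replaced by
    elements of the finite-dimensional \<open>span B\<close> without changing the values of the
    functionals, which contradicts biorthogonality.\<close>
  have unbounded: "\<exists>n. j < m n" for j
  proof (rule ccontr)
    assume "\<nexists>n. j < m n"
    then have le: "m n \<le> j" for n by (meson not_less)
    obtain B where B: "finite B" "\<forall>w. \<exists>b\<in>span B. q j (w - b) = 0" using fin by blast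
    have "\<exists>b. \<forall>n. b n \<in> span B \<and> q j (x n - b n) = 0"
      using B(2) by (intro choice) blast
    then obtain b where b: "\<And>n. b n \<in> span B" "\<And>n. q j (x n - b n) = 0" by blast
    have "f i (b n) = of_bool (i = n)" for i n
    proof -
      interpret fi: Vector_Spaces.linear mul "(*)" "f i" by (rule lin)
      have "q (m i) (x n - b n) = 0" using q_mono[OF le[of i], of "x n - b n"] b(2)[of n] q_nonneg[of "m i" "x n - b n"] by linarith
      then have "f i (x n - b n) = 0" using C[of i "x n - b n"] by simp
      then show ?thesis using bi[of i n] by (simp add: fi.diff)
    qed
    then have "Suc (card B) \<le> card B"
      by (intro biorthogonal_card_le[where b = b and f = f] B(1) b(1) lin)
    then show False by simp
  qed
  then obtain N where N: "\<And>j. j < m (N j)" by metis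
  have q_le: "q j z \<le> (\<Sum>i<N j. norm (f i z) * q j (x i))" for j z
  proof -
    define s where "s = (\<Sum>i<N j. mul (f i z) (x i))"
    have "q j (z - s) = 0"
    proof (rule vanish[OF N], safe)
      fix l assume "l < N j"
      then show "f l (z - s) = 0" unfolding s_def by (intro project_kernel lin bi)
    qed
    then have "q j z \<le> q j s" using q_add[of j "z - s" s] by simp
    also have "\<dots> \<le> (\<Sum>i<N j. q j (mul (f i z) (x i)))" unfolding s_def by (rule q_sum)
    finally show ?thesis by (simp add: q_scale)
  qed
  define J where "J z = (\<lambda>n. f n z)" for z
  \<comment> \<open>The inverse of \<open>J\<close>. The series converges for arbitrary coefficients
    because \<open>q j (x n) = 0\<close> for \<open>n \<ge> N j\<close>.\<close>
  define G where "G c = (\<Sum>n. mul (c n) (x n))" for c :: "nat \<Rightarrow> 'k"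
  have G_sums: "(\<lambda>n. mul (c n) (x n)) sums G c" for c
    unfolding G_def
  proof (intro summable_sums summable_q)
    fix j
    have "q j (x n) = 0" if "n \<notin> {..<N j}" for n
      using vanish[OF N[of j], of "x n"] zero that by auto
    then show "summable (\<lambda>n. q j (mul (c n) (x n)))"
      by (intro summable_finite[of "{..<N j}"]) (auto simp: q_scale)
  qed
  have JG: "J (G c) = c" for c
  proof
    fix n
    interpret fn: Vector_Spaces.linear mul "(*)" "f n" by (rule lin)
    have "(\<lambda>K. f n (\<Sum>i<K. mul (c i) (x i))) \<longlonglongrightarrow> f n (G c)"
      using continuous_on_functional[OF lin C, of n] G_sums[of c] unfolding sums_def
      by (intro continuous_on_tendsto_compose[where s = UNIV and f = "f n"]) auto
    moreover have "f n (\<Sum>i<K. mul (c i) (x i)) = c n" if "n < K" for K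
    proof -
      have "f n (\<Sum>i<K. mul (c i) (x i)) = (\<Sum>i<K. if i = n then c i else 0)"
        unfolding fn.sum fn.scale by (rule sum.cong) (use bi in auto)
      then show ?thesis using that by simp
    qed
    then have "\<forall>\<^sub>F K in sequentially. f n (\<Sum>i<K. mul (c i) (x i)) = c n"
      by (rule eventually_mono[OF eventually_gt_at_top[of n]])
    then have "(\<lambda>K. f n (\<Sum>i<K. mul (c i) (x i))) \<longlonglongrightarrow> c n" by (rule tendsto_eventually)
    ultimately show "J (G c) n = c n" unfolding J_def by (rule LIMSEQ_unique)
  qed
  have GJ: "G (J z) = z" for z
  proof -
    have "q j (G (J z) - z) \<le> 0" for j
    proof -
      have "f i (G (J z) - z) = 0" for i
      proof -
        interpret fi: Vector_Spaces.linear mul "(*)" "f i" by (rule lin)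
        show ?thesis using fun_cong[OF JG[of "J z"], of i] by (simp add: fi.diff J_def)
      qed
      then show ?thesis using q_le[of j "G (J z) - z"] by simp
    qed
    then have "G (J z) - z = 0" using q_nonneg by (intro q_separates) (simp add: eq_iff)
    then show ?thesis by simp
  qed
  have "Vector_Spaces.linear mul omega_scale J"
  proof -
    interpret o: vector_space "omega_scale :: 'k \<Rightarrow> (nat \<Rightarrow> 'k) \<Rightarrow> nat \<Rightarrow> 'k"
      by unfold_locales (auto simp: omega_scale_def fun_eq_iff algebra_simps)
    show ?thesis
    proof unfold_locales
      fix y z c
      interpret fi: Vector_Spaces.linear mul "(*)" "f i" for i by (rule lin)
      show "J (y + z) = J y + J z" "J (mul c y) = omega_scale c (J y)"
        by (auto simp: J_def omega_scale_def fi.add fi.scale)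
    qed
  qed
  moreover have "homeomorphic_maps euclidean euclidean J G"
    unfolding homeomorphic_maps_def
  proof (intro conjI ballI)
    have "continuous_on UNIV J" unfolding J_def[abs_def]
      by (intro continuous_on_coordinatewise_then_product continuous_on_functional[OF lin C])
    then show "continuous_map euclidean euclidean J" by simp
    have "continuous_on UNIV G" unfolding continuous_on_def tendsto_q_iff
    proof (intro ballI allI)
      fix c :: "nat \<Rightarrow> 'k" and j
      have ci: "((\<lambda>c'. c' i) \<longlongrightarrow> c i) (at c)" for i
        using continuous_on_product_coordinates[of i] unfolding continuous_on_def by auto
      have "((\<lambda>c'. \<Sum>i<N j. norm (c' i - c i) * q j (x i)) \<longlongrightarrow> (\<Sum>i<N j. norm (c i - c i) * q j (x i))) (at c)"
        by (intro tendsto_intros ci)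
      then have lim: "((\<lambda>c'. \<Sum>i<N j. norm (c' i - c i) * q j (x i)) \<longlongrightarrow> 0) (at c)" by simp
      show "((\<lambda>c'. q j (G c' - G c)) \<longlongrightarrow> 0) (at c)"
      proof (rule tendsto_sandwich[OF _ _ tendsto_const lim])
        show "\<forall>\<^sub>F c' in at c. q j (G c' - G c) \<le> (\<Sum>i<N j. norm (c' i - c i) * q j (x i))"
        proof (rule always_eventually, rule allI)
          fix c'
          have "f i (G c' - G c) = c' i - c i" for i
          proof -
            interpret fi: Vector_Spaces.linear mul "(*)" "f i" by (rule lin)
            show ?thesis using fun_cong[OF JG[of c], of i] fun_cong[OF JG[of c'], of i] by (simp add: fi.diff J_def)
          qed
          then show "q j (G c' - G c) \<le> (\<Sum>i<N j. norm (c' i - c i) * q j (x i))"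
            using q_le[of j "G c' - G c"] by simp
        qed
      qed auto
    qed
    then show "continuous_map euclidean euclidean G" by simp
  qed (auto simp: JG GJ)
  ultimately show ?thesis
    unfolding isomorphic_tvs_def using homeomorphic_maps_imp_map by blast
qed

end

section \<open>Mixing groups yield supercyclic semigroups\<close>

lemma closure_eq_UNIV_I:
  assumes "\<And>W. open W \<Longrightarrow> W \<noteq> {} \<Longrightarrow> A \<inter> W \<noteq> {}"
  shows "closure A = UNIV"
proof (rule ccontr)
  assume "closure A \<noteq> UNIV"
  then have "- closure A \<noteq> {}" by blast
  then have "A \<inter> - closure A \<noteq> {}" by (intro assms open_Compl closed_closure)
  then show False using closure_subset[of A] by blast
qed

context graded_frechet
begin

lemma mixing_groups_exist:
  assumes "separable_space (euclidean :: 'a topology)" "infinite_dimensional mul"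
    and "\<not> isomorphic_tvs mul (omega_scale :: 'k \<Rightarrow> (nat \<Rightarrow> 'k) \<Rightarrow> nat \<Rightarrow> 'k)"
  shows "has_mixing_groups mul"
  unfolding has_mixing_groups_def
proof (intro allI impI)
  fix k :: nat
  obtain m0 where m0: "\<not> (\<exists>B. finite B \<and> (\<forall>w. \<exists>b\<in>span B. q m0 (w - b) = 0))"
    using isomorphic_omega assms(2,3) by blast
  obtain x :: "nat \<Rightarrow> 'a" and f C where x: "\<And>n. Vector_Spaces.linear mul (*) (f n)"
    "\<And>n y. norm (f n y) \<le> C n * q m0 y" "\<And>n m. f n (x m) = of_bool (n = m)"
    "closure (span (range x)) = UNIV"
    using dense_biorthogonal_exists[OF m0 assms(1)] by blast
  obtain a where a: "translation_system k a" using translation_system_exists by blast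
  interpret translation_group mul q k a m0 x f C
    by (intro translation_group.intro graded_frechet_axioms a translation_group_axioms.intro x)
  show "\<exists>T. operator_semigroup mul (Euclidean_space k) T \<and> uniformly_continuous_family (Euclidean_space k) T \<and>
    mixing_family (Euclidean_space k) (\<lambda>t. L2_set t {..<k}) T"
    using group group_uniformly_continuous group_mixing by blast
qed

text \<open>Baire's argument with nested closed seminorm balls: the ball of stage
  \<open>n + 1\<close> is mapped into \<open>V n\<close> by some \<open>S t\<close>. Radii tend to 0
  while seminorm indices tend to infinity, so the centres are Cauchy for every seminorm and their
  limit lies in all the balls.\<close>

lemma common_point_of_orbits:
  fixes S :: "'t \<Rightarrow> 'a \<Rightarrow> 'a"
  assumes cont: "\<And>t. t \<in> A \<Longrightarrow> continuous_on UNIV (S t)"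
    and trans: "\<And>U V. open U \<Longrightarrow> U \<noteq> {} \<Longrightarrow> open V \<Longrightarrow> V \<noteq> {} \<Longrightarrow> \<exists>t\<in>A. S t ` U \<inter> V \<noteq> {}"
    and V: "\<And>n. open (V n)" "\<And>n. V n \<noteq> ({} :: 'a set)"
  shows "\<exists>l. \<forall>n::nat. \<exists>t\<in>A. S t l \<in> V n"
proof -
  define ball :: "'a \<times> nat \<times> real \<Rightarrow> 'a set" where "ball s = (case s of (x, m, e) \<Rightarrow> {z. q m (z - x) \<le> e})" for s
  define P :: "nat \<Rightarrow> 'a \<times> nat \<times> real \<Rightarrow> bool"
    where "P n s = (case s of (x, m, e) \<Rightarrow> 0 < e \<and> e \<le> 1 / real (Suc n) \<and> n \<le> m)" for n s
  have "\<exists>f. \<forall>n. P n (f n) \<and> (ball (f (Suc n)) \<subseteq> ball (f n) \<and> (\<exists>t\<in>A. \<forall>z\<in>ball (f (Suc n)). S t z \<in> V n))"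
  proof (rule dependent_nat_choice)
    show "\<exists>s. P 0 s" by (intro exI[of _ "(0, 0, 1)"]) (simp add: P_def)
    fix s n assume s: "P n s"
    obtain x m e where sx: "s = (x, m, e)" by (cases s) auto
    have e: "0 < e" using s by (simp add: sx P_def)
    have "open {z. q m (z - x) < e}" by (rule open_q_less)
    moreover have "x \<in> {z. q m (z - x) < e}" using e by simp
    ultimately obtain t u where t: "t \<in> A" and u: "q m (u - x) < e" "S t u \<in> V n"
      using trans[of "{z. q m (z - x) < e}" "V n"] V by blast
    have "open ({z. q m (z - x) < e} \<inter> S t -` V n)"
      using cont[OF t] V by (intro open_Int open_q_less) (simp add: open_vimage)
    moreover have "u \<in> {z. q m (z - x) < e} \<inter> S t -` V n" using u by simp
    ultimately obtain m1 e1 where e1: "0 < e1" "\<And>z. q m1 (z - u) < e1 \<Longrightarrow> z \<in> {z. q m (z - x) < e} \<inter> S t -` V n"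
      by (rule open_q_ball) blast
    define s' where "s' = (u, max m1 (Suc n), min (e1 / 2) (1 / real (Suc (Suc n))))"
    have sub: "z \<in> {z. q m (z - x) < e} \<inter> S t -` V n" if "z \<in> ball s'" for z
    proof (rule e1(2))
      have "q m1 (z - u) \<le> q (max m1 (Suc n)) (z - u)" by (rule q_mono) simp
      also have "\<dots> \<le> e1 / 2" using that by (simp add: ball_def s'_def)
      finally show "q m1 (z - u) < e1" using e1(1) by simp
    qed
    have "P (Suc n) s'" using e1(1) by (simp add: P_def s'_def)
    moreover have "ball s' \<subseteq> ball s" using sub by (fastforce simp: ball_def sx)
    moreover have "\<exists>t\<in>A. \<forall>z\<in>ball s'. S t z \<in> V n" using sub t by blast
    ultimately show "\<exists>s'. P (Suc n) s' \<and> (ball s' \<subseteq> ball s \<and> (\<exists>t\<in>A. \<forall>z\<in>ball s'. S t z \<in> V n))" by blast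
  qed
  then obtain f where f: "\<And>n. P n (f n)" "\<And>n. ball (f (Suc n)) \<subseteq> ball (f n)"
    "\<And>n. \<exists>t\<in>A. \<forall>z\<in>ball (f (Suc n)). S t z \<in> V n" by blast
  define x where "x n = fst (f n)" for n
  define m where "m n = fst (snd (f n))" for n
  define e where "e n = snd (snd (f n))" for n
  have fx: "f n = (x n, m n, e n)" for n by (simp add: x_def m_def e_def)
  have e: "0 < e n" "e n \<le> 1 / real (Suc n)" "n \<le> m n" for n using f(1)[of n] by (simp_all add: fx P_def)
  have anti: "ball (f i) \<subseteq> ball (f n)" if "n \<le> i" for i n
    using that f(2) by (rule lift_Suc_antimono_le[rotated])
  then have in_ball: "q (m n) (x i - x n) \<le> e n" if "n \<le> i" for i n
  proof -
    have "x i \<in> ball (f i)" using e(1)[of i] by (simp add: ball_def fx)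
    then have "x i \<in> ball (f n)" using anti[OF that] by blast
    then show ?thesis by (simp add: ball_def fx)
  qed
  have "\<exists>l. x \<longlonglongrightarrow> l"
  proof (rule q_complete)
    fix k and d :: real assume "0 < d"
    define n where "n = max k (nat \<lceil>2 / d\<rceil>)"
    have "2 / d \<le> real n" unfolding n_def by linarith
    then have n: "k \<le> n" "2 / real (Suc n) < d" using \<open>0 < d\<close> by (auto simp: n_def field_simps)
    show "\<exists>M. \<forall>i\<ge>M. \<forall>j\<ge>M. q k (x i - x j) < d"
    proof (intro exI[of _ n] allI impI)
      fix i j assume ij: "n \<le> i" "n \<le> j"
      have "q k (x i - x j) \<le> q (m n) (x i - x j)" using n(1) e(3)[of n] by (intro q_mono) simp
      also have "\<dots> \<le> q (m n) (x i - x n) + q (m n) (x n - x j)" by (rule q_triangle)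
      also have "\<dots> \<le> e n + e n"
        using in_ball[OF ij(1)] in_ball[OF ij(2)] by (simp add: q_minus_commute[of _ "x n"])
      also have "\<dots> \<le> 2 / real (Suc n)" using e(2)[of n] by simp
      also have "\<dots> < d" by (rule n(2))
      finally show "q k (x i - x j) < d" .
    qed
  qed
  then obtain l where l: "x \<longlonglongrightarrow> l" by blast
  have "l \<in> ball (f n)" for n
  proof -
    have "(\<lambda>i. q (m n) (x i - x n)) \<longlonglongrightarrow> q (m n) (l - x n)"
      using q_continuous[of "m n"] tendsto_diff[OF l tendsto_const[of "x n"]]
      by (intro continuous_on_tendsto_compose[where s = UNIV and f = "q (m n)"]) auto
    then have "q (m n) (l - x n) \<le> e n"
      by (rule Lim_bounded[where M = n]) (use in_ball in blast)
    then show ?thesis by (simp add: ball_def fx)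
  qed
  then show ?thesis using f(3) by blast
qed

lemma supercyclic_of_mixing:
  assumes "separable_space (euclidean :: 'a topology)" "has_mixing_groups mul"
  shows "has_supercyclic_semigroup mul"
proof -
  obtain T where T: "operator_semigroup mul (Euclidean_space 1) T"
    "uniformly_continuous_family (Euclidean_space 1) T" "mixing_family (Euclidean_space 1) (\<lambda>t. L2_set t {..<1}) T"
    using assms(2) unfolding has_mixing_groups_def by blast
  \<comment> \<open>The identification of the real line with the first coordinate axis, which is
    \<open>Euclidean_space 1\<close>.\<close>
  define \<epsilon> :: "real \<Rightarrow> nat \<Rightarrow> real" where "\<epsilon> s = (\<lambda>i. if i = 0 then s else 0)" for s
  have \<epsilon>_top: "\<epsilon> s \<in> topspace (Euclidean_space 1)" for s
    by (simp add: \<epsilon>_def topspace_Euclidean_space)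
  have \<epsilon>_0: "\<epsilon> 0 = 0" and \<epsilon>_add: "\<epsilon> (s + t) = \<epsilon> s + \<epsilon> t" for s t
    by (auto simp: \<epsilon>_def)
  define S where "S s = T (\<epsilon> s)" for s
  have lin: "Vector_Spaces.linear mul mul (S s)" and cont: "continuous_on UNIV (S s)" for s
    using T(1) \<epsilon>_top unfolding operator_semigroup_def S_def by blast+
  have "operator_semigroup mul (top_of_set {0..}) S"
    using T(1) \<epsilon>_top unfolding operator_semigroup_def S_def \<epsilon>_0 \<epsilon>_add by blast
  moreover have "strongly_continuous (top_of_set {0..}) S"
    unfolding strongly_continuous_def
  proof
    fix x
    have "continuous_on {0..} (\<lambda>t. S t x)"
    proof (rule continuous_on_sequentiallyI)
      fix u :: "nat \<Rightarrow> real" and a assume u: "u \<longlonglongrightarrow> a"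
      have lim: "limitin (Euclidean_space 1) (\<lambda>n. \<epsilon> (u n)) (\<epsilon> a) sequentially"
        unfolding Euclidean_space_def limitin_subtopology limitin_componentwise
        using u by (auto simp: \<epsilon>_def)
      obtain U where U: "0 \<in> interior U"
        "\<And>W. open W \<Longrightarrow> 0 \<in> W \<Longrightarrow> \<forall>\<^sub>F n in sequentially. \<forall>x\<in>U. T (\<epsilon> (u n)) x - T (\<epsilon> a) x \<in> W"
      proof -
        obtain U where "0 \<in> interior U" "\<forall>t \<tau>. (\<forall>n. \<tau> n \<in> topspace (Euclidean_space 1)) \<and>
            limitin (Euclidean_space 1) \<tau> t sequentially \<longrightarrow> (\<forall>W. open W \<and> 0 \<in> W \<longrightarrow>
            (\<forall>\<^sub>F n in sequentially. \<forall>x\<in>U. T (\<tau> n) x - T t x \<in> W))"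
          using T(2) unfolding uniformly_continuous_family_def by blast
        then show thesis using lim \<epsilon>_top by (intro that[of U]) simp_all
      qed
      \<comment> \<open>Uniform continuity speaks about \<open>U\<close> only, so \<open>x\<close>
        is scaled into \<open>U\<close> by a non-zero \<open>c\<close>; linearity carries
        convergence back to \<open>x\<close>.\<close>
      have "(\<lambda>n. mul (of_real (inverse (real (Suc n)))) x) \<longlonglongrightarrow> mul (of_real 0) x"
        by (intro tendsto_mul tendsto_of_real tendsto_const LIMSEQ_inverse_real_of_nat)
      then have "\<forall>\<^sub>F n in sequentially. mul (of_real (inverse (real (Suc n)))) x \<in> interior U"
        using U(1) by (intro topological_tendstoD) auto
      then obtain N where N: "mul (of_real (inverse (real (Suc N)))) x \<in> interior U"
        using eventually_happens'[OF sequentially_bot] by blast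
      define c :: 'k where "c = of_real (inverse (real (Suc N)))"
      have c: "mul c x \<in> U" "c \<noteq> 0"
        using N interior_subset unfolding c_def by (blast, simp del: of_nat_Suc)
      interpret S: Vector_Spaces.linear mul mul "S s" for s by (rule lin)
      have "(\<lambda>n. S (u n) (mul c x) - S a (mul c x)) \<longlonglongrightarrow> 0"
      proof (rule topological_tendstoI)
        fix W :: "'a set" assume "open W" "0 \<in> W"
        from U(2)[OF this] show "\<forall>\<^sub>F n in sequentially. S (u n) (mul c x) - S a (mul c x) \<in> W"
          by eventually_elim (use c in \<open>simp add: S_def\<close>)
      qed
      then have "(\<lambda>n. mul (inverse c) (S (u n) (mul c x) - S a (mul c x)) + S a x) \<longlonglongrightarrow> mul (inverse c) 0 + S a x"
        by (intro tendsto_add tendsto_mul tendsto_const)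
      moreover have "mul (inverse c) (S (u n) (mul c x) - S a (mul c x)) + S a x = S (u n) x" for n
        using c(2) by (simp add: S.scale scale_right_diff_distrib)
      ultimately show "(\<lambda>n. S (u n) x) \<longlonglongrightarrow> S a x" by simp
    qed
    then show "continuous_map (top_of_set {0..}) euclidean (\<lambda>t. S t x)" by simp
  qed
  moreover have "supercyclic_family mul (top_of_set {0..}) S"
  proof -
    have trans: "\<exists>t\<in>{0..}. S t ` U \<inter> V \<noteq> {}" if "open U" "U \<noteq> {}" "open V" "V \<noteq> {}" for U V
    proof -
      have "\<exists>r>0. \<forall>t\<in>topspace (Euclidean_space 1). L2_set t {..<1} > r \<longrightarrow> T t ` U \<inter> V \<noteq> {}"
        using that by (intro T(3)[unfolded mixing_family_def, rule_format] conjI)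
      then obtain r where r: "r > 0"
        "\<And>t. t \<in> topspace (Euclidean_space 1) \<Longrightarrow> L2_set t {..<1} > r \<Longrightarrow> T t ` U \<inter> V \<noteq> {}" by blast
      have "L2_set (\<epsilon> (r + 1)) {..<1} = r + 1" using r(1) by (simp add: L2_set_def \<epsilon>_def)
      then have "S (r + 1) ` U \<inter> V \<noteq> {}" unfolding S_def by (intro r \<epsilon>_top) simp
      then show ?thesis using r(1) by (intro bexI[of _ "r + 1"]) auto
    qed
    obtain D :: "'a set" where D: "countable D" "closure D = UNIV"
      using assms(1) unfolding separable_space_def by auto
    \<comment> \<open>Countably many balls about the points of \<open>D\<close>, with radius 1 / (j
      + 1) for the j-th seminorm. An orbit that meets all of them is dense, already without scalar
      multiples.\<close>
    define V where "V n = {z. q (snd (prod_decode n)) (z - from_nat_into D (fst (prod_decode n))) < 1 / real (Suc (snd (prod_decode n)))}" for n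
    have "from_nat_into D (fst (prod_decode n)) \<in> V n" for n by (simp add: V_def)
    then have ne: "V n \<noteq> {}" for n by blast
    have op: "open (V n)" for n unfolding V_def by (rule open_q_less)
    obtain x where x: "\<And>n. \<exists>t\<in>{0..}. S t x \<in> V n"
      using common_point_of_orbits[of "{0..}" S V, OF cont trans op ne] by blast
    have "{mul z (S t x) | z t. t \<in> {0..}} \<inter> W \<noteq> {}" if W: "open W" "W \<noteq> {}" for W
    proof -
      obtain w where "w \<in> W" using W by blast
      then obtain n0 e where e: "0 < e" "\<And>z. q n0 (z - w) < e \<Longrightarrow> z \<in> W" using open_q_ball W(1) by blast
      define j where "j = max n0 (nat \<lceil>2 / e\<rceil>)"
      have "2 / e \<le> real j" unfolding j_def by linarith
      then have j: "n0 \<le> j" "2 / real (Suc j) < e" using \<open>0 < e\<close> by (auto simp: j_def field_simps)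
      have "open {z. q j (z - w) < 1 / real (Suc j)}" by (rule open_q_less)
      moreover have "w \<in> {z. q j (z - w) < 1 / real (Suc j)}" by simp
      ultimately have "{z. q j (z - w) < 1 / real (Suc j)} \<inter> D \<noteq> {}"
        using D(2) open_Int_closure_eq_empty[of "{z. q j (z - w) < 1 / real (Suc j)}" D] by blast
      then obtain d where d: "d \<in> D" "q j (d - w) < 1 / real (Suc j)" by blast
      then obtain i where i: "from_nat_into D i = d" using from_nat_into_surj[OF D(1)] by blast
      obtain t where t: "t \<in> {0..}" "S t x \<in> V (prod_encode (i, j))" using x by blast
      then have "q j (S t x - d) < 1 / real (Suc j)" by (simp add: V_def i)
      then have "q j (S t x - w) < 2 / real (Suc j)" using d(2) q_triangle[of j "S t x" w d] by linarith
      then have "S t x \<in> W" using q_mono[OF j(1), of "S t x - w"] j(2) by (intro e(2)) linarith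
      then have "mul 1 (S t x) \<in> W" by simp
      then show ?thesis using t(1) by blast
    qed
    then have "closure {mul z (S t x) | z t. t \<in> {0..}} = UNIV" by (rule closure_eq_UNIV_I)
    then show ?thesis unfolding supercyclic_family_def topspace_euclidean_subtopology by blast
  qed
  ultimately show ?thesis unfolding has_supercyclic_semigroup_def by blast
qed

end

section \<open>Separation by functionals and gradings of Frechet spaces\<close>

text \<open>The real scalar multiplication is a parameter, so that a complex space can be used with
  its scalars restricted to the reals.\<close>

definition sublinear :: "(real \<Rightarrow> 'a::ab_group_add \<Rightarrow> 'a) \<Rightarrow> ('a \<Rightarrow> real) \<Rightarrow> bool" where
  "sublinear rs p \<longleftrightarrow> (\<forall>x y. p (x + y) \<le> p x + p y) \<and> (\<forall>r x. 0 \<le> r \<longrightarrow> p (rs r x) = r * p x)"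

lemma sublinearD:
  assumes "sublinear rs p"
  shows "p (x + y) \<le> p x + p y" "0 \<le> r \<Longrightarrow> p (rs r x) = r * p x"
  using assms unfolding sublinear_def by auto

context
  fixes rs :: "real \<Rightarrow> 'a::ab_group_add \<Rightarrow> 'a"
  assumes rs: "vector_space rs"
begin

interpretation vector_space rs by (rule rs)

lemma sublinear_0: "sublinear rs p \<Longrightarrow> p 0 = 0"
  using sublinearD(2)[of rs p 0 0] by simp

lemma sublinear_minus: "sublinear rs p \<Longrightarrow> - p (- x) \<le> p x"
  using sublinearD(1)[of rs p x "- x"] sublinear_0[of p] by simp

text \<open>Along the ray of \<open>x\<close> the functional is lowered as far as sublinearity
  allows: \<open>p'\<close> is the infimum over t >= 0 of p(y + t x) - t p(x), and t = 1 gives the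
  bound at \<open>- x\<close>. It is finite because \<open>- p (- y)\<close> bounds it from
  below.\<close>

lemma sublinear_descent:
  assumes p: "sublinear rs p"
  shows "\<exists>p'. sublinear rs p' \<and> (\<forall>y. p' y \<le> p y) \<and> p' (- x) \<le> - p x"
proof -
  define h where "h y t = p (y + rs t x) - t * p x" for y t
  define p' where "p' y = (INF t\<in>{0..}. h y t)" for y
  have low: "- p (- y) \<le> h y t" if "0 \<le> t" for y t
  proof -
    have "t * p x = p (- y + (y + rs t x))" using sublinearD(2)[OF p that, of x] by simp
    also have "\<dots> \<le> p (- y) + p (y + rs t x)" by (rule sublinearD(1)[OF p])
    finally show ?thesis by (simp add: h_def)
  qed
  then have bdd: "bdd_below (h y ` {0..})" for y by (intro bdd_belowI2[of _ "- p (- y)"]) auto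
  have le: "p' y \<le> h y t" if "0 \<le> t" for y t
    unfolding p'_def by (rule cINF_lower[OF bdd]) (use that in auto)
  have ge: "c \<le> p' y" if "\<And>t. 0 \<le> t \<Longrightarrow> c \<le> h y t" for c y
    unfolding p'_def by (rule cINF_greatest) (use that in auto)
  have "sublinear rs p'"
    unfolding sublinear_def
  proof (intro conjI allI impI)
    fix y z
    have hh: "p' (y + z) \<le> h y s + h z t" if "0 \<le> s" "0 \<le> t" for s t
    proof -
      have "p' (y + z) \<le> h (y + z) (s + t)" using that by (intro le) auto
      also have "y + z + rs (s + t) x = (y + rs s x) + (z + rs t x)"
        by (simp add: scale_left_distrib algebra_simps)
      then have "h (y + z) (s + t) \<le> h y s + h z t"
        using sublinearD(1)[OF p, of "y + rs s x" "z + rs t x"] by (simp add: h_def algebra_simps)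
      finally show ?thesis .
    qed
    have "p' (y + z) - h y s \<le> p' z" if "0 \<le> s" for s
      by (rule ge) (use hh[OF that] in \<open>simp add: algebra_simps\<close>)
    then have "p' (y + z) - p' z \<le> p' y" by (intro ge) (simp add: algebra_simps)
    then show "p' (y + z) \<le> p' y + p' z" by simp
  next
    have half: "p' (rs r y) \<le> r * p' y" if "0 < r" for r y
    proof -
      have "p' (rs r y) / r \<le> p' y"
      proof (rule ge)
        fix t :: real assume t: "0 \<le> t"
        have "p' (rs r y) \<le> h (rs r y) (r * t)" using t that by (intro le) auto
        also have "rs r y + rs (r * t) x = rs r (y + rs t x)" by (simp add: scale_right_distrib)
        then have "h (rs r y) (r * t) = r * h y t"
          using sublinearD(2)[OF p, of r "y + rs t x"] that by (simp add: h_def algebra_simps)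
        finally show "p' (rs r y) / r \<le> h y t" using that by (simp add: field_simps)
      qed
      then show ?thesis using that by (simp add: field_simps)
    qed
    fix r :: real and y assume "0 \<le> r"
    show "p' (rs r y) = r * p' y"
    proof (cases "r = 0")
      case True
      have "p' 0 \<le> h 0 0" by (rule le) simp
      moreover have "0 \<le> p' 0" by (rule ge) (use low[of _ 0] sublinear_0[OF p] in auto)
      ultimately show ?thesis using True sublinear_0[OF p] by (simp add: h_def)
    next
      case False
      then have "0 < r" using \<open>0 \<le> r\<close> by simp
      have "p' (rs (1 / r) (rs r y)) \<le> 1 / r * p' (rs r y)" using \<open>0 < r\<close> by (intro half) simp
      then have "r * p' y \<le> p' (rs r y)" using \<open>0 < r\<close> by (simp add: field_simps)
      then show ?thesis using half[OF \<open>0 < r\<close>, of y] by simp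
    qed
  qed
  moreover have "p' y \<le> p y" for y using le[of 0 y] by (simp add: h_def)
  moreover have "p' (- x) \<le> - p x" using le[of 1 "- x"] sublinear_0[OF p] by (simp add: h_def)
  ultimately show ?thesis by blast
qed

lemma minimal_sublinear_exists:
  assumes p: "sublinear rs p"
  shows "\<exists>m. sublinear rs m \<and> (\<forall>x. m x \<le> p x) \<and>
    (\<forall>g. sublinear rs g \<longrightarrow> (\<forall>x. g x \<le> m x) \<longrightarrow> g = m)"
proof -
  define A where "A = {g. sublinear rs g \<and> (\<forall>x. g x \<le> p x)}"
  \<comment> \<open>The order is the reverse of the pointwise one, so that maximality in Zorn's
    lemma means minimality of the functional.\<close>
  define P :: "('a \<Rightarrow> real) \<Rightarrow> ('a \<Rightarrow> real) \<Rightarrow> bool" where "P f g = (\<forall>x. g x \<le> f x)" for f g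
  have "\<exists>m\<in>A. \<forall>g\<in>A. P m g \<longrightarrow> g = m"
  proof (rule predicate_Zorn)
    show "partial_order_on A (relation_of P A)"
      by (rule partial_order_on_relation_ofI) (auto simp: P_def fun_eq_iff intro: order_trans antisym)
    fix C assume C: "C \<in> Chains (relation_of P A)"
    have CA: "C \<subseteq> A" and chain: "\<And>f g. f \<in> C \<Longrightarrow> g \<in> C \<Longrightarrow> P f g \<or> P g f"
      using C unfolding Chains_def relation_of_def by auto
    show "\<exists>u\<in>A. \<forall>g\<in>C. P g u"
    proof (cases "C = {}")
      case True
      then show ?thesis using p by (intro bexI[of _ p]) (auto simp: A_def)
    next
      case False
      define u where "u x = (INF g\<in>C. g x)" for x
      have sub: "sublinear rs g" and gp: "g x \<le> p x" if "g \<in> C" for g x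
        using CA that unfolding A_def by auto
      have low: "- p (- x) \<le> g x" if "g \<in> C" for g x
        using sublinear_minus[OF sub[OF that], of x] gp[OF that, of "- x"] by linarith
      have bdd: "bdd_below ((\<lambda>g. g x) ` C)" for x
        using low by (intro bdd_belowI2[of _ "- p (- x)"]) auto
      have le: "u x \<le> g x" if "g \<in> C" for g x
        unfolding u_def by (rule cINF_lower[OF bdd that])
      have ge: "c \<le> u x" if "\<And>g. g \<in> C \<Longrightarrow> c \<le> g x" for c x
        unfolding u_def by (rule cINF_greatest[OF False that])
      have "sublinear rs u" unfolding sublinear_def
      proof (intro conjI allI impI)
        fix x y
        have gh: "u (x + y) \<le> g x + h y" if gh: "g \<in> C" "h \<in> C" for g h
        proof -
          have "\<exists>k\<in>C. k x \<le> g x \<and> k y \<le> h y"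
            using chain[OF gh] gh unfolding P_def by blast
          then obtain k where k: "k \<in> C" "k x \<le> g x" "k y \<le> h y" by blast
          have "u (x + y) \<le> k (x + y)" by (rule le[OF k(1)])
          also have "\<dots> \<le> k x + k y" by (rule sublinearD(1)[OF sub[OF k(1)]])
          finally show ?thesis using k by linarith
        qed
        have "u (x + y) - g x \<le> u y" if "g \<in> C" for g
          by (rule ge) (use gh[OF that] in \<open>simp add: algebra_simps\<close>)
        then have "u (x + y) - u y \<le> u x" by (intro ge) (simp add: algebra_simps)
        then show "u (x + y) \<le> u x + u y" by simp
      next
        have half: "u (rs r x) \<le> r * u x" if "0 < r" for r x
        proof -
          have "u (rs r x) / r \<le> u x"
          proof (rule ge)
            fix g assume g: "g \<in> C"
            have "u (rs r x) \<le> r * g x"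
              using le[OF g, of "rs r x"] sublinearD(2)[OF sub[OF g], of r x] that by simp
            then show "u (rs r x) / r \<le> g x" using that by (simp add: field_simps)
          qed
          then show ?thesis using that by (simp add: field_simps)
        qed
        fix r :: real and x assume "0 \<le> r"
        show "u (rs r x) = r * u x"
        proof (cases "r = 0")
          case True
          have "g 0 = 0" if "g \<in> C" for g using sublinear_0[OF sub[OF that]] .
          then have "u 0 = (INF g\<in>C. 0)" unfolding u_def by (intro INF_cong) auto
          then have "u 0 = 0" using \<open>C \<noteq> {}\<close> by simp
          then show ?thesis using True by simp
        next
          case False
          then have "0 < r" using \<open>0 \<le> r\<close> by simp
          have "u (rs (1 / r) (rs r x)) \<le> 1 / r * u (rs r x)" using \<open>0 < r\<close> by (intro half) simp
          then have "r * u x \<le> u (rs r x)" using \<open>0 < r\<close> by (simp add: field_simps)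
          then show ?thesis using half[OF \<open>0 < r\<close>, of x] by simp
        qed
      qed
      moreover have "u x \<le> p x" for x using False le gp order_trans by blast
      ultimately show ?thesis using le by (intro bexI[of _ u]) (auto simp: A_def P_def)
    qed
  qed
  then obtain m where m: "m \<in> A" "\<And>g. g \<in> A \<Longrightarrow> P m g \<Longrightarrow> g = m" by blast
  have "g = m" if "sublinear rs g" "\<forall>x. g x \<le> m x" for g
  proof (rule m(2))
    show "g \<in> A" using that m(1) order_trans unfolding A_def by blast
    show "P m g" using that by (simp add: P_def)
  qed
  then show ?thesis using m(1) unfolding A_def by blast
qed

text \<open>A minimal sublinear functional is linear, because \<open>sublinear_descent\<close> cannot decrease it.\<close>

lemma Hahn_Banach_sublinear:
  assumes p: "sublinear rs p"
  shows "\<exists>u. Vector_Spaces.linear rs (*) u \<and> (\<forall>y. u y \<le> p y) \<and> u x = p x"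
proof -
  obtain p' where p': "sublinear rs p'" "\<And>y. p' y \<le> p y" "p' (- x) \<le> - p x"
    using sublinear_descent[OF p, of x] by blast
  obtain u where u: "sublinear rs u" "\<And>y. u y \<le> p' y"
    "\<And>g. sublinear rs g \<Longrightarrow> (\<forall>x. g x \<le> u x) \<Longrightarrow> g = u"
    using minimal_sublinear_exists[OF p'(1)] by blast
  have minus: "u (- y) = - u y" for y
  proof -
    obtain g where g: "sublinear rs g" "\<forall>x. g x \<le> u x" "g (- y) \<le> - u y"
      using sublinear_descent[OF u(1), of y] by blast
    then have "u (- y) \<le> - u y" using u(3)[OF g(1,2)] by simp
    then show ?thesis using sublinear_minus[OF u(1), of "- y"] by simp
  qed
  have "Vector_Spaces.linear rs (*) u"
  proof unfold_locales
    fix y z r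
    have "u (y + z + - z) \<le> u (y + z) + u (- z)" by (rule sublinearD(1)[OF u(1)])
    then show "u (y + z) = u y + u z" using sublinearD(1)[OF u(1), of y z] by (simp add: minus)
    show "u (rs r y) = r * u y"
    proof (cases "0 \<le> r")
      case False
      then have "u (rs (- r) y) = - r * u y" by (intro sublinearD(2)[OF u(1)]) simp
      then show ?thesis by (simp add: minus)
    qed (rule sublinearD(2)[OF u(1)])
  qed
  moreover have "u y \<le> p y" for y using u(2)[of y] p'(2)[of y] by simp
  moreover have "p x \<le> u x" using u(2)[of "- x"] p'(3) by (simp add: minus)
  ultimately show ?thesis using antisym by blast
qed

end

section \<open>Functionals bounded by a seminorm, over the reals and over the complex
  numbers\<close>

definition seminorm_for :: "('k::real_normed_field \<Rightarrow> 'a::ab_group_add \<Rightarrow> 'a) \<Rightarrow> ('a \<Rightarrow> real) \<Rightarrow> bool" where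
  "seminorm_for mul p \<longleftrightarrow> (\<forall>x y. p (x + y) \<le> p x + p y) \<and> (\<forall>c x. p (mul c x) = norm c * p x)"

lemma vector_space_of_real:
  assumes "vector_space (mul :: 'k::real_normed_field \<Rightarrow> 'a::ab_group_add \<Rightarrow> 'a)"
  shows "vector_space (\<lambda>r. mul (of_real r))"
proof -
  interpret vector_space mul by fact
  show ?thesis
    by unfold_locales (simp_all add: scale_right_distrib scale_left_distrib)
qed

lemma seminorm_functional_real:
  fixes mul :: "real \<Rightarrow> 'a::ab_group_add \<Rightarrow> 'a"
  assumes "vector_space mul" "seminorm_for mul p" "p x \<noteq> 0"
  shows "\<exists>f C. Vector_Spaces.linear mul (*) f \<and> (\<forall>y. norm (f y) \<le> C * p y) \<and> f x \<noteq> 0"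
proof -
  interpret vector_space mul by fact
  have sub: "sublinear mul p" using assms(2) by (simp add: sublinear_def seminorm_for_def)
  obtain u where u: "Vector_Spaces.linear mul (*) u" "\<And>y. u y \<le> p y" "u x = p x"
    using Hahn_Banach_sublinear[OF assms(1) sub, of x] by blast
  interpret u: Vector_Spaces.linear mul "(*)" u by fact
  have "p (mul (- 1) y) = norm (- 1 :: real) * p y" for y using assms(2) unfolding seminorm_for_def by blast
  then have "p (- y) = p y" for y by simp
  then have "norm (u y) \<le> 1 * p y" for y
    using u(2)[of y] u(2)[of "- y"] by (simp add: u.neg abs_le_iff)
  then show ?thesis using u assms(3) by (intro exI[of _ u] exI[of _ 1]) auto
qed

lemma seminorm_functional_complex:
  fixes mul :: "complex \<Rightarrow> 'a::ab_group_add \<Rightarrow> 'a"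
  assumes "vector_space mul" "seminorm_for mul p" "p x \<noteq> 0"
  shows "\<exists>f C. Vector_Spaces.linear mul (*) f \<and> (\<forall>y. norm (f y) \<le> C * p y) \<and> f x \<noteq> 0"
proof -
  interpret vector_space mul by fact
  have p_scale: "p (mul c y) = norm c * p y" for c y using assms(2) by (simp add: seminorm_for_def)
  have sub: "sublinear (\<lambda>r. mul (of_real r)) p"
    using assms(2) by (simp add: sublinear_def seminorm_for_def)
  obtain u where u: "Vector_Spaces.linear (\<lambda>r. mul (of_real r)) (*) u" "\<And>y. u y \<le> p y" "u x = p x"
    using Hahn_Banach_sublinear[OF vector_space_of_real[OF assms(1)] sub, of x] by blast
  interpret u: Vector_Spaces.linear "\<lambda>r. mul (of_real r)" "(*)" u by fact
  have bound: "\<bar>u y\<bar> \<le> p y" for y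
    using u(2)[of y] u(2)[of "- y"] p_scale[of "- 1" y] by (simp add: u.neg abs_le_iff)
  \<comment> \<open>The real part \<open>u\<close> determines a complex linear functional, since its
    imaginary part at \<open>y\<close> must be minus its real part at
    \<open>mul \<i> y\<close>.\<close>
  define f where "f y = Complex (u y) (- u (mul \<i> y))" for y
  have "Vector_Spaces.linear mul (*) f"
  proof unfold_locales
    fix y z c
    show "f (y + z) = f y + f z" by (simp add: f_def scale_right_distrib u.add complex_eq_iff)
    have c: "c = of_real (Re c) + of_real (Im c) * \<i>" by (simp add: complex_eq_iff)
    have "mul c y = mul (of_real (Re c)) y + mul (of_real (Im c)) (mul \<i> y)"
      by (subst c) (simp add: scale_left_distrib)
    then have 1: "u (mul c y) = Re c * u y + Im c * u (mul \<i> y)" by (simp only: u.add u.scale)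
    have "\<i> * c = of_real (Re c) * \<i> + of_real (- Im c)" by (simp add: complex_eq_iff)
    then have "mul \<i> (mul c y) = mul (of_real (Re c)) (mul \<i> y) + mul (of_real (- Im c)) y"
      by (simp only: scale_scale scale_left_distrib)
    then have 2: "u (mul \<i> (mul c y)) = Re c * u (mul \<i> y) - Im c * u y"
      by (simp only: u.add u.scale)
    show "f (mul c y) = c * f y" by (simp add: f_def 1 2 complex_eq_iff algebra_simps del: scale_scale)
  qed
  moreover have "norm (f y) \<le> 2 * p y" for y
  proof -
    have "norm (f y) \<le> \<bar>u y\<bar> + \<bar>u (mul \<i> y)\<bar>"
      using cmod_le[of "f y"] by (simp add: f_def)
    then show ?thesis using bound[of y] bound[of "mul \<i> y"] p_scale[of \<i> y] by simp
  qed
  moreover have "f x \<noteq> 0" using u(3) assms(3) by (simp add: f_def complex_eq_iff)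
  ultimately show ?thesis by blast
qed

section \<open>Defining seminorms of a Frechet space\<close>

context frechet_space
begin

lemma tendsto_scale:
  assumes "(c \<longlongrightarrow> c0) F" "(x \<longlongrightarrow> x0) F"
  shows "((\<lambda>i. mul (c i) (x i)) \<longlongrightarrow> mul c0 x0) F"
proof -
  have "((\<lambda>i. case (c i, x i) of (c, x) \<Rightarrow> mul c x) \<longlongrightarrow> (case (c0, x0) of (c, x) \<Rightarrow> mul c x)) F"
    using continuous_mul tendsto_Pair[OF assms]
    by (intro continuous_on_tendsto_compose[where s = UNIV and f = "\<lambda>(c, x). mul c x"]) auto
  then show ?thesis by simp
qed

lemma continuous_scale: "continuous_on UNIV (\<lambda>x. mul c (x - y))"
proof -
  have "continuous_on UNIV (\<lambda>x. (c, x - y))" by (intro continuous_intros)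
  then have "continuous_on UNIV (\<lambda>x. case (c, x - y) of (c, x) \<Rightarrow> mul c x)"
    using continuous_on_compose2[OF continuous_mul] by blast
  then show ?thesis by simp
qed

lemma balanced_convex_neighborhood:
  assumes "open U" "0 \<in> U"
  obtains W where "W \<subseteq> U" "0 \<in> interior W" "convex_in mul W"
    "\<And>c x. norm c = 1 \<Longrightarrow> x \<in> W \<Longrightarrow> mul c x \<in> W"
proof -
  obtain C where C: "C \<subseteq> U" "0 \<in> interior C" "convex_in mul C"
    using locally_convex[OF assms] by blast
  define W where "W = {x. \<forall>c. norm c = 1 \<longrightarrow> mul c x \<in> C}"
  have "open ((\<lambda>(c, x). mul c x) -` interior C)"
    using continuous_mul by (intro open_vimage) auto
  moreover have "(0, 0) \<in> (\<lambda>(c, x). mul c x) -` interior C" using C(2) by simp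
  ultimately obtain A V where AV: "open A" "open V" "(0, 0) \<in> A \<times> V"
    "A \<times> V \<subseteq> (\<lambda>(c, x). mul c x) -` interior C"
    by (rule open_prod_elim)
  then have A0: "0 \<in> A" and V0: "0 \<in> V" by auto
  obtain d where d: "d > 0" "ball 0 d \<subseteq> A" using AV(1) A0 open_contains_ball by blast
  \<comment> \<open>A scalar \<open>c\<close> of norm 1 is written as
    \<open>c * of_real (d / 2)\<close> times \<open>of_real (2 / d)\<close>. The first factor is in
    \<open>A\<close> whatever \<open>c\<close> is, so continuity of \<open>mul\<close> at (0, 0)
    treats all such \<open>c\<close> simultaneously.\<close>
  define V' where "V' = (\<lambda>x. mul (of_real (2 / d)) (x - 0)) -` V"
  have "open V'" unfolding V'_def by (intro open_vimage AV continuous_scale)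
  moreover have "0 \<in> V'" using V0 by (simp add: V'_def)
  moreover have "V' \<subseteq> W"
  proof
    fix x assume x: "x \<in> V'"
    have "mul c x \<in> C" if "norm c = 1" for c
    proof -
      have "c * of_real (d / 2) \<in> A"
        using d that by (intro subsetD[OF d(2)]) (simp add: norm_mult)
      moreover have "mul (of_real (2 / d)) x \<in> V" using x by (simp add: V'_def)
      ultimately have "mul (c * of_real (d / 2)) (mul (of_real (2 / d)) x) \<in> interior C"
        using subsetD[OF AV(4), of "(c * of_real (d / 2), mul (of_real (2 / d)) x)"] by simp
      moreover have "mul (c * of_real (d / 2)) (mul (of_real (2 / d)) x) = mul c x"
        using d(1) by simp
      ultimately have "mul c x \<in> interior C" by (simp only:)
      then show ?thesis using interior_subset[of C] by (rule subsetD[rotated])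
    qed
    then show "x \<in> W" by (simp add: W_def)
  qed
  ultimately have "0 \<in> interior W" by (rule interiorI)
  moreover have "W \<subseteq> U"
  proof
    fix x assume "x \<in> W"
    then have "norm (1::'k) = 1 \<longrightarrow> mul 1 x \<in> C" unfolding W_def by blast
    then show "x \<in> U" using C(1) by auto
  qed
  moreover have "convex_in mul W"
    unfolding convex_in_def
  proof (intro ballI allI impI)
    fix x y and u :: real assume xy: "x \<in> W" "y \<in> W" and u: "0 \<le> u \<and> u \<le> 1"
    have "mul c (mul (of_real (1 - u)) x + mul (of_real u) y) \<in> C" if "norm c = 1" for c
    proof -
      have "mul c (mul (of_real (1 - u)) x + mul (of_real u) y) = mul (of_real (1 - u)) (mul c x) + mul (of_real u) (mul c y)"
        by (simp add: scale_right_distrib mult.commute)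
      moreover have "mul c x \<in> C" "mul c y \<in> C" using xy that by (auto simp: W_def)
      moreover have "mul (of_real (1 - u)) (mul c x) + mul (of_real u) (mul c y) \<in> C"
        using C(3)[unfolded convex_in_def, rule_format] calculation(2,3) u by blast
      ultimately show ?thesis by (simp only:)
    qed
    then show "mul (of_real (1 - u)) x + mul (of_real u) y \<in> W" by (simp add: W_def)
  qed
  moreover have "mul c x \<in> W" if "norm c = 1" "x \<in> W" for c x
    using that by (auto simp: W_def norm_mult)
  ultimately show thesis using that by blast
qed

text \<open>\<open>p\<close> is the Minkowski gauge of \<open>W\<close>. Convexity gives
  subadditivity, invariance under scalars of norm 1 gives homogeneity, and the interior point 0
  gives finiteness and continuity.\<close>

lemma seminorm_exists:
  assumes "open U" "0 \<in> U"
  shows "\<exists>p. seminorm_for mul p \<and> continuous_on UNIV p \<and> {x. p x < 1} \<subseteq> U"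
proof -
  obtain W where W: "W \<subseteq> U" "0 \<in> interior W" "convex_in mul W"
    "\<And>c x. norm c = 1 \<Longrightarrow> x \<in> W \<Longrightarrow> mul c x \<in> W"
    using balanced_convex_neighborhood[OF assms] by blast
  have W0: "0 \<in> W" using W(2) interior_subset by blast
  define S where "S x = {r::real. 0 < r \<and> mul (of_real (inverse r)) x \<in> W}" for x
  have nonempty: "S x \<noteq> {}" for x
  proof -
    have "(\<lambda>n. mul (of_real (inverse (real (Suc n)))) x) \<longlonglongrightarrow> mul (of_real 0) x"
      by (intro tendsto_scale tendsto_of_real tendsto_const LIMSEQ_inverse_real_of_nat)
    then have "\<forall>\<^sub>F n in sequentially. mul (of_real (inverse (real (Suc n)))) x \<in> interior W"
      using W(2) by (intro topological_tendstoD) auto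
    then obtain n where "mul (of_real (inverse (real (Suc n)))) x \<in> interior W"
      using eventually_happens'[OF sequentially_bot] by blast
    then have "mul (of_real (inverse (real (Suc n)))) x \<in> W" using interior_subset by blast
    then have "real (Suc n) \<in> S x" unfolding S_def by simp
    then show ?thesis by blast
  qed
  have up: "s \<in> S x" if "r \<in> S x" "r \<le> s" for r s x
  proof -
    have r: "0 < r" "mul (of_real (inverse r)) x \<in> W" using that by (auto simp: S_def)
    have "0 \<le> r / s \<and> r / s \<le> 1" using r that by simp
    then have "mul (of_real (1 - r / s)) 0 + mul (of_real (r / s)) (mul (of_real (inverse r)) x) \<in> W"
      using W(3) W0 r(2) unfolding convex_in_def by blast
    moreover have "r / s * inverse r = inverse s" using r that by (simp add: field_simps)
    ultimately have "mul (of_real (inverse s)) x \<in> W"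
      by (simp only: scale_scale of_real_mult[symmetric] scale_zero_right add_0_left)
    then show ?thesis using r that by (simp add: S_def)
  qed
  define p where "p x = Inf (S x)" for x
  have bdd: "bdd_below (S x)" for x by (intro bdd_belowI[of _ 0]) (auto simp: S_def)
  have le: "p x \<le> r" if "r \<in> S x" for r x unfolding p_def by (rule cInf_lower[OF that bdd])
  have ge: "c \<le> p x" if "\<And>r. r \<in> S x \<Longrightarrow> c \<le> r" for c x
    unfolding p_def by (rule cInf_greatest[OF nonempty that])
  have mem: "r \<in> S x" if "p x < r" for r x
  proof -
    from cInf_lessD[OF nonempty that[unfolded p_def]] obtain s where "s \<in> S x" "s < r" by blast
    then show ?thesis using up by simp
  qed
  have nonneg: "0 \<le> p x" for x by (rule ge) (auto simp: S_def)
  have "p 0 = 0"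
  proof (rule antisym[OF _ nonneg])
    have "r \<in> S 0" if "0 < r" for r using that W0 by (simp add: S_def)
    then have "p 0 \<le> 0 + e" if "0 < e" for e unfolding add_0_left using that by (intro le)
    then show "p 0 \<le> 0" by (rule field_le_epsilon)
  qed
  have half: "p (mul c x) \<le> norm c * p x" if "c \<noteq> 0" for c x
  proof -
    have "p (mul c x) / norm c \<le> p x"
    proof (rule ge)
      fix r assume r: "r \<in> S x"
      have "mul (c / of_real (norm c)) (mul (of_real (inverse r)) x) \<in> W"
      proof (rule W(4))
        show "norm (c / of_real (norm c)) = 1" using that by (simp add: norm_divide)
        show "mul (of_real (inverse r)) x \<in> W" using r by (simp add: S_def)
      qed
      moreover have "mul (c / of_real (norm c)) (mul (of_real (inverse r)) x) =
          mul (of_real (inverse (norm c * r))) (mul c x)"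
        by (simp add: divide_inverse mult_ac)
      ultimately have "mul (of_real (inverse (norm c * r))) (mul c x) \<in> W" by (simp only:)
      then have "norm c * r \<in> S (mul c x)" using r that unfolding S_def by auto
      then show "p (mul c x) / norm c \<le> r" using le that by (simp add: field_simps)
    qed
    then show ?thesis using that by (simp add: field_simps)
  qed
  have scale: "p (mul c x) = norm c * p x" for c x
  proof (cases "c = 0")
    case False
    have "p (mul (inverse c) (mul c x)) \<le> norm (inverse c) * p (mul c x)" using False by (intro half) simp
    then have "norm c * p x \<le> p (mul c x)" using False by (simp add: norm_inverse norm_divide field_simps)
    then show ?thesis using half[OF False, of x] by simp
  qed (simp add: \<open>p 0 = 0\<close>)
  have add: "p (x + y) \<le> p x + p y" for x y
  proof -
    have rs: "p (x + y) \<le> r + s" if "r \<in> S x" "s \<in> S y" for r s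
    proof (rule le)
      have r: "0 < r" "mul (of_real (inverse r)) x \<in> W" and s: "0 < s" "mul (of_real (inverse s)) y \<in> W"
        using that by (auto simp: S_def)
      have "0 \<le> s / (r + s) \<and> s / (r + s) \<le> 1" using r s by simp
      then have "mul (of_real (1 - s / (r + s))) (mul (of_real (inverse r)) x) +
          mul (of_real (s / (r + s))) (mul (of_real (inverse s)) y) \<in> W"
        using W(3) r(2) s(2) unfolding convex_in_def by blast
      moreover have "(1 - s / (r + s)) * inverse r = inverse (r + s)" "s / (r + s) * inverse s = inverse (r + s)"
        using r s by (simp_all add: field_simps)
      ultimately have "mul (of_real (inverse (r + s))) (x + y) \<in> W"
        by (simp only: scale_scale of_real_mult[symmetric] scale_right_distrib)
      then show "r + s \<in> S (x + y)" using r s by (simp add: S_def)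
    qed
    have "p (x + y) - r \<le> p y" if "r \<in> S x" for r by (rule ge) (use rs[OF that] in \<open>simp add: algebra_simps\<close>)
    then have "p (x + y) - p y \<le> p x" by (intro ge) (simp add: algebra_simps)
    then show ?thesis by simp
  qed
  have "continuous_on UNIV p"
    unfolding continuous_on_def
  proof (intro ballI tendstoI)
    fix x and e :: real assume "0 < e"
    define V where "V = (\<lambda>y. mul (of_real (inverse (e / 2))) (y - x)) -` interior W"
    have "open V" unfolding V_def by (intro open_vimage continuous_scale) simp
    moreover have "x \<in> V" using W(2) by (simp add: V_def)
    ultimately have "\<forall>\<^sub>F y in at x. y \<in> V" using eventually_at_topological by blast
    then show "\<forall>\<^sub>F y in at x. dist (p y) (p x) < e"
    proof eventually_elim
      case (elim y)
      then have "e / 2 \<in> S (y - x)" using interior_subset \<open>0 < e\<close> unfolding V_def S_def by auto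
      then have "p (y - x) \<le> e / 2" by (rule le)
      moreover have "p y \<le> p (y - x) + p x" using add[of "y - x" x] by simp
      moreover have "p (x - y) = p (y - x)" using scale[of "- 1" "y - x"] by simp
      moreover have "p x \<le> p (x - y) + p y" using add[of "x - y" y] by simp
      ultimately show ?case using \<open>0 < e\<close> by (simp add: dist_real_def abs_less_iff)
    qed
  qed
  moreover have "{x. p x < 1} \<subseteq> U"
  proof safe
    fix x assume "p x < 1"
    then have "1 \<in> S x" by (rule mem)
    then show "x \<in> U" using W(1) by (auto simp: S_def)
  qed
  ultimately show ?thesis using add scale by (auto simp: seminorm_for_def)
qed

lemma graded_frechet_exists:
  assumes functional: "\<And>p x. seminorm_for mul p \<Longrightarrow> p x \<noteq> 0 \<Longrightarrow>
    \<exists>f C. Vector_Spaces.linear mul (*) f \<and> (\<forall>y. norm (f y) \<le> C * p y) \<and> f x \<noteq> 0"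
  shows "\<exists>q. graded_frechet mul q"
proof -
  have "first_countable (euclidean :: 'a topology)" by (rule metrizable_imp_first_countable[OF metrizable])
  then have "\<exists>B :: 'a set set. countable B \<and> (\<forall>V\<in>B. open V) \<and>
      (\<forall>U. open U \<and> 0 \<in> U \<longrightarrow> (\<exists>V\<in>B. 0 \<in> V \<and> V \<subseteq> U))"
    unfolding first_countable_def by (simp flip: open_openin)
  then obtain B :: "'a set set" where "countable B \<and> (\<forall>V\<in>B. open V) \<and>
      (\<forall>U. open U \<and> 0 \<in> U \<longrightarrow> (\<exists>V\<in>B. 0 \<in> V \<and> V \<subseteq> U))"
    by (elim exE)
  then have B: "countable B" "\<And>V. V \<in> B \<Longrightarrow> open V"
    "\<And>U. open U \<Longrightarrow> 0 \<in> U \<Longrightarrow> \<exists>V\<in>B. 0 \<in> V \<and> V \<subseteq> U"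
    by simp_all
  have "B \<noteq> {}" using B(3)[of UNIV] by auto
  \<comment> \<open>The countable family is a neighbourhood base at 0 only through its members that
    contain 0; the others are replaced by the whole space.\<close>
  define u where "u n = (if 0 \<in> from_nat_into B n then from_nat_into B n else UNIV)" for n
  have "open (u n)" "0 \<in> u n" for n
    using B(2) from_nat_into[OF \<open>B \<noteq> {}\<close>] by (auto simp: u_def)
  then have "\<exists>p. seminorm_for mul p \<and> continuous_on UNIV p \<and> {x. p x < 1} \<subseteq> u n" for n
    by (rule seminorm_exists)
  then obtain p where p: "\<And>n. seminorm_for mul (p n)" "\<And>n. continuous_on UNIV (p n)" "\<And>n. {x. p n x < 1} \<subseteq> u n"
    by metis
  have p_add: "p n (x + y) \<le> p n x + p n y" and p_scale: "p n (mul c x) = norm c * p n x" for n x y c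
    using p(1)[of n] by (auto simp: seminorm_for_def)
  have p_nonneg: "0 \<le> p n x" for n x
    using p_add[of n x "- x"] p_scale[of n "- 1" x] p_scale[of n 0 x] by simp
  \<comment> \<open>Summing makes the seminorms increasing in \<open>n\<close> without losing any
    neighbourhood, as \<open>p n \<le> q n\<close>.\<close>
  define q where "q n x = (\<Sum>i\<le>n. p i x)" for n x
  have q_add: "q n (x + y) \<le> q n x + q n y" for n x y
    unfolding q_def sum.distrib[symmetric] by (intro sum_mono p_add)
  have q_scale: "q n (mul c x) = norm c * q n x" for n c x
    unfolding q_def by (simp add: p_scale sum_distrib_left)
  have base: "\<exists>n. {x. q n x < 1} \<subseteq> U" if "open U" "0 \<in> U" for U
  proof -
    obtain V where V: "V \<in> B" "0 \<in> V" "V \<subseteq> U" using B(3) \<open>open U\<close> \<open>0 \<in> U\<close> by blast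
    obtain n where n: "from_nat_into B n = V" using from_nat_into_surj[OF B(1) V(1)] by blast
    have "p n x \<le> q n x" for x
      unfolding q_def by (rule member_le_sum) (auto simp: p_nonneg)
    then have "{x. q n x < 1} \<subseteq> {x. p n x < 1}" by (auto intro: le_less_trans)
    also have "\<dots> \<subseteq> u n" by (rule p)
    also have "\<dots> = V" using n V(2) by (simp add: u_def)
    finally show ?thesis using V(3) by blast
  qed
  have "graded_frechet mul q"
  proof unfold_locales
    fix n m x y c
    show "q n (x + y) \<le> q n x + q n y" by (rule q_add)
    show "q n (mul c x) = norm c * q n x" by (rule q_scale)
    show "q m x \<le> q n x" if "m \<le> n"
      unfolding q_def by (rule sum_mono2) (use that p_nonneg in auto)
    show "continuous_on UNIV (q n)" unfolding q_def[abs_def] by (intro continuous_on_sum p)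
    show "\<exists>n e. 0 < e \<and> {x. q n x < e} \<subseteq> U" if "open U" "0 \<in> U" for U
      using base[OF that] zero_less_one by blast
    show "\<exists>f C. Vector_Spaces.linear mul (*) f \<and> (\<forall>y. norm (f y) \<le> C * q n y) \<and> f x \<noteq> 0" if "q n x \<noteq> 0"
      using that q_add q_scale by (intro functional) (auto simp: seminorm_for_def)
  next
    fix s :: "nat \<Rightarrow> 'a"
    assume cauchy: "\<And>n e. 0 < e \<Longrightarrow> \<exists>M. \<forall>i\<ge>M. \<forall>j\<ge>M. q n (s i - s j) < e"
    have "\<exists>l. filtermap s sequentially \<le> nhds l"
    proof (rule complete)
      show "filtermap s sequentially \<noteq> bot" by (simp add: filtermap_bot_iff)
      fix U :: "'a set" assume "open U" "0 \<in> U"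
      then obtain n where n: "{x. q n x < 1} \<subseteq> U" using base by blast
      obtain M where M: "\<And>i j. i \<ge> M \<Longrightarrow> j \<ge> M \<Longrightarrow> q n (s i - s j) < 1" using cauchy[of 1 n] by auto
      have ev: "eventually (\<lambda>x. \<exists>i\<ge>M. x = s i) (filtermap s sequentially)"
        unfolding eventually_filtermap eventually_sequentially by blast
      show "eventually (\<lambda>(x, y). x - y \<in> U) (filtermap s sequentially \<times>\<^sub>F filtermap s sequentially)"
        unfolding eventually_prod_filter
      proof (intro exI conjI allI impI)
        fix x y assume "\<exists>i\<ge>M. x = s i" "\<exists>i\<ge>M. y = s i"
        then have "q n (x - y) < 1" using M by blast
        then show "case (x, y) of (x, y) \<Rightarrow> x - y \<in> U" using n by auto
      qed (rule ev)+
    qed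
    then show "\<exists>l. s \<longlonglongrightarrow> l" unfolding filterlim_def .
  qed
  then show ?thesis by blast
qed

end

section \<open>Common eigenvectors\<close>

context vector_space
begin

text \<open>Formulated for families: a repeated vector is invisible in the image set, but yields a
  relation with coefficients 1 and -1.\<close>

lemma linear_relation_exists:
  fixes u :: "nat \<Rightarrow> 'b"
  assumes "finite B" "\<And>i. i \<le> card B \<Longrightarrow> u i \<in> span B"
  shows "\<exists>c. (\<exists>i\<le>card B. c i \<noteq> 0) \<and> (\<Sum>i\<le>card B. scale (c i) (u i)) = 0"
proof (cases "inj_on u {..card B}")
  case True
  have "\<not> independent (u ` {..card B})"
  proof
    assume "independent (u ` {..card B})"
    then have "card (u ` {..card B}) \<le> card B" using assms by (intro independent_span_bound[THEN conjunct2]) auto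
    then show False by (simp add: card_image[OF True])
  qed
  then obtain c where c: "\<exists>v\<in>u ` {..card B}. c v \<noteq> 0" "(\<Sum>v\<in>u ` {..card B}. scale (c v) v) = 0"
    using dependent_finite[of "u ` {..card B}"] by auto
  have "(\<Sum>i\<le>card B. scale (c (u i)) (u i)) = 0" using c(2) by (simp add: sum.reindex[OF True])
  then show ?thesis using c(1) by (intro exI[of _ "\<lambda>i. c (u i)"]) auto
next
  case False
  then obtain i j where ij: "i \<le> card B" "j \<le> card B" "i \<noteq> j" "u i = u j" unfolding inj_on_def by auto
  define c :: "nat \<Rightarrow> 'a" where "c l = (if l = i then 1 else 0) - (if l = j then 1 else 0)" for l
  have "(\<Sum>l\<le>card B. scale (c l) (u l)) =
      (\<Sum>l\<le>card B. if l = i then u l else 0) - (\<Sum>l\<le>card B. if l = j then u l else 0)"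
    unfolding sum_subtractf[symmetric] by (rule sum.cong) (auto simp: c_def scale_left_diff_distrib)
  also have "\<dots> = 0" using ij by simp
  finally show ?thesis using ij by (intro exI[of _ c] conjI exI[of _ i]) (auto simp: c_def)
qed

lemma span_eq_of_dim_eq:
  assumes "A \<subseteq> C" "C \<subseteq> span B" "finite B" "dim A = dim C"
  shows "span A = span C"
proof -
  obtain X where X: "X \<subseteq> A" "independent X" "A \<subseteq> span X" "card X = dim A" using basis_exists by blast
  obtain Y where Y: "Y \<subseteq> C" "independent Y" "C \<subseteq> span Y" "card Y = dim C" using basis_exists by blast
  have fX: "finite X" and fY: "finite Y"
    using independent_span_bound[OF assms(3) X(2)] independent_span_bound[OF assms(3) Y(2)] X(1) Y(1) assms(1,2) by auto
  have "C \<subseteq> span X"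
  proof
    fix x assume "x \<in> C"
    show "x \<in> span X"
    proof (rule ccontr)
      assume x: "x \<notin> span X"
      then have "independent (insert x X)" using X(2) by (simp add: independent_insert)
      moreover have "insert x X \<subseteq> span Y" using X(1) assms(1) Y(3) \<open>x \<in> C\<close> by auto
      ultimately have "card (insert x X) \<le> card Y" using independent_span_bound[OF fY] by blast
      moreover have "x \<notin> X" using x span_base by blast
      ultimately show False using X(4) Y(4) assms(4) fX by simp
    qed
  qed
  also have "span X \<subseteq> span A" using X(1) by (rule span_mono)
  finally show ?thesis using assms(1) span_mono[OF assms(1)] span_minimal[of C "span A"] by auto
qed

end

text \<open>\<open>ev p v\<close> is p(R) v. Finite dimension provides a non-zero polynomial
  annihilating \<open>w\<close>. Splitting off a root z, either R v = z v or R v - z v is a non-zero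
  vector of \<open>W\<close> annihilated by the cofactor, whose degree is smaller.\<close>

lemma eigenvector_exists:
  fixes scale :: "complex \<Rightarrow> 'b::ab_group_add \<Rightarrow> 'b"
  assumes vs: "vector_space scale" and R: "Vector_Spaces.linear scale scale R"
    and W: "module.subspace scale W" "\<And>v. v \<in> W \<Longrightarrow> R v \<in> W"
    and B: "finite B" "W \<subseteq> module.span scale B"
    and w: "w \<in> W" "w \<noteq> 0"
  shows "\<exists>v c. v \<in> W \<and> v \<noteq> 0 \<and> R v = scale c v"
proof -
  interpret vector_space scale by fact
  interpret R: Vector_Spaces.linear scale scale R by fact
  define ev where "ev p v = (\<Sum>i\<le>degree p. scale (coeff p i) ((R ^^ i) v))" for p v
  have ev: "ev p v = (\<Sum>i\<le>N. scale (coeff p i) ((R ^^ i) v))" if "degree p \<le> N" for p v N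
    unfolding ev_def by (rule sum.mono_neutral_left) (use that in \<open>auto simp: coeff_eq_0\<close>)
  have pow_add: "(R ^^ i) (u + v) = (R ^^ i) u + (R ^^ i) v"
    and pow_scale: "(R ^^ i) (scale c v) = scale c ((R ^^ i) v)" for i u v c
    by (induction i) (auto simp: R.add R.scale)
  have root: "ev ([:- z, 1:] * p) v = ev p (R v - scale z v)" for z p v
  proof -
    define N where "N = degree p"
    have "ev ([:- z, 1:] * p) v = (\<Sum>i\<le>Suc N. scale (coeff (pCons 0 p) i - z * coeff p i) ((R ^^ i) v))"
    proof -
      have "[:- z, 1:] * p = pCons 0 p - Polynomial.smult z p" by simp
      moreover have "degree ([:- z, 1:] * p) \<le> Suc N"
        using degree_mult_le[of "[:- z, 1:]" p] by (simp add: N_def)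
      ultimately show ?thesis by (subst ev) auto
    qed
    also have "\<dots> = (\<Sum>i\<le>Suc N. scale (coeff (pCons 0 p) i) ((R ^^ i) v)) - (\<Sum>i\<le>Suc N. scale z (scale (coeff p i) ((R ^^ i) v)))"
      by (simp add: scale_left_diff_distrib sum_subtractf)
    also have "(\<Sum>i\<le>Suc N. scale (coeff (pCons 0 p) i) ((R ^^ i) v)) = ev p (R v)"
      by (subst sum.atMost_Suc_shift) (simp add: ev_def N_def funpow_swap1)
    also have "(\<Sum>i\<le>Suc N. scale z (scale (coeff p i) ((R ^^ i) v))) = scale z (ev p v)"
      by (subst ev[of p "Suc N"]) (auto simp: N_def scale_sum_right scale_right_distrib)
    also have "ev p (R v) - scale z (ev p v) = ev p (R v - scale z v)"
    proof -
      have "ev p ((R v - scale z v) + scale z v) = ev p (R v - scale z v) + ev p (scale z v)"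
        by (simp only: ev_def pow_add scale_right_distrib sum.distrib)
      then have "ev p (R v) = ev p (R v - scale z v) + ev p (scale z v)" by (simp only: diff_add_cancel)
      moreover have "ev p (scale z v) = scale z (ev p v)"
        unfolding ev_def by (simp add: pow_scale scale_sum_right mult.commute)
      ultimately show ?thesis by simp
    qed
    finally show ?thesis .
  qed
  have pow_W: "(R ^^ i) w \<in> W" for i by (induction i) (auto intro: W w)
  obtain c where c: "\<exists>i\<le>card B. c i \<noteq> 0" "(\<Sum>i\<le>card B. scale (c i) ((R ^^ i) w)) = 0"
    using linear_relation_exists[of B "\<lambda>i. (R ^^ i) w"] B pow_W by blast
  define p0 where "p0 = (\<Sum>i\<le>card B. monom (c i) i)"
  have coeff_p0: "coeff p0 i = (if i \<le> card B then c i else 0)" for i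
    by (simp add: p0_def coeff_sum)
  obtain i0 where "i0 \<le> card B" "c i0 \<noteq> 0" using c(1) by blast
  then have "coeff p0 i0 \<noteq> 0" by (simp add: coeff_p0)
  then have "p0 \<noteq> 0" by auto
  have "degree p0 \<le> card B" by (rule degree_le) (simp add: coeff_p0)
  then have "ev p0 w = 0" using c(2) by (simp add: ev coeff_p0)
  have "p \<noteq> 0 \<Longrightarrow> v \<in> W \<Longrightarrow> v \<noteq> 0 \<Longrightarrow> ev p v = 0 \<Longrightarrow> ?thesis" for p v
  proof (induction "degree p" arbitrary: p v)
    case 0
    then have p: "[:coeff p 0:] = p" using degree_0_id[of p] by simp
    moreover have "scale (coeff p 0) v = 0" using 0 by (simp add: ev_def)
    ultimately have "coeff p 0 = 0" using 0 by simp
    then have "p = 0" using p by (simp only: pCons_0_0)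
    then show ?case using 0 by simp
  next
    case (Suc n)
    then obtain z where "poly p z = 0"
      using fundamental_theorem_of_algebra[of p] by (auto simp: constant_degree)
    then obtain r where r: "p = [:- z, 1:] * r" by (auto simp: poly_eq_0_iff_dvd elim: dvdE)
    show ?case
    proof (cases "R v - scale z v = 0")
      case True
      then show ?thesis using Suc.prems by auto
    next
      case False
      have "r \<noteq> 0" using Suc.prems r by auto
      then have "degree p = Suc (degree r)" unfolding r by (subst degree_mult_eq) auto
      then have "n = degree r" using Suc.hyps(2) by simp
      moreover have "R v - scale z v \<in> W" using W Suc.prems by (intro subspace_diff subspace_scale) auto
      moreover have "ev r (R v - scale z v) = 0" using Suc.prems root[of z r v] r by simp
      ultimately show ?thesis using Suc.hyps(1)[of r "R v - scale z v"] \<open>r \<noteq> 0\<close> False by blast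
    qed
  qed
  then show ?thesis using \<open>p0 \<noteq> 0\<close> w \<open>ev p0 w = 0\<close> by blast
qed

text \<open>Take a non-zero invariant subspace \<open>W\<close> of least dimension. An eigenspace of
  \<open>R i\<close> in \<open>W\<close> is invariant under the whole commuting family, hence equals
  \<open>W\<close>; so every non-zero vector of \<open>W\<close> is a common eigenvector. The family
  may be infinite.\<close>

lemma common_eigenvector_exists:
  fixes scale :: "complex \<Rightarrow> 'b::ab_group_add \<Rightarrow> 'b"
  assumes vs: "vector_space scale" and R: "\<And>i. i \<in> I \<Longrightarrow> Vector_Spaces.linear scale scale (R i)"
    and B: "finite B" "\<And>i v. i \<in> I \<Longrightarrow> v \<in> module.span scale B \<Longrightarrow> R i v \<in> module.span scale B"
    and commute: "\<And>i j v. i \<in> I \<Longrightarrow> j \<in> I \<Longrightarrow> R i (R j v) = R j (R i v)"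
    and w: "w \<in> module.span scale B" "w \<noteq> 0"
  shows "\<exists>v. v \<in> module.span scale B \<and> v \<noteq> 0 \<and> (\<forall>i\<in>I. \<exists>c. R i v = scale c v)"
proof -
  interpret vector_space scale by fact
  define Q where "Q W \<longleftrightarrow> subspace W \<and> W \<subseteq> span B \<and> (\<forall>i\<in>I. \<forall>v\<in>W. R i v \<in> W) \<and> (\<exists>v\<in>W. v \<noteq> 0)" for W
  have "Q (span B)" using B w by (auto simp: Q_def)
  then obtain W where W: "Q W" "\<And>W'. Q W' \<Longrightarrow> dim W \<le> dim W'"
    using ex_has_least_nat[of Q "span B" dim] by blast
  obtain v where v: "v \<in> W" "v \<noteq> 0" using W(1) by (auto simp: Q_def)
  have "\<exists>c. R i v = scale c v" if i: "i \<in> I" for i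
  proof -
    interpret Ri: Vector_Spaces.linear scale scale "R i" using R i by blast
    obtain u c where u: "u \<in> W" "u \<noteq> 0" "R i u = scale c u"
      using eigenvector_exists[OF vs R[OF i], of W B v] W(1) v B(1) i unfolding Q_def by blast
    define E where "E = {u \<in> W. R i u = scale c u}"
    have "subspace E"
      using W(1) unfolding Q_def E_def subspace_def
      by (auto simp: Ri.zero Ri.add Ri.scale scale_right_distrib scale_left_commute)
    moreover have "\<forall>j\<in>I. \<forall>u\<in>E. R j u \<in> E"
    proof (intro ballI)
      fix j u assume j: "j \<in> I" "u \<in> E"
      interpret Rj: Vector_Spaces.linear scale scale "R j" using R j by blast
      show "R j u \<in> E"
        using j W(1) commute[OF i j(1), of u] unfolding E_def Q_def by (simp add: Rj.scale)
    qed
    ultimately have "Q E" using u W(1) unfolding Q_def E_def by blast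
    have "E \<subseteq> W" "W \<subseteq> span B" using W(1) by (auto simp: E_def Q_def)
    moreover have "dim E \<le> dim W"
    proof -
      obtain Y where Y: "Y \<subseteq> W" "independent Y" "W \<subseteq> span Y" "card Y = dim W" using basis_exists by blast
      then have "finite Y" using independent_span_bound[OF B(1) Y(2)] \<open>W \<subseteq> span B\<close> by blast
      then show ?thesis using dim_le_card[of E Y] Y \<open>E \<subseteq> W\<close> by auto
    qed
    ultimately have "span E = span W"
      using W(2)[OF \<open>Q E\<close>] B(1) by (intro span_eq_of_dim_eq) auto
    then have "E = W" using \<open>subspace E\<close> W(1) span_eq_iff unfolding Q_def by metis
    then show ?thesis using v(1) unfolding E_def by blast
  qed
  then show ?thesis using v W(1) unfolding Q_def by blast
qed

section \<open>Operator semigroups on the space of all sequences\<close>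

text \<open>Turns functions into a vector space, so that spans and dimensions of sets of functionals
  make sense, for values in the scalar field as well as in the complex numbers.\<close>

definition pointwise_scale :: "'c::field \<Rightarrow> ('x \<Rightarrow> 'c) \<Rightarrow> 'x \<Rightarrow> 'c" where
  "pointwise_scale c F = (\<lambda>x. c * F x)"

lemma vector_space_pointwise_scale: "vector_space (pointwise_scale :: 'c::field \<Rightarrow> ('x \<Rightarrow> 'c) \<Rightarrow> _)"
  by unfold_locales (auto simp: pointwise_scale_def fun_eq_iff algebra_simps)

interpretation fs: vector_space "pointwise_scale :: 'c::field \<Rightarrow> ('x \<Rightarrow> 'c) \<Rightarrow> 'x \<Rightarrow> 'c"
  by (rule vector_space_pointwise_scale)

lemma pointwise_scale_apply [simp]: "pointwise_scale c F x = c * F x"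
  by (simp add: pointwise_scale_def)

lemma pointwise_add_apply:
  "(\<lambda>x. (pointwise_scale c F + G) (h x)) = pointwise_scale c (\<lambda>x. F (h x)) + (\<lambda>x. G (h x))"
  by (rule ext) (simp only: plus_fun_apply pointwise_scale_apply)

lemma vector_space_omega: "vector_space (omega_scale :: 'k::real_normed_field \<Rightarrow> _)"
  by unfold_locales (auto simp: omega_scale_def fun_eq_iff algebra_simps)

lemma omega_scale_apply [simp]: "omega_scale c x i = c * x i"
  by (simp add: omega_scale_def)

lemma tendsto_coordinatewise:
  fixes f :: "'i \<Rightarrow> nat \<Rightarrow> 'b::topological_space"
  assumes "\<And>i. ((\<lambda>n. f n i) \<longlongrightarrow> l i) F"
  shows "(f \<longlongrightarrow> l) F"
proof -
  have "limitin (product_topology (\<lambda>i. euclidean) UNIV) f l F"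
    unfolding limitin_componentwise using assms by (simp add: limitin_canonical_iff)
  then show ?thesis by (simp add: euclidean_product_topology limitin_canonical_iff)
qed

lemma tendsto_coordinate:
  fixes f :: "'i \<Rightarrow> nat \<Rightarrow> 'b::topological_space"
  assumes "(f \<longlongrightarrow> l) F"
  shows "((\<lambda>n. f n i) \<longlongrightarrow> l i) F"
  using continuous_on_tendsto_compose[of UNIV "\<lambda>x. x i", OF continuous_on_product_coordinates assms] by simp

definition omega_functional :: "((nat \<Rightarrow> 'k::real_normed_field) \<Rightarrow> 'k) \<Rightarrow> bool" where
  "omega_functional F \<longleftrightarrow> (\<forall>x y. F (x + y) = F x + F y) \<and> (\<forall>c x. F (omega_scale c x) = c * F x) \<and>
    continuous_on UNIV F"

lemma omega_functionalD:
  assumes "omega_functional F"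
  shows "F (x + y) = F x + F y" "F (omega_scale c x) = c * F x" "continuous_on UNIV F"
  using assms unfolding omega_functional_def by auto

lemma omega_functional_linear:
  "omega_functional F \<Longrightarrow> Vector_Spaces.linear omega_scale (*) F"
proof -
  assume F: "omega_functional F"
  interpret vector_space "omega_scale :: 'a \<Rightarrow> _" by (rule vector_space_omega)
  show ?thesis by unfold_locales (auto simp: omega_functionalD[OF F] algebra_simps)
qed

lemma omega_functional_simps:
  assumes "omega_functional F"
  shows "F 0 = 0" "F (- x) = - F x" "F (x - y) = F x - F y" "F (sum g A) = (\<Sum>i\<in>A. F (g i))"
proof -
  interpret F: Vector_Spaces.linear omega_scale "(*)" F by (rule omega_functional_linear) fact
  show "F 0 = 0" "F (- x) = - F x" "F (x - y) = F x - F y" "F (sum g A) = (\<Sum>i\<in>A. F (g i))"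
    by (rule F.zero F.neg F.diff F.sum)+
qed

lemma omega_functional_coordinate: "omega_functional (\<lambda>x. x i)"
  unfolding omega_functional_def by auto

lemma omega_functional_span:
  assumes "\<And>F. F \<in> B \<Longrightarrow> omega_functional F" "G \<in> fs.span B"
  shows "omega_functional G"
  using assms(2)
proof (induction rule: fs.span_induct_alt)
  case base
  then show ?case by (simp add: omega_functional_def zero_fun_def)
next
  case (step c F G)
  have F: "omega_functional F" using assms(1) step(1) by blast
  have eq: "pointwise_scale c F + G = (\<lambda>x. c * F x + G x)" by (simp add: fun_eq_iff)
  show ?case
    unfolding eq omega_functional_def omega_functionalD(1,2)[OF F] omega_functionalD(1,2)[OF step(2)]
    by (intro conjI allI continuous_intros omega_functionalD(3)[OF F] omega_functionalD(3)[OF step(2)])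
      (simp_all only: distrib_left add_ac mult.left_commute)
qed

text \<open>Otherwise the vectors \<open>z M\<close> vanish on the first \<open>M\<close>
  coordinates, hence tend to 0 however large their other entries are, although \<open>F\<close> is 1
  at each of them.\<close>

lemma omega_functional_finite_support:
  assumes F: "omega_functional F"
  shows "\<exists>M. \<forall>x. (\<forall>i<M. x i = 0) \<longrightarrow> F x = 0"
proof (rule ccontr)
  assume "\<not> ?thesis"
  then have "\<forall>M. \<exists>x. (\<forall>i<M. x i = 0) \<and> F x \<noteq> 0" by blast
  then obtain x where x: "\<And>M i. i < M \<Longrightarrow> x M i = 0" "\<And>M. F (x M) \<noteq> 0" by metis
  define z where "z M = omega_scale (1 / F (x M)) (x M)" for M
  have "z \<longlonglongrightarrow> 0"
  proof (rule tendsto_coordinatewise, rule tendsto_eventually)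
    fix i
    show "\<forall>\<^sub>F n in sequentially. z n i = 0 i"
      by (rule eventually_mono[OF eventually_gt_at_top[of i]]) (simp add: z_def x)
  qed
  then have "(\<lambda>n. F (z n)) \<longlonglongrightarrow> F 0"
    using omega_functionalD(3)[OF F] by (intro continuous_on_tendsto_compose[where s = UNIV and f = F]) auto
  moreover have "F (z n) = 1" for n unfolding z_def omega_functionalD(2)[OF F] using x(2) by simp
  ultimately show False using omega_functional_simps(1)[OF F] LIMSEQ_unique[of "\<lambda>n. 1 :: 'a" 1 0] by simp
qed

lemma omega_functional_in_span:
  assumes F: "omega_functional F" and M: "\<And>x. (\<forall>i<M. x i = 0) \<Longrightarrow> F x = 0"
  shows "F \<in> fs.span ((\<lambda>i x. x i) ` {..<M})"
proof -
  define e :: "nat \<Rightarrow> nat \<Rightarrow> 'a" where "e i j = of_bool (i = j)" for i j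
  have "F = (\<Sum>i<M. pointwise_scale (F (e i)) (\<lambda>x. x i))"
  proof
    fix x
    have sum_apply: "(\<Sum>i<M. h i) y = (\<Sum>i<M. h i y)" for h :: "nat \<Rightarrow> 'x \<Rightarrow> 'a" and y
      by (induction M) auto
    have "(\<Sum>i<M. omega_scale (x i) (e i)) j = x j" if "j < M" for j
    proof -
      have "(\<Sum>i<M. omega_scale (x i) (e i)) j = (\<Sum>i<M. if i = j then x i else 0)"
        unfolding sum_apply by (rule sum.cong) (auto simp: e_def)
      then show ?thesis using that by simp
    qed
    then have "F (x - (\<Sum>i<M. omega_scale (x i) (e i))) = 0" by (intro M) auto
    then have "F x = (\<Sum>i<M. x i * F (e i))"
      by (simp add: omega_functional_simps[OF F] omega_functionalD(2)[OF F])
    then show "F x = (\<Sum>i<M. pointwise_scale (F (e i)) (\<lambda>x. x i)) x"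
      by (simp add: sum_apply mult.commute)
  qed
  also have "\<dots> \<in> fs.span ((\<lambda>i x. x i) ` {..<M})"
    by (intro fs.span_sum fs.span_scale fs.span_base) auto
  finally show ?thesis .
qed

locale omega_semigroup =
  fixes S :: "real \<Rightarrow> (nat \<Rightarrow> 'k::{real_normed_field,heine_borel}) \<Rightarrow> nat \<Rightarrow> 'k"
  assumes S_add: "0 \<le> t \<Longrightarrow> S t (x + y) = S t x + S t y"
    and S_scale: "0 \<le> t \<Longrightarrow> S t (omega_scale c x) = omega_scale c (S t x)"
    and S_continuous: "0 \<le> t \<Longrightarrow> continuous_on UNIV (S t)"
    and S_0: "S 0 x = x"
    and S_plus: "0 \<le> s \<Longrightarrow> 0 \<le> t \<Longrightarrow> S (s + t) x = S t (S s x)"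
    and S_strong: "continuous_on {0..} (\<lambda>t. S t x)"
begin

lemma functional_S:
  assumes F: "omega_functional F" and t: "0 \<le> t"
  shows "omega_functional (\<lambda>x. F (S t x))"
  unfolding omega_functional_def
  using omega_functionalD(1,2)[OF F] S_add[OF t] S_scale[OF t]
    continuous_on_compose2[OF omega_functionalD(3)[OF F] S_continuous[OF t]] by auto

lemma functional_orbit_continuous:
  assumes "omega_functional F"
  shows "continuous_on {0..} (\<lambda>t. F (S t x))"
  using continuous_on_compose2[OF omega_functionalD(3)[OF assms] S_strong] by auto

text \<open>A gliding hump: otherwise some orbit would be unbounded on \<open>[0, 1]\<close>.\<close>

lemma uniform_finite_support:
  assumes F: "omega_functional F"
  shows "\<exists>M. \<forall>t\<in>{0..1}. \<forall>x. (\<forall>i<M. x i = 0) \<longrightarrow> F (S t x) = 0"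
proof (rule ccontr)
  assume neg: "\<not> ?thesis"
  have FS: "omega_functional (\<lambda>x. F (S t x))" if "t \<in> {0..1}" for t using functional_S[OF F] that by simp
  \<comment> \<open>A state is a vector with a number of frozen coordinates. A step changes the
    vector beyond these only, makes the value of F at some S t of it at least \<open>n\<close>, and
    freezes enough coordinates for that functional to ignore all later changes.\<close>
  have "\<exists>f. \<forall>n. n \<le> snd (f n) \<and> ((\<forall>i<snd (f n). fst (f (Suc n)) i = fst (f n) i) \<and> snd (f n) \<le> snd (f (Suc n)) \<and>
     (\<exists>t\<in>{0..1}. real n \<le> norm (F (S t (fst (f (Suc n))))) \<and>
       (\<forall>x. (\<forall>i<snd (f (Suc n)). x i = 0) \<longrightarrow> F (S t x) = 0)))"
  proof (rule dependent_nat_choice)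
    show "\<exists>s :: (nat \<Rightarrow> 'k) \<times> nat. 0 \<le> snd s" by auto
    fix s :: "(nat \<Rightarrow> 'k) \<times> nat" and n assume "n \<le> snd s"
    obtain t x where t: "t \<in> {0..1}" and x: "\<forall>i<snd s. x i = 0" "F (S t x) \<noteq> 0" using neg by blast
    \<comment> \<open>Chosen so that the new contribution exceeds the old value by exactly
      \<open>n\<close> in norm, which rules out cancellation.\<close>
    define a :: 'k where "a = of_real ((real n + norm (F (S t (fst s)))) / norm (F (S t x)))"
    define z where "z = fst s + omega_scale a x"
    have "norm (a * F (S t x)) = real n + norm (F (S t (fst s)))"
      using x(2) unfolding a_def norm_mult norm_of_real by (simp add: field_simps)
    moreover have "F (S t z) = F (S t (fst s)) + a * F (S t x)"
      unfolding z_def using omega_functionalD(1,2)[OF FS[OF t]] by simp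
    ultimately have "real n \<le> norm (F (S t z))"
      using norm_diff_ineq[of "a * F (S t x)" "F (S t (fst s))"] by (simp add: add.commute)
    moreover obtain M where M: "\<forall>x. (\<forall>i<M. x i = 0) \<longrightarrow> F (S t x) = 0"
      using omega_functional_finite_support[OF FS[OF t]] by blast
    moreover have "z i = fst s i" if "i < snd s" for i using x(1) that by (simp add: z_def)
    ultimately show "\<exists>s'. Suc n \<le> snd s' \<and> ((\<forall>i<snd s. fst s' i = fst s i) \<and> snd s \<le> snd s' \<and>
     (\<exists>t\<in>{0..1}. real n \<le> norm (F (S t (fst s'))) \<and> (\<forall>x. (\<forall>i<snd s'. x i = 0) \<longrightarrow> F (S t x) = 0)))"
      using t by (intro exI[of _ "(z, max M (max (Suc n) (snd s)))"]) auto
  qed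
  then obtain f where f: "\<And>n. n \<le> snd (f n)" "\<And>n i. i < snd (f n) \<Longrightarrow> fst (f (Suc n)) i = fst (f n) i"
     "\<And>n. snd (f n) \<le> snd (f (Suc n))"
     "\<And>n. \<exists>t\<in>{0..1}. real n \<le> norm (F (S t (fst (f (Suc n))))) \<and>
       (\<forall>x. (\<forall>i<snd (f (Suc n)). x i = 0) \<longrightarrow> F (S t x) = 0)" by blast
  have mono: "snd (f n) \<le> snd (f m)" if "n \<le> m" for n m using lift_Suc_mono_le[of "\<lambda>n. snd (f n)", OF f(3) that] .
  have stable: "fst (f m) i = fst (f n) i" if "n \<le> m" "i < snd (f n)" for n m i
    using that(1)
  proof (induction m rule: dec_induct)
    case (step m)
    have "i < snd (f m)" using that(2) mono[OF step(1)] by simp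
    then show ?case using f(2) step by simp
  qed simp
  define y where "y i = fst (f (Suc i)) i" for i
  have y: "y i = fst (f n) i" if "i < snd (f n)" for i n
  proof (cases "n \<le> Suc i")
    case True
    then show ?thesis using stable[OF True that] by (simp add: y_def)
  next
    case False
    have "i < snd (f (Suc i))" using f(1)[of "Suc i"] by simp
    then show ?thesis using stable[of "Suc i" n i] False by (simp add: y_def)
  qed
  have "bounded ((\<lambda>t. F (S t y)) ` {0..1})"
    by (intro compact_imp_bounded compact_continuous_image continuous_on_subset[OF functional_orbit_continuous[OF F]]) auto
  then obtain K where "\<forall>z\<in>(\<lambda>t. F (S t y)) ` {0..1}. norm z \<le> K" unfolding bounded_iff by blast
  then have K: "norm (F (S t y)) \<le> K" if "t \<in> {0..1}" for t using that by blast
  obtain n where n: "K < real n" using reals_Archimedean2 by blast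
  obtain t where t: "t \<in> {0..1}" "real n \<le> norm (F (S t (fst (f (Suc n)))))"
      "\<forall>x. (\<forall>i<snd (f (Suc n)). x i = 0) \<longrightarrow> F (S t x) = 0"
    using f(4) by blast
  have "F (S t (y - fst (f (Suc n)))) = 0" using t(3) y by simp
  then have "F (S t y) = F (S t (fst (f (Suc n))))" using omega_functional_simps(3)[OF FS[OF t(1)]] by simp
  then show False using K[OF t(1)] t(2) n by simp
qed

text \<open>The spans of \<open>{F \<circ> S t | t \<le> a}\<close> shrink as \<open>a\<close> decreases and have finite dimension,
  so they are eventually constant; the eventual value is invariant.\<close>

lemma finite_invariant_span:
  assumes F: "omega_functional F"
  shows "\<exists>B. finite B \<and> (\<forall>G\<in>B. omega_functional G) \<and> F \<in> fs.span B \<and>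
    (\<forall>G\<in>fs.span B. \<forall>t\<ge>0. (\<lambda>x. G (S t x)) \<in> fs.span B)"
proof -
  obtain M where M: "\<And>t x. t \<in> {0..1} \<Longrightarrow> (\<forall>i<M. x i = 0) \<Longrightarrow> F (S t x) = 0"
    using uniform_finite_support[OF F] by blast
  define Orb where "Orb a = {\<lambda>x. F (S t x) | t. t \<in> {0..a}}" for a
  define E :: "((nat \<Rightarrow> 'k) \<Rightarrow> 'k) set" where "E = (\<lambda>i x. x i) ` {..<M}"
  have "finite E" by (simp add: E_def)
  have func: "omega_functional G" if "G \<in> Orb a" for G a using that functional_S[OF F] by (auto simp: Orb_def)
  have OrbE: "Orb a \<subseteq> fs.span E" if "a \<le> 1" for a
  proof
    fix G assume "G \<in> Orb a"
    then obtain t where t: "G = (\<lambda>x. F (S t x))" "t \<in> {0..a}" by (auto simp: Orb_def)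
    show "G \<in> fs.span E" unfolding E_def
      by (rule omega_functional_in_span[OF func[OF \<open>G \<in> Orb a\<close>]]) (use t M that in auto)
  qed
  obtain a where a: "a \<in> {0<..1}" "\<And>b. b \<in> {0<..1} \<Longrightarrow> fs.dim (Orb a) \<le> fs.dim (Orb b)"
    using ex_has_least_nat[of "\<lambda>a. a \<in> {0<..1::real}" 1 "\<lambda>a. fs.dim (Orb a)"] by auto
  have sub: "Orb (a / 2) \<subseteq> Orb a" using a(1) by (force simp: Orb_def)
  obtain B where B: "B \<subseteq> Orb a" "fs.independent B" "Orb a \<subseteq> fs.span B" "card B = fs.dim (Orb a)"
    using fs.basis_exists by blast
  have finB: "finite B" using fs.independent_span_bound[OF \<open>finite E\<close> B(2)] B(1) OrbE[of a] a(1) by auto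
  have "fs.dim (Orb (a / 2)) \<le> fs.dim (Orb a)"
    using fs.dim_le_card[of "Orb (a / 2)" B] sub B finB by auto
  then have "fs.span (Orb (a / 2)) = fs.span (Orb a)"
    using a by (intro fs.span_eq_of_dim_eq[OF sub OrbE \<open>finite E\<close>] antisym) auto
  moreover have spanB: "fs.span B = fs.span (Orb a)"
    using B fs.span_mono[OF B(1)] fs.span_minimal[OF B(3)] by auto
  ultimately have half: "fs.span B = fs.span (Orb (a / 2))" by simp
  \<comment> \<open>Since \<open>Orb (a / 2)\<close> already spans, only generators with time at
    most a / 2 need to be checked, and shifting them by another \<open>t \<le> a / 2\<close> stays
    within \<open>Orb a\<close>. Larger times are reached by iteration.\<close>
  have step: "(\<lambda>x. G (S t x)) \<in> fs.span B" if G: "G \<in> fs.span B" and t: "t \<in> {0..a / 2}" for G t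
    using G unfolding half
  proof (induction rule: fs.span_induct_alt)
    case base
    have eq: "(\<lambda>x. 0 (S t x)) = (0 :: (nat \<Rightarrow> 'k) \<Rightarrow> 'k)" by (simp add: fun_eq_iff)
    show ?case unfolding eq by (rule fs.span_zero)
  next
    case (step c H G)
    obtain s where s: "H = (\<lambda>x. F (S s x))" "s \<in> {0..a / 2}" using step(1) by (auto simp: Orb_def)
    have "(\<lambda>x. H (S t x)) = (\<lambda>x. F (S (t + s) x))" 
    proof (rule ext)
      fix x show "H (S t x) = F (S (t + s) x)" using s t by (simp only: s(1) S_plus atLeastAtMost_iff)
    qed
    also have "\<dots> \<in> Orb a" using s(2) t by (auto simp: Orb_def intro!: exI[of _ "t + s"])
    finally have "(\<lambda>x. H (S t x)) \<in> fs.span (Orb (a / 2))" using half spanB fs.span_base by auto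
    then show ?case
      by (subst pointwise_add_apply) (intro fs.span_add fs.span_scale step(2))
  qed
  have "(\<lambda>x. G (S t x)) \<in> fs.span B" if "G \<in> fs.span B" "0 \<le> t" "t \<le> real n * (a / 2)" for G t n
    using that
  proof (induction n arbitrary: G t)
    case 0
    then show ?case by (simp add: S_0)
  next
    case (Suc n)
    define s where "s = min t (a / 2)"
    have s: "s \<in> {0..a / 2}" using Suc.prems a(1) by (auto simp: s_def)
    have ts: "0 \<le> t - s" "t - s \<le> real n * (a / 2)" using Suc.prems by (auto simp: s_def min_def algebra_simps)
    have "(\<lambda>x. G (S (t - s) x)) \<in> fs.span B" by (rule Suc.IH[OF Suc.prems(1) ts])
    from step[OF this s] have "(\<lambda>x. G (S (t - s) (S s x))) \<in> fs.span B" .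
    moreover have "S t x = S (t - s) (S s x)" for x using S_plus[of s "t - s" x] s ts by simp
    ultimately show ?case by (simp only:)
  qed
  moreover have "\<exists>n. t \<le> real n * (a / 2)" for t
  proof -
    obtain n where "t / (a / 2) \<le> real n" using real_arch_simple by blast
    then show ?thesis using a(1) by (intro exI[of _ n]) (simp add: field_simps)
  qed
  ultimately have "\<forall>G\<in>fs.span B. \<forall>t\<ge>0. (\<lambda>x. G (S t x)) \<in> fs.span B" by meson
  moreover have "F \<in> fs.span B"
  proof -
    have "F = (\<lambda>x. F (S 0 x))" by (simp add: S_0)
    also have "\<dots> \<in> Orb a" using a(1) by (auto simp: Orb_def intro!: exI[of _ 0])
    finally show ?thesis unfolding spanB by (rule fs.span_base)
  qed
  moreover have "\<forall>G\<in>B. omega_functional G" by (intro ballI func[OF subsetD[OF B(1)]])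
  ultimately show ?thesis using finB by (intro exI[of _ B] conjI)
qed

lemma finite_invariant_span_coordinates:
  "\<exists>B. finite B \<and> (\<forall>G\<in>B. omega_functional G) \<and> (\<forall>i<k. (\<lambda>x. x i) \<in> fs.span B) \<and>
    (\<forall>G\<in>fs.span B. \<forall>t\<ge>0. (\<lambda>x. G (S t x)) \<in> fs.span B)"
proof -
  obtain B where B: "\<And>i. finite (B i) \<and> (\<forall>G\<in>B i. omega_functional G) \<and> (\<lambda>x. x i) \<in> fs.span (B i) \<and>
    (\<forall>G\<in>fs.span (B i). \<forall>t\<ge>0. (\<lambda>x. G (S t x)) \<in> fs.span (B i))"
    using finite_invariant_span[OF omega_functional_coordinate] by metis
  define C where "C = (\<Union>i<k. B i)"
  have sub: "fs.span (B i) \<subseteq> fs.span C" if "i < k" for i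
    unfolding C_def by (rule fs.span_mono) (use that in auto)
  have "(\<lambda>x. G (S t x)) \<in> fs.span C" if "G \<in> fs.span C" "0 \<le> t" for G t
    using that(1)
  proof (induction rule: fs.span_induct_alt)
    case base
    have eq: "(\<lambda>x. 0 (S t x)) = (0 :: (nat \<Rightarrow> 'k) \<Rightarrow> 'k)" by (simp add: fun_eq_iff)
    show ?case unfolding eq by (rule fs.span_zero)
  next
    case (step c H G)
    obtain i where i: "i < k" "H \<in> B i" using step(1) by (auto simp: C_def)
    then have "(\<lambda>x. H (S t x)) \<in> fs.span C" using B[of i] sub fs.span_base that(2) by blast
    then show ?case
      by (subst pointwise_add_apply) (intro fs.span_add fs.span_scale step(2))
  qed
  moreover have "finite C" "\<forall>G\<in>C. omega_functional G" using B by (auto simp: C_def)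
  moreover have "\<forall>i<k. (\<lambda>x. x i) \<in> fs.span C" using B sub by blast
  ultimately show ?thesis by blast
qed

end

section \<open>Supercyclic semigroups on the space of all sequences\<close>

locale omega_supercyclic = omega_semigroup S
  for S :: "real \<Rightarrow> (nat \<Rightarrow> 'k::{real_normed_field,heine_borel}) \<Rightarrow> nat \<Rightarrow> 'k" +
  fixes x :: "nat \<Rightarrow> 'k"
  assumes dense: "closure {omega_scale z (S t x) | z t. t \<in> {0..}} = UNIV"
begin

lemma functional_eq_0:
  assumes F: "omega_functional F" and "\<And>t. 0 \<le> t \<Longrightarrow> F (S t x) = 0"
  shows "F y = 0"
proof -
  have "{omega_scale z (S t x) | z t. t \<in> {0..}} \<subseteq> {y. F y = 0}"
    using assms(2) omega_functionalD(2)[OF F] by auto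
  moreover have "closed {y. F y = 0}"
    using omega_functionalD(3)[OF F] by (intro closed_Collect_eq) auto
  ultimately have "closure {omega_scale z (S t x) | z t. t \<in> {0..}} \<subseteq> {y. F y = 0}" by (rule closure_minimal)
  then show ?thesis unfolding dense by blast
qed

text \<open>A biorthogonal family of functionals from the invariant span and points of the orbit, of
  maximal length. By maximality the orbit points \<open>S (s i) x\<close> represent a basis of the
  quotient with dual basis \<open>G i\<close>. Having the basis on the orbit is what lets
  \<open>star\<close> be defined through the operators \<open>S (s i)\<close>.\<close>

lemma dual_system_exists:
  "\<exists>(m :: nat) G s. (\<forall>i<m. omega_functional (G i) \<and> 0 \<le> s i) \<and>
    (\<forall>i<m. \<forall>j<m. G i (S (s j) x) = of_bool (i = j)) \<and>
    (\<forall>i<m. \<forall>t\<ge>0. \<forall>y. G i (S t y) = (\<Sum>l<m. G i (S t (S (s l) x)) * G l y)) \<and>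
    (\<forall>y. (\<forall>i<m. G i y = 0) \<longrightarrow> (\<forall>i<k. y i = 0))"
proof -
  obtain B where B: "finite B" "\<And>G. G \<in> B \<Longrightarrow> omega_functional G" "\<And>i. i < k \<Longrightarrow> (\<lambda>x. x i) \<in> fs.span B"
    "\<And>G t. G \<in> fs.span B \<Longrightarrow> 0 \<le> t \<Longrightarrow> (\<lambda>x. G (S t x)) \<in> fs.span B"
    using finite_invariant_span_coordinates[of k] by meson
  have func: "omega_functional G" if "G \<in> fs.span B" for G using B(2) that by (rule omega_functional_span)
  define dual where "dual m G s \<longleftrightarrow> (\<forall>i<m. G i \<in> fs.span B \<and> 0 \<le> s i) \<and>
    (\<forall>i<m. \<forall>j<m. G i (S (s j) x) = of_bool (i = j))" for m :: nat and G s
  define D where "D m \<longleftrightarrow> (\<exists>G s. dual m G s)" for m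
  have "m \<le> card B" if Dm: "D m" for m
  proof -
    obtain G s where "dual m G s" using Dm unfolding D_def by blast
    then have G: "\<And>i. i < m \<Longrightarrow> G i \<in> fs.span B"
      "\<And>i j. i < m \<Longrightarrow> j < m \<Longrightarrow> G i (S (s j) x) = of_bool (i = j)" by (simp_all add: dual_def)
    have "Vector_Spaces.linear pointwise_scale (*) (\<lambda>F :: (nat \<Rightarrow> 'k) \<Rightarrow> 'k. F (S (s i) x))" for i
      by unfold_locales (auto simp: algebra_simps)
    then show ?thesis
      by (intro fs.biorthogonal_card_le[where b = G and f = "\<lambda>i F. F (S (s i) x)"] B(1) G(1)) (auto simp: G(2))
  qed
  moreover have "D 0" by (simp add: D_def dual_def)
  ultimately obtain m where m: "D m" "\<And>n. D n \<Longrightarrow> n \<le> m"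
    using GreatestI_nat[of D 0 "card B"] Greatest_le_nat[of D _ "card B"] by blast
  obtain G s where "dual m G s" using m(1) unfolding D_def by blast
  then have G: "\<And>i. i < m \<Longrightarrow> G i \<in> fs.span B" "\<And>i. i < m \<Longrightarrow> 0 \<le> s i"
    "\<And>i j. i < m \<Longrightarrow> j < m \<Longrightarrow> G i (S (s j) x) = of_bool (i = j)" by (simp_all add: dual_def)
  have expand: "H y = (\<Sum>l<m. H (S (s l) x) * G l y)" if H: "H \<in> fs.span B" for H y
  proof -
    define E where "E = H - (\<Sum>l<m. pointwise_scale (H (S (s l) x)) (G l))"
    have sum_apply: "(\<Sum>l<m. h l) z = (\<Sum>l<m. h l z)" for h :: "nat \<Rightarrow> (nat \<Rightarrow> 'k) \<Rightarrow> 'k" and z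
      by (induction m) auto
    have E_apply: "E z = H z - (\<Sum>l<m. H (S (s l) x) * G l z)" for z
      by (simp add: E_def sum_apply)
    have E_span: "E \<in> fs.span B" unfolding E_def
      by (intro fs.span_diff fs.span_sum fs.span_scale G H) auto
    have E_v: "E (S (s j) x) = 0" if "j < m" for j
    proof -
      have "(\<Sum>l<m. H (S (s l) x) * G l (S (s j) x)) = (\<Sum>l<m. if l = j then H (S (s l) x) else 0)"
        by (rule sum.cong) (use G(3) that in auto)
      then show ?thesis using that by (simp add: E_apply)
    qed
    have "E (S t x) = 0" if "0 \<le> t" for t
    proof (rule ccontr)
      assume nz: "E (S t x) \<noteq> 0"
      \<comment> \<open>A functional vanishing at all chosen orbit points but not at
        \<open>S t x\<close> would lengthen the family: it is normalised at \<open>S t x\<close>,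
        and the old functionals are corrected to vanish there.\<close>
      define g where "g = pointwise_scale (1 / E (S t x)) E"
      define G' where "G' i = (if i = m then g else G i - pointwise_scale (G i (S t x)) g)" for i
      define s' where "s' i = (if i = m then t else s i)" for i
      have g: "g \<in> fs.span B" "g (S t x) = 1" "\<And>j. j < m \<Longrightarrow> g (S (s j) x) = 0"
        using nz E_v E_span by (auto simp: g_def intro: fs.span_scale)
      have "G' i \<in> fs.span B \<and> 0 \<le> s' i" if "i < Suc m" for i
        using that \<open>0 \<le> t\<close> G g(1) by (auto simp: G'_def s'_def less_Suc_eq intro!: fs.span_diff fs.span_scale)
      moreover have "G' i (S (s' j) x) = of_bool (i = j)" if "i < Suc m" "j < Suc m" for i j
        using that G(3) g(2,3) by (auto simp: G'_def s'_def less_Suc_eq)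
      ultimately have "dual (Suc m) G' s'" unfolding dual_def by blast
      then have "D (Suc m)" unfolding D_def by blast
      then show False using m(2)[of "Suc m"] by simp
    qed
    then have "E y = 0" by (rule functional_eq_0[OF func[OF E_span]])
    then show ?thesis by (simp add: E_apply)
  qed
  show ?thesis
  proof (intro exI[of _ m] exI[of _ G] exI[of _ s] conjI allI impI)
    fix i y and t :: real assume i: "i < m" and t: "0 \<le> t"
    show "G i (S t y) = (\<Sum>l<m. G i (S t (S (s l) x)) * G l y)"
      by (rule expand[OF B(4)[OF G(1)[OF i] t]])
  next
    fix y i assume "\<forall>i<m. G i y = 0" "i < k"
    then show "y i = 0" using expand[OF B(3), of i y] by simp
  qed (use G func in auto)
qed

end

text \<open>Eigenvalues are sought in the complex numbers for either scalar field; this map lets the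
  real and the complex case share the argument.\<close>

locale scalar_embedding =
  fixes \<iota> :: "'k::{real_normed_field,heine_borel} \<Rightarrow> complex"
  assumes \<iota>_add: "\<iota> (a + b) = \<iota> a + \<iota> b"
    and \<iota>_mult: "\<iota> (a * b) = \<iota> a * \<iota> b"
    and norm_\<iota>: "norm (\<iota> a) = norm a"
    and \<iota>_of_real: "\<iota> (of_real r) = of_real r"
begin

lemma \<iota>_0: "\<iota> 0 = 0" and \<iota>_1: "\<iota> 1 = 1"
  using \<iota>_of_real[of 0] \<iota>_of_real[of 1] by simp_all

lemma \<iota>_diff: "\<iota> (a - b) = \<iota> a - \<iota> b"
  using \<iota>_add[of "a - b" b] by (simp add: algebra_simps)

lemma \<iota>_sum: "\<iota> (\<Sum>i\<in>A. h i) = (\<Sum>i\<in>A. \<iota> (h i))"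
  by (induction A rule: infinite_finite_induct) (auto simp: \<iota>_0 \<iota>_add)

lemma \<iota>_continuous: "continuous_on UNIV \<iota>"
  unfolding continuous_on_iff
  by (auto simp: dist_norm norm_\<iota> simp flip: \<iota>_diff)

end

text \<open>\<open>coordinates\<close> is the form in which the dimension of the quotient is used:
  the first three unit sequences remain independent modulo the common kernel of the
  \<open>G i\<close>.\<close>

locale dual_system = omega_supercyclic S x + scalar_embedding \<iota>
  for S :: "real \<Rightarrow> (nat \<Rightarrow> 'k::{real_normed_field,heine_borel}) \<Rightarrow> nat \<Rightarrow> 'k" and x and \<iota> :: "'k \<Rightarrow> complex" +
  fixes m :: nat and G :: "nat \<Rightarrow> (nat \<Rightarrow> 'k) \<Rightarrow> 'k" and s :: "nat \<Rightarrow> real"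
  assumes G: "i < m \<Longrightarrow> omega_functional (G i)"
    and s_nonneg: "i < m \<Longrightarrow> 0 \<le> s i"
    and dual: "i < m \<Longrightarrow> j < m \<Longrightarrow> G i (S (s j) x) = of_bool (i = j)"
    and expand: "i < m \<Longrightarrow> 0 \<le> t \<Longrightarrow> G i (S t y) = (\<Sum>l<m. G i (S t (S (s l) x)) * G l y)"
    and coordinates: "(\<And>i. i < m \<Longrightarrow> G i y = 0) \<Longrightarrow> i < 3 \<Longrightarrow> y i = 0"
begin

definition v :: "nat \<Rightarrow> nat \<Rightarrow> 'k" where
  "v i = S (s i) x"

definition P :: "(nat \<Rightarrow> 'k) \<Rightarrow> real" where
  "P y = (\<Sum>i<m. norm (G i y))"

text \<open>The entry sum of the matrix of \<open>S t\<close> in the basis \<open>v\<close>; it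
  bounds the operator norm for \<open>P\<close>, see \<open>P_S_le\<close>.\<close>

definition gain :: "real \<Rightarrow> real" where
  "gain t = (\<Sum>j<m. \<Sum>l<m. norm (G j (S t (v l))))"

lemma P_nonneg: "0 \<le> P y"
  unfolding P_def by (intro sum_nonneg) simp

lemma norm_G_le: "i < m \<Longrightarrow> norm (G i y) \<le> P y"
  unfolding P_def by (rule member_le_sum) auto

lemma P_add: "P (y + z) \<le> P y + P z"
  unfolding P_def sum.distrib[symmetric]
  by (intro sum_mono) (auto simp: omega_functionalD(1)[OF G] norm_triangle_ineq)

lemma P_minus: "P (- y) = P y"
  unfolding P_def by (intro sum.cong) (auto simp: omega_functional_simps(2)[OF G])

lemma P_diff_commute: "P (y - z) = P (z - y)"
  using P_minus[of "y - z"] by (simp only: minus_diff_eq)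

lemma P_le: "P y \<le> P (y - z) + P z"
  using P_add[of "y - z" z] by (simp only: diff_add_cancel)

lemma P_scale: "P (omega_scale c y) = norm c * P y"
  unfolding P_def sum_distrib_left
  by (intro sum.cong) (auto simp: omega_functionalD(2)[OF G] norm_mult)

lemma P_diff_eq: "P (y - z) = (\<Sum>i<m. norm (G i y - G i z))"
  unfolding P_def by (intro sum.cong) (auto simp: omega_functional_simps(3)[OF G])

lemma P_continuous: "continuous_on UNIV (\<lambda>y. P (y - z))"
  unfolding P_diff_eq by (intro continuous_intros omega_functionalD(3)[OF G]) auto

lemma P_pos: "i < 3 \<Longrightarrow> y i \<noteq> 0 \<Longrightarrow> 0 < P y"
proof (rule ccontr)
  assume i: "i < 3" "y i \<noteq> 0" "\<not> 0 < P y"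
  then have "P y = 0" using P_nonneg[of y] by simp
  then have "G j y = 0" if "j < m" for j using norm_G_le[OF that, of y] by simp
  then show False using coordinates i(1,2) by blast
qed

lemma gain_nonneg: "0 \<le> gain t"
  unfolding gain_def by (intro sum_nonneg) simp

lemma P_S_le:
  assumes "0 \<le> t"
  shows "P (S t y) \<le> gain t * P y"
proof -
  have "P (S t y) = (\<Sum>j<m. norm (\<Sum>l<m. G j (S t (v l)) * G l y))"
    unfolding P_def v_def by (intro sum.cong) (auto simp: expand[OF _ assms, symmetric])
  also have "\<dots> \<le> (\<Sum>j<m. \<Sum>l<m. norm (G j (S t (v l))) * P y)"
    by (intro sum_mono order_trans[OF norm_sum]) (auto simp: norm_mult intro!: mult_left_mono norm_G_le)
  also have "\<dots> = gain t * P y" by (simp add: gain_def sum_distrib_right)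
  finally show ?thesis .
qed

lemma gain_continuous: "continuous_on {0..} gain"
  unfolding gain_def[abs_def]
  by (intro continuous_intros functional_orbit_continuous G) auto

lemma orbit_approximates:
  assumes "0 < e"
  shows "\<exists>z t. 0 \<le> t \<and> P (omega_scale z (S t x) - w) < e"
proof -
  have "open {y. P (y - w) < e}" by (intro open_Collect_less P_continuous continuous_on_const)
  moreover have "w \<in> {y. P (y - w) < e}" using assms omega_functional_simps(1)[OF G] by (simp add: P_def)
  ultimately have "{y. P (y - w) < e} \<inter> {omega_scale z (S t x) | z t. t \<in> {0..}} \<noteq> {}"
    using dense open_Int_closure_eq_empty[of "{y. P (y - w) < e}" "{omega_scale z (S t x) | z t. t \<in> {0..}}"] by blast
  then show ?thesis by auto
qed

text \<open>Continuity in time pushes \<open>t\<close> off 0. In \<open>contradiction\<close> the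
  return time has to exceed an error 1 / (n + 1), so it must be positive.\<close>

lemma orbit_approximates_positive_time:
  assumes "0 < e"
  shows "\<exists>z t. 0 < t \<and> P (omega_scale z (S t x) - w) < e"
proof -
  obtain z t where zt: "0 \<le> t" "P (omega_scale z (S t x) - w) < e" using orbit_approximates[OF assms] by blast
  define h where "h r = P (omega_scale z (S r x) - w)" for r
  have h_eq: "h = (\<lambda>r. \<Sum>i<m. norm (z * G i (S r x) - G i w))"
    unfolding h_def[abs_def] P_diff_eq by (intro ext sum.cong) (auto simp: omega_functionalD(2)[OF G])
  have "continuous_on {0..} h"
    unfolding h_eq by (intro continuous_intros functional_orbit_continuous G) auto
  then have "(h \<longlongrightarrow> h t) (at t within {0..})" using zt(1) unfolding continuous_on_def by simp
  moreover have "h t < e" using zt(2) by (simp add: h_def)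
  ultimately have "\<forall>\<^sub>F r in at t within {0..}. h r < e" by (rule order_tendstoD(2))
  then obtain d where d: "0 < d" "\<And>r. r \<in> {0..} \<Longrightarrow> r \<noteq> t \<Longrightarrow> dist r t < d \<Longrightarrow> h r < e"
    unfolding eventually_at by blast
  have "h (t + d / 2) < e" using d(1) zt(1) by (intro d(2)) (auto simp: dist_real_def)
  then show ?thesis using d(1) zt(1) unfolding h_def by (intro exI[of _ z] exI[of _ "t + d / 2"]) auto
qed

text \<open>The finite-dimensional quotient \<open>\<omega> / ker P\<close> is a commutative algebra with unit \<open>x\<close>:
  \<open>star\<close> is the multiplication for which \<open>S t\<close> is multiplication by \<open>S t x\<close>.\<close>

definition star :: "(nat \<Rightarrow> 'k) \<Rightarrow> (nat \<Rightarrow> 'k) \<Rightarrow> nat \<Rightarrow> 'k" where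
  "star u w j = (\<Sum>i<m. G i u * G j (S (s i) w))"

lemma star_add_left: "star (u + u') w j = star u w j + star u' w j"
  unfolding star_def by (simp add: omega_functionalD(1)[OF G] distrib_right sum.distrib)

lemma star_add_right: "j < m \<Longrightarrow> star u (w + w') j = star u w j + star u w' j"
  unfolding star_def
  by (simp add: S_add s_nonneg omega_functionalD(1)[OF G] distrib_left sum.distrib)

lemma star_scale_right: "j < m \<Longrightarrow> star u (omega_scale c w) j = c * star u w j"
  unfolding star_def
  by (simp add: S_scale s_nonneg omega_functionalD(2)[OF G] sum_distrib_left mult.left_commute)

lemma star_unit_right: "j < m \<Longrightarrow> star u x j = G j u"
proof -
  assume j: "j < m"
  have "star u x j = (\<Sum>i<m. if i = j then G i u else 0)"
    unfolding star_def by (rule sum.cong) (use dual j in auto)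
  then show ?thesis using j by simp
qed

lemma star_orbit: "j < m \<Longrightarrow> 0 \<le> t \<Longrightarrow> star u (S t x) j = G j (S t u)"
proof -
  assume j: "j < m" and t: "0 \<le> t"
  have "S (s i) (S t x) = S t (S (s i) x)" if "i < m" for i
    using S_plus[of t "s i" x] S_plus[of "s i" t x] s_nonneg[OF that] t by (simp add: add.commute)
  then show ?thesis unfolding star_def by (subst expand[OF j t]) (auto intro!: sum.cong)
qed

lemma star_continuous: "j < m \<Longrightarrow> continuous_on UNIV (\<lambda>w. star u w j)"
  unfolding star_def
  by (intro continuous_intros omega_functionalD(3)[OF functional_S[OF G s_nonneg]]) auto

text \<open>True for scalar multiples of orbit points by \<open>star_orbit\<close>, hence everywhere
  by density and continuity in \<open>w\<close>.\<close>

lemma star_unit_left: "j < m \<Longrightarrow> star x w j = G j w"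
proof -
  assume j: "j < m"
  have "{omega_scale z (S t x) | z t. t \<in> {0..}} \<subseteq> {w. star x w j = G j w}"
    using j by (auto simp: star_scale_right star_orbit omega_functionalD(2)[OF G])
  moreover have "closed {w. star x w j = G j w}"
    by (intro closed_Collect_eq star_continuous omega_functionalD(3)[OF G] j)
  ultimately have "closure {omega_scale z (S t x) | z t. t \<in> {0..}} \<subseteq> {w. star x w j = G j w}" by (rule closure_minimal)
  then show ?thesis unfolding dense by blast
qed

text \<open>The constant of the multiplication \<open>star\<close> with respect to \<open>P\<close>,
  see \<open>star_bound\<close>.\<close>

definition K :: real where
  "K = (\<Sum>i<m. gain (s i))"

lemma K_nonneg: "0 \<le> K"
  unfolding K_def by (intro sum_nonneg gain_nonneg)

lemma star_bound: "(\<Sum>j<m. norm (star u w j)) \<le> K * P u * P w"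
proof -
  have "(\<Sum>j<m. norm (star u w j)) \<le> (\<Sum>j<m. \<Sum>i<m. norm (G i u) * norm (G j (S (s i) w)))"
    unfolding star_def by (intro sum_mono order_trans[OF norm_sum]) (simp add: norm_mult)
  also have "\<dots> = (\<Sum>i<m. norm (G i u) * P (S (s i) w))"
    by (subst sum.swap) (simp add: P_def sum_distrib_left)
  also have "\<dots> \<le> (\<Sum>i<m. P u * (gain (s i) * P w))"
    by (intro sum_mono mult_mono P_S_le s_nonneg norm_G_le P_nonneg) auto
  also have "\<dots> = K * P u * P w" by (simp add: K_def sum_distrib_left sum_distrib_right mult_ac)
  finally show ?thesis .
qed

text \<open>Near the unit, \<open>u = x + h\<close> is inverted up to second order by \<open>x - h\<close>;
  approximating \<open>x - h\<close> by the orbit of \<open>x\<close> brings \<open>u\<close> back near \<open>x\<close>.\<close>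

lemma return:
  assumes \<rho>: "0 < \<rho>" "K * \<rho> \<le> 1 / 2" and u: "P (u - x) \<le> \<rho>"
  shows "\<exists>z t. 0 < t \<and> P (omega_scale z (S t u) - x) < \<rho>"
proof -
  define h where "h = u - x"
  define w where "w = x - h"
  have "u = x + h" by (simp add: h_def)
  \<comment> \<open>In the quotient algebra: (x + h)(x - h) = x - h h.\<close>
  have uw: "star u w j = G j x - star h h j" if "j < m" for j
  proof -
    have "star h x j = star h w j + star h h j"
      unfolding star_add_right[OF that, symmetric] by (simp add: w_def)
    moreover have "G j w = G j x - G j h" by (simp add: w_def omega_functional_simps(3)[OF G[OF that]])
    ultimately show ?thesis
      using star_unit_left[OF that, of w] star_unit_right[OF that, of h]
      by (simp add: \<open>u = x + h\<close> star_add_left)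
  qed
  \<comment> \<open>The approximation error \<open>d\<close> then contributes less than
    \<open>\<rho> / 2\<close>, and the second-order term at most K \<rho>^2, which is at most
    \<open>\<rho> / 2\<close>. The summand 1 guards against a zero denominator.\<close>
  define e where "e = \<rho> / (2 * (K * P u + 1))"
  have Ku: "0 \<le> K * P u" using K_nonneg P_nonneg by simp
  then have "0 < e" using \<rho>(1) by (simp add: e_def)
  have Ke: "K * P u * e < \<rho> / 2"
  proof -
    have "K * P u * e < (K * P u + 1) * e" using \<open>0 < e\<close> by simp
    also have "\<dots> = \<rho> / 2" using Ku by (simp add: e_def field_simps)
    finally show ?thesis .
  qed
  obtain z t where zt: "0 < t" "P (omega_scale z (S t x) - w) < e"
    using orbit_approximates_positive_time[OF \<open>0 < e\<close>] by blast
  define d where "d = omega_scale z (S t x) - w"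
  have "G j (omega_scale z (S t u)) - G j x = star u d j - star h h j" if "j < m" for j
  proof -
    have "G j (omega_scale z (S t u)) = star u (omega_scale z (S t x)) j"
      using that zt(1) by (simp add: star_scale_right star_orbit omega_functionalD(2)[OF G])
    also have "\<dots> = star u d j + star u w j"
      unfolding star_add_right[OF that, symmetric] by (simp add: d_def)
    finally show ?thesis using uw[OF that] by simp
  qed
  then have "P (omega_scale z (S t u) - x) = (\<Sum>j<m. norm (star u d j - star h h j))"
    unfolding P_diff_eq by (intro sum.cong) auto
  also have "\<dots> \<le> (\<Sum>j<m. norm (star u d j) + norm (star h h j))"
    by (intro sum_mono norm_triangle_ineq4)
  also have "\<dots> \<le> K * P u * P d + K * P h * P h"
    unfolding sum.distrib by (intro add_mono star_bound)
  also have "K * P u * P d \<le> K * P u * e" using zt(2) Ku by (intro mult_left_mono) (auto simp: d_def)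
  also have "K * P h * P h \<le> K * \<rho> * \<rho>"
    using u K_nonneg P_nonneg \<rho>(1) by (intro mult_mono) (auto simp: h_def)
  also have "K * \<rho> * \<rho> \<le> 1 / 2 * \<rho>" using \<rho> by (intro mult_right_mono) auto
  finally have "P (omega_scale z (S t u) - x) < \<rho>" using Ke by simp
  then show ?thesis using zt(1) by blast
qed

end

section \<open>The common eigenfunctional and the contradiction with density\<close>

context dual_system
begin

text \<open>\<open>common_eigenvector_exists\<close> is applied to the operators F \<mapsto> F o S t
  on the complex span of the functionals \<iota> o G i, which \<open>expand\<close> shows to be
  invariant.\<close>

lemma eigenfunctional_exists:
  obtains f :: "(nat \<Rightarrow> 'k) \<Rightarrow> complex" and C \<alpha>
  where "\<And>y z. f (y + z) = f y + f z" "\<And>c y. f (omega_scale c y) = \<iota> c * f y"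
    "\<And>y. norm (f y) \<le> C * P y" "\<And>y. continuous_on {0..} (\<lambda>t. f (S t y))" "\<exists>y. f y \<noteq> 0"
    "\<And>t y. 0 \<le> t \<Longrightarrow> f (S t y) = \<alpha> t * f y"
proof -
  have "0 < m" using coordinates[of "\<lambda>_. 1" 0] by (cases "m = 0") auto
  define E where "E i y = \<iota> (G i y)" for i y
  define B where "B = E ` {..<m}"
  define R where "R t F = (\<lambda>y. F (S t y))" for t and F :: "(nat \<Rightarrow> 'k) \<Rightarrow> complex"
  have R_lin: "Vector_Spaces.linear pointwise_scale pointwise_scale (R t)" for t
    by unfold_locales (auto simp: R_def fun_eq_iff algebra_simps)
  have R_B: "R t F \<in> fs.span B" if F: "F \<in> fs.span B" and t: "t \<in> {0..}" for t F
    using F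
  proof (induction rule: fs.span_induct_alt)
    case base
    have eq: "R t 0 = 0" by (simp add: R_def fun_eq_iff)
    show ?case unfolding eq by (rule fs.span_zero)
  next
    case (step c F H)
    obtain i where i: "i < m" "F = E i" using step(1) by (auto simp: B_def)
    have sum_apply: "(\<Sum>l<m. h l) z = (\<Sum>l<m. h l z)" for h :: "nat \<Rightarrow> (nat \<Rightarrow> 'k) \<Rightarrow> complex" and z
      by (induction m) auto
    have "R t F = (\<Sum>l<m. pointwise_scale (\<iota> (G i (S t (v l)))) (E l))"
    proof
      fix y
      have "G i (S t y) = (\<Sum>l<m. G i (S t (v l)) * G l y)"
        unfolding v_def using t by (intro expand i(1)) simp
      then show "R t F y = (\<Sum>l<m. pointwise_scale (\<iota> (G i (S t (v l)))) (E l)) y"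
        by (simp add: i(2) R_def E_def sum_apply \<iota>_sum \<iota>_mult)
    qed
    also have "\<dots> \<in> fs.span B"
      by (intro fs.span_sum fs.span_scale fs.span_base) (auto simp: B_def)
    finally have "R t F \<in> fs.span B" .
    moreover have "R t (pointwise_scale c F + H) = pointwise_scale c (R t F) + R t H"
      by (simp add: R_def fun_eq_iff)
    ultimately show ?case using fs.span_add[OF fs.span_scale step(2)] by (simp only:)
  qed
  have commute: "R r (R t F) = R t (R r F)" if "r \<in> {0..}" "t \<in> {0..}" for r t F
    using S_plus[of r t] S_plus[of t r] that by (auto simp: R_def add.commute)
  have "\<exists>f. f \<in> fs.span B \<and> f \<noteq> 0 \<and> (\<forall>t\<in>{0::real..}. \<exists>c. R t f = pointwise_scale c f)"
  proof (rule common_eigenvector_exists[where w = "E 0"])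
    show "vector_space (pointwise_scale :: complex \<Rightarrow> ((nat \<Rightarrow> 'k) \<Rightarrow> complex) \<Rightarrow> _)"
      by (rule vector_space_pointwise_scale)
    show "finite B" by (simp add: B_def)
    show "E 0 \<in> fs.span B" using \<open>0 < m\<close> by (intro fs.span_base) (auto simp: B_def)
    have "E 0 (v 0) = 1" using dual[of 0 0] \<open>0 < m\<close> by (simp add: E_def v_def \<iota>_1)
    then show "E 0 \<noteq> 0" by auto
  qed (rule R_lin R_B commute; assumption)+
  then obtain f where f: "f \<in> fs.span B" "f \<noteq> 0" "\<forall>t\<in>{0::real..}. \<exists>c. R t f = pointwise_scale c f" by blast
  have props: "(\<forall>y z. F (y + z) = F y + F z) \<and> (\<forall>c y. F (omega_scale c y) = \<iota> c * F y) \<and>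
      (\<exists>C. \<forall>y. norm (F y) \<le> C * P y) \<and> (\<forall>y. continuous_on {0..} (\<lambda>t. F (S t y)))"
    if "F \<in> fs.span B" for F
    using that
  proof (induction rule: fs.span_induct_alt)
    case base
    show ?case by (auto intro!: exI[of _ 0])
  next
    case (step c F H)
    obtain i where i: "i < m" "F = E i" using step(1) by (auto simp: B_def)
    obtain C where C: "\<And>y. norm (H y) \<le> C * P y" using step(2) by blast
    have eq: "pointwise_scale c F + H = (\<lambda>y. c * \<iota> (G i y) + H y)" by (simp add: fun_eq_iff i(2) E_def)
    have "norm (c * \<iota> (G i y) + H y) \<le> (norm c + C) * P y" for y
    proof -
      have "norm (c * \<iota> (G i y) + H y) \<le> norm c * norm (G i y) + norm (H y)"
        by (intro order_trans[OF norm_triangle_ineq]) (simp add: norm_mult norm_\<iota>)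
      also have "\<dots> \<le> norm c * P y + C * P y"
        by (intro add_mono mult_left_mono norm_G_le i C) simp
      finally show ?thesis by (simp add: distrib_right)
    qed
    moreover have "continuous_on {0..} (\<lambda>t. c * \<iota> (G i (S t y)) + H (S t y))" for y
      using step(2) continuous_on_compose2[OF \<iota>_continuous functional_orbit_continuous[OF G[OF i(1)]]]
      by (intro continuous_intros) auto
    moreover have "c * \<iota> (G i (y + z)) + H (y + z) = (c * \<iota> (G i y) + H y) + (c * \<iota> (G i z) + H z)" for y z
    proof -
      have "H (y + z) = H y + H z" using step(2) by blast
      then show ?thesis by (simp only: omega_functionalD(1)[OF G[OF i(1)]] \<iota>_add distrib_left add_ac)
    qed
    moreover have "c * \<iota> (G i (omega_scale b y)) + H (omega_scale b y) = \<iota> b * (c * \<iota> (G i y) + H y)" for b y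
    proof -
      have "H (omega_scale b y) = \<iota> b * H y" using step(2) by blast
      then show ?thesis by (simp only: omega_functionalD(2)[OF G[OF i(1)]] \<iota>_mult distrib_left mult_ac)
    qed
    ultimately show ?case unfolding eq by blast
  qed
  obtain \<alpha> where \<alpha>: "\<And>t. t \<in> {0..} \<Longrightarrow> R t f = pointwise_scale (\<alpha> t) f" using bchoice[OF f(3)] by blast
  have eigen: "f (S t y) = \<alpha> t * f y" if "0 \<le> t" for t y
    using fun_cong[OF \<alpha>[of t], of y] that by (simp add: R_def)
  have nz: "\<exists>y. f y \<noteq> 0" using f(2) by (auto simp: fun_eq_iff)
  obtain C where C: "\<And>y. norm (f y) \<le> C * P y" using props[OF f(1)] by blast
  show thesis
    by (rule that[of f C \<alpha>, OF _ _ C _ nz eigen]) (use props[OF f(1)] in blast)+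
qed

text \<open>Coordinates from \<open>m\<close> on are pinned to 0, so that a bounded closed box in
  \<open>m\<close> dimensions becomes a compact set of sequences, from which subsequences can be
  extracted.\<close>

lemma compact_box: "compact {c :: nat \<Rightarrow> 'k. \<forall>i. c i \<in> (if i < m then cball (G i x) \<rho> else {0})}"
proof -
  have "compactin (product_topology (\<lambda>i. euclidean) UNIV) (PiE UNIV (\<lambda>i. if i < m then cball (G i x) \<rho> else {0}))"
    unfolding compactin_PiE by auto
  moreover have "PiE UNIV (\<lambda>i. if i < m then cball (G i x) \<rho> else {0}) =
      {c. \<forall>i. c i \<in> (if i < m then cball (G i x) \<rho> else {0})}"
    by (auto simp: PiE_def Pi_def)
  ultimately show ?thesis by (simp add: euclidean_product_topology)
qed

text \<open>Let scalar multiples of orbit points at times \<open>t n\<close> approach a vector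
  \<open>y\<close> with f(y) = 0 and P(y) > 0. Let \<open>r n\<close> be nearly the last time up to
  \<open>t n\<close> at which the orbit is, up to a scalar, within \<open>\<rho>\<close> of
  \<open>x\<close>, and let \<open>u n\<close> be that scaled point. A limit of the
  \<open>u n\<close> returns near \<open>x\<close> after a time \<open>\<tau> > 0\<close>, and so do
  the \<open>u n\<close> close to it; hence t n - r n < \<tau>. Over times in [0, \<tau>],
  \<open>P\<close> grows boundedly and \<open>f\<close> shrinks boundedly, while f(u n) stays away
  from 0.\<close>

lemma contradiction: False
proof -
  obtain f C0 \<alpha> where f_add: "\<And>y z. f (y + z) = f y + f z" and f_scale: "\<And>c y. f (omega_scale c y) = \<iota> c * f y"
    and f_bound0: "\<And>y. norm (f y) \<le> C0 * P y" and f_cont: "\<And>y. continuous_on {0..} (\<lambda>t. f (S t y))"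
    and f_nz: "\<exists>y. f y \<noteq> 0" and eigen: "\<And>t y. 0 \<le> t \<Longrightarrow> f (S t y) = \<alpha> t * (f y :: complex)"
    by (rule eigenfunctional_exists) (rule that; assumption)
  define C where "C = \<bar>C0\<bar> + 1"
  have "0 < C" by (simp add: C_def)
  have f_bound: "norm (f y) \<le> C * P y" for y
  proof -
    have "C0 * P y \<le> C * P y" by (intro mult_right_mono P_nonneg) (simp add: C_def)
    then show ?thesis using f_bound0 order_trans by blast
  qed
  have f_diff: "f (y - z) = f y - f z" for y z using f_add[of "y - z" z] by (simp add: algebra_simps)
  have f_near: "norm (f y - f z) \<le> C * P (y - z)" for y z using f_bound[of "y - z"] by (simp add: f_diff)
  have fx: "f x \<noteq> 0"
  proof
    assume "f x = 0"
    obtain y where y: "f y \<noteq> 0" using f_nz by blast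
    have "0 < norm (f y) / C" using y \<open>0 < C\<close> by simp
    then obtain z t where zt: "0 \<le> t" "P (omega_scale z (S t x) - y) < norm (f y) / C" using orbit_approximates by blast
    have "norm (f (omega_scale z (S t x)) - f y) \<le> C * P (omega_scale z (S t x) - y)" by (rule f_near)
    also have "\<dots> < norm (f y)" using zt(2) \<open>0 < C\<close> by (simp add: field_simps)
    finally show False using zt(1) \<open>f x = 0\<close> by (simp add: f_scale eigen)
  qed
  have \<alpha>_eq: "\<alpha> t = f (S t x) / f x" if "0 \<le> t" for t using eigen[OF that, of x] fx by simp
  have \<alpha>_cont: "continuous_on {0..} \<alpha>"
  proof -
    have "continuous_on {0..} (\<lambda>t. f (S t x) / f x)" by (intro continuous_intros f_cont) (use fx in auto)
    then show ?thesis using \<alpha>_eq by (subst continuous_on_cong[OF refl, of _ _ "\<lambda>t. f (S t x) / f x"]) auto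
  qed
  have \<alpha>_0: "\<alpha> 0 = 1" using \<alpha>_eq[of 0] fx by (simp add: S_0)
  have \<alpha>_add: "\<alpha> (r + t) = \<alpha> r * \<alpha> t" if "0 \<le> r" "0 \<le> t" for r t
    using \<alpha>_eq[of "r + t"] S_plus[OF that, of x] eigen that fx by simp
  have \<alpha>_nz: "\<alpha> t \<noteq> 0" if "0 \<le> t" for t
  proof
    assume 0: "\<alpha> t = 0"
    \<comment> \<open>A zero of \<open>\<alpha>\<close> propagates to all halved times, since
      \<alpha>(t) = \<alpha>(t / 2)^2; these tend to 0, where \<open>\<alpha>\<close> is 1.\<close>
    have "\<alpha> (t / 2 ^ n) = 0" for n
    proof (induction n)
      case (Suc n)
      have "\<alpha> (t / 2 ^ Suc n + t / 2 ^ Suc n) = \<alpha> (t / 2 ^ Suc n) * \<alpha> (t / 2 ^ Suc n)"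
        using that by (intro \<alpha>_add) auto
      moreover have "t / 2 ^ Suc n + t / 2 ^ Suc n = t / 2 ^ n" by (simp add: field_simps)
      ultimately show ?case using Suc by simp
    qed (simp add: 0)
    moreover have "(\<lambda>n. t / 2 ^ n) \<longlonglongrightarrow> 0"
      using tendsto_mult_right_zero[OF LIMSEQ_power_zero[of "1 / 2 :: real"], of t] by (simp add: power_divide)
    then have "(\<lambda>n. \<alpha> (t / 2 ^ n)) \<longlonglongrightarrow> \<alpha> 0"
      using that by (intro continuous_on_tendsto_compose[OF \<alpha>_cont]) auto
    ultimately show False using \<alpha>_0 LIMSEQ_const_iff[of "0 :: complex" 1] by simp
  qed
  text \<open>Three complex numbers are linearly dependent over the reals.\<close>
  define e :: "nat \<Rightarrow> nat \<Rightarrow> 'k" where "e i j = of_bool (i = j)" for i j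
  have "\<exists>c :: nat \<Rightarrow> real. (\<exists>i\<le>2. c i \<noteq> 0) \<and> (\<Sum>i\<le>2. c i *\<^sub>R f (e i)) = 0"
  proof -
    have c2: "card {1, \<i>} = 2" by (simp add: complex_eq_iff card_insert_if)
    have "z \<in> span {1, \<i>}" for z :: complex
    proof -
      have "z = Re z *\<^sub>R 1 + Im z *\<^sub>R \<i>" by (simp add: complex_eq_iff)
      also have "\<dots> \<in> span {1, \<i>}" by (intro span_add span_scale span_base) auto
      finally show ?thesis .
    qed
    then show ?thesis using real_vector.linear_relation_exists[of "{1, \<i>}" "\<lambda>i. f (e i)"] by (simp only: c2) auto
  qed
  then obtain c :: "nat \<Rightarrow> real" and i0 where c: "i0 \<le> 2" "c i0 \<noteq> 0" "(\<Sum>i\<le>2. c i *\<^sub>R f (e i)) = 0" by blast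
  define y where "y = (\<Sum>i\<le>2. omega_scale (of_real (c i)) (e i))"
  have f_sum: "f (\<Sum>i\<le>(n::nat). h i) = (\<Sum>i\<le>n. f (h i))" for h n
  proof (induction n)
    case (Suc n)
    then show ?case by (simp only: sum.atMost_Suc f_add)
  qed simp
  have fy: "f y = 0"
    using c(3) unfolding y_def f_sum f_scale \<iota>_of_real by (simp add: scaleR_conv_of_real)
  have "y i0 = of_real (c i0)"
  proof -
    have "(\<Sum>i\<le>(n::nat). h i) j = (\<Sum>i\<le>n. h i j)" for h :: "nat \<Rightarrow> nat \<Rightarrow> 'k" and j n by (induction n) auto
    then have "y i0 = (\<Sum>i\<le>2. if i = i0 then of_real (c i) else 0)"
      unfolding y_def by (auto simp: e_def intro!: sum.cong)
    then show ?thesis using c(1) by simp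
  qed
  then have Py: "0 < P y" using c(1,2) by (intro P_pos[of i0]) auto
  \<comment> \<open>The first bound is the hypothesis of \<open>return\<close>; the second keeps |f|
    at least |f x| / 2 on the ball of radius \<open>\<rho>\<close> about \<open>x\<close>.\<close>
  define \<rho> where "\<rho> = min (1 / (2 * (K + 1))) (norm (f x) / (2 * C))"
  have \<rho>: "0 < \<rho>" using K_nonneg fx \<open>0 < C\<close> by (simp add: \<rho>_def add_nonneg_pos)
  have K\<rho>: "K * \<rho> \<le> 1 / 2"
  proof -
    have "K * \<rho> \<le> K * (1 / (2 * (K + 1)))" by (intro mult_left_mono K_nonneg) (simp add: \<rho>_def)
    also have "\<dots> \<le> 1 / 2" using K_nonneg by (simp add: field_simps)
    finally show ?thesis .
  qed
  have C\<rho>: "C * \<rho> \<le> norm (f x) / 2"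
  proof -
    have "C * \<rho> \<le> C * (norm (f x) / (2 * C))" using \<open>0 < C\<close> by (intro mult_left_mono) (auto simp: \<rho>_def)
    then show ?thesis using \<open>0 < C\<close> by simp
  qed
  have "\<exists>z t. 0 \<le> t \<and> P (omega_scale z (S t x) - y) < 1 / real (Suc n)" for n by (rule orbit_approximates) simp
  then obtain z t where zt: "\<And>n. 0 \<le> t n" "\<And>n. P (omega_scale (z n) (S (t n) x) - y) < 1 / real (Suc n)" by metis
  define A where "A n = {r. 0 \<le> r \<and> r \<le> t n \<and> (\<exists>w. P (omega_scale w (S r x) - x) < \<rho>)}" for n
  \<comment> \<open>\<open>A n\<close> is defined by a strict inequality and need not contain its
    supremum, so the last visit is taken up to an error 1 / (n + 1).\<close>
  have "\<exists>r\<in>A n. \<forall>r'\<in>A n. r' < r + 1 / real (Suc n)" for n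
  proof -
    have "P (omega_scale 1 (S 0 x) - x) < \<rho>"
      using \<rho> omega_functional_simps(1)[OF G] by (simp add: S_0 P_def omega_scale_def)
    then have "0 \<in> A n" using zt(1) unfolding A_def by blast
    have bdd: "bdd_above (A n)" by (intro bdd_aboveI[of _ "t n"]) (auto simp: A_def)
    have "Sup (A n) - 1 / real (Suc n) < Sup (A n)" by simp
    then obtain r where r: "r \<in> A n" "Sup (A n) - 1 / real (Suc n) < r"
      using less_cSupE \<open>0 \<in> A n\<close> by (metis empty_iff)
    have "r' < r + 1 / real (Suc n)" if "r' \<in> A n" for r'
      using cSup_upper[OF that bdd] r(2) by linarith
    then show ?thesis using r(1) by blast
  qed
  then obtain r where r: "\<And>n. r n \<in> A n" "\<And>n r'. r' \<in> A n \<Longrightarrow> r' < r n + 1 / real (Suc n)" by metis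
  have "\<exists>w. P (omega_scale w (S (r n) x) - x) < \<rho>" for n using r(1)[of n] unfolding A_def by blast
  then obtain w where w: "\<And>n. P (omega_scale (w n) (S (r n) x) - x) < \<rho>" by metis
  have r0: "0 \<le> r n" "r n \<le> t n" for n using r(1)[of n] by (auto simp: A_def)
  define u where "u n = omega_scale (w n) (S (r n) x)" for n
  have Pu: "P (u n - x) < \<rho>" for n unfolding u_def by (rule w)
  define b where "b n = (\<lambda>i. if i < m then G i (u n) else 0)" for n
  have "b n i \<in> (if i < m then cball (G i x) \<rho> else {0})" for n i
  proof (cases "i < m")
    case True
    have "norm (G i (u n - x)) \<le> P (u n - x)" by (rule norm_G_le[OF True])
    then show ?thesis using True Pu[of n]
      by (simp add: b_def dist_norm omega_functional_simps(3)[OF G[OF True]] norm_minus_commute)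
  qed (simp add: b_def)
  then have "\<forall>n. b n \<in> {c. \<forall>i. c i \<in> (if i < m then cball (G i x) \<rho> else {0})}" by blast
  from seq_compactE[OF compact_imp_seq_compact[OF compact_box] this]
  obtain l \<sigma> where \<sigma>: "strict_mono \<sigma>" and lim: "(b \<circ> \<sigma>) \<longlonglongrightarrow> l" by blast
  \<comment> \<open>Only the classes of the \<open>u n\<close> modulo the kernel of \<open>P\<close>
    converge along the subsequence; \<open>u'\<close> is a representative of the limit.\<close>
  define u' where "u' = (\<Sum>i<m. omega_scale (l i) (v i))"
  have Gu': "G j u' = l j" if "j < m" for j
  proof -
    have "G j u' = (\<Sum>i<m. l i * G j (v i))"
      unfolding u'_def by (simp add: omega_functional_simps(4)[OF G[OF that]] omega_functionalD(2)[OF G[OF that]])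
    also have "\<dots> = (\<Sum>i<m. if i = j then l i else 0)"
      by (rule sum.cong) (use dual that in \<open>auto simp: v_def\<close>)
    finally show ?thesis using that by simp
  qed
  have lim_G: "(\<lambda>n. G i (u (\<sigma> n))) \<longlonglongrightarrow> l i" if "i < m" for i
    using tendsto_coordinate[OF lim, of i] that by (simp add: b_def)
  have d_lim: "(\<lambda>n. P (u (\<sigma> n) - u')) \<longlonglongrightarrow> 0"
  proof -
    have "(\<lambda>n. \<Sum>i<m. norm (G i (u (\<sigma> n)) - G i u')) \<longlonglongrightarrow> (\<Sum>i<m. norm (l i - G i u'))"
      by (intro tendsto_intros lim_G) simp
    then show ?thesis by (simp add: P_diff_eq Gu')
  qed
  have "P (u' - x) \<le> \<rho>"
  proof -
    have "P (u' - x) \<le> P (u (\<sigma> n) - u') + \<rho>" for n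
      using P_add[of "u' - u (\<sigma> n)" "u (\<sigma> n) - x"] Pu[of "\<sigma> n"] P_diff_commute[of u' "u (\<sigma> n)"] by simp
    moreover have "(\<lambda>n. P (u (\<sigma> n) - u') + \<rho>) \<longlonglongrightarrow> 0 + \<rho>" by (intro tendsto_intros d_lim)
    ultimately show ?thesis using LIMSEQ_le_const[of "\<lambda>n. P (u (\<sigma> n) - u') + \<rho>" "0 + \<rho>" "P (u' - x)"] by simp
  qed
  then obtain Z \<tau> where \<tau>: "0 < \<tau>" and Z: "P (omega_scale Z (S \<tau> u') - x) < \<rho>"
    using return[OF \<rho> K\<rho>] by blast
  \<comment> \<open>The ball about \<open>x\<close> is open and \<open>S \<tau>\<close> is bounded
    for \<open>P\<close>, so the scalar and the time that bring \<open>u'\<close> back also work for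
    nearby \<open>u (\<sigma> n)\<close>.\<close>
  have ev1: "\<forall>\<^sub>F n in sequentially. P (omega_scale Z (S \<tau> (u (\<sigma> n))) - x) < \<rho>"
  proof -
    have "(\<lambda>n. norm Z * (gain \<tau> * P (u (\<sigma> n) - u')) + P (omega_scale Z (S \<tau> u') - x)) \<longlonglongrightarrow>
        norm Z * (gain \<tau> * 0) + P (omega_scale Z (S \<tau> u') - x)" by (intro tendsto_intros d_lim)
    then have "\<forall>\<^sub>F n in sequentially. norm Z * (gain \<tau> * P (u (\<sigma> n) - u')) + P (omega_scale Z (S \<tau> u') - x) < \<rho>"
      using Z by (intro order_tendstoD(2)) auto
    then show ?thesis
    proof eventually_elim
      case (elim n)
      have "S \<tau> (u (\<sigma> n)) = S \<tau> (u (\<sigma> n) - u') + S \<tau> u'" using \<tau> by (simp flip: S_add)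
      then have "omega_scale Z (S \<tau> (u (\<sigma> n))) - x =
          omega_scale Z (S \<tau> (u (\<sigma> n) - u')) + (omega_scale Z (S \<tau> u') - x)"
        by (simp add: fun_eq_iff omega_scale_def algebra_simps)
      then have "P (omega_scale Z (S \<tau> (u (\<sigma> n))) - x) \<le>
          P (omega_scale Z (S \<tau> (u (\<sigma> n) - u'))) + P (omega_scale Z (S \<tau> u') - x)"
        using P_add by (simp only:)
      also have "P (omega_scale Z (S \<tau> (u (\<sigma> n) - u'))) \<le> norm Z * (gain \<tau> * P (u (\<sigma> n) - u'))"
        unfolding P_scale using \<tau> by (intro mult_left_mono P_S_le) auto
      finally show ?case using elim by linarith
    qed
  qed
  \<comment> \<open>Otherwise \<open>r (\<sigma> n) + \<tau>\<close> would be another visit up to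
    time \<open>t (\<sigma> n)\<close>, later than \<open>r (\<sigma> n)\<close> by more than the
    permitted error.\<close>
  have short: "t (\<sigma> n) - r (\<sigma> n) < \<tau>"
    if "P (omega_scale Z (S \<tau> (u (\<sigma> n))) - x) < \<rho>" "1 / real (Suc (\<sigma> n)) < \<tau>" for n
  proof (rule ccontr)
    assume long: "\<not> ?thesis"
    have "omega_scale Z (S \<tau> (u (\<sigma> n))) = omega_scale (Z * w (\<sigma> n)) (S (r (\<sigma> n) + \<tau>) x)"
      using \<tau> r0 by (simp add: u_def S_scale S_plus fun_eq_iff)
    then have "r (\<sigma> n) + \<tau> \<in> A (\<sigma> n)"
      using that(1) long r0[of "\<sigma> n"] \<tau> unfolding A_def by auto
    then show False using r(2)[of "r (\<sigma> n) + \<tau>" "\<sigma> n"] that(2) by simp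
  qed
  have "continuous_on {0..\<tau>} (\<lambda>\<delta>. norm (\<alpha> \<delta>))"
    by (intro continuous_on_norm continuous_on_subset[OF \<alpha>_cont]) auto
  then have "\<exists>\<delta>0\<in>{0..\<tau>}. \<forall>\<delta>\<in>{0..\<tau>}. norm (\<alpha> \<delta>0) \<le> norm (\<alpha> \<delta>)"
    using \<tau> by (intro continuous_attains_inf) auto
  then obtain \<delta>0 where \<delta>0: "\<delta>0 \<in> {0..\<tau>}" "\<And>\<delta>. \<delta> \<in> {0..\<tau>} \<Longrightarrow> norm (\<alpha> \<delta>0) \<le> norm (\<alpha> \<delta>)" by blast
  define a where "a = norm (\<alpha> \<delta>0)"
  have "0 < a" using \<alpha>_nz \<delta>0(1) by (simp add: a_def)
  have "continuous_on {0..\<tau>} gain" by (rule continuous_on_subset[OF gain_continuous]) auto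
  then have "\<exists>\<delta>1\<in>{0..\<tau>}. \<forall>\<delta>\<in>{0..\<tau>}. gain \<delta> \<le> gain \<delta>1"
    using \<tau> by (intro continuous_attains_sup) auto
  then obtain \<delta>1 where \<delta>1: "\<And>\<delta>. \<delta> \<in> {0..\<tau>} \<Longrightarrow> gain \<delta> \<le> gain \<delta>1" by blast
  define K' where "K' = gain \<delta>1 + 1"
  have "0 < K'" using gain_nonneg[of \<delta>1] by (simp add: K'_def)
  define Q where "Q = P x + \<rho>"
  have "0 < Q" using P_nonneg[of x] \<rho> by (simp add: Q_def)
  \<comment> \<open>For times \<delta> in [0, \<tau>], \<open>a * (norm (f x) / 2)\<close> bounds
    |f| from below and \<open>K' * Q\<close> bounds \<open>P\<close> from above at the point
    \<open>S \<delta> (u N)\<close>.\<close>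
  define \<kappa> where "\<kappa> = a * (norm (f x) / 2) / (K' * Q)"
  have "0 < \<kappa>" using \<open>0 < a\<close> fx \<open>0 < K'\<close> \<open>0 < Q\<close> by (simp add: \<kappa>_def)
  have lower: "\<kappa> * P (omega_scale (z N) (S (t N) x)) \<le> norm (f (omega_scale (z N) (S (t N) x)))"
    if "t N - r N < \<tau>" for N
  proof -
    define \<delta> where "\<delta> = t N - r N"
    have \<delta>: "\<delta> \<in> {0..\<tau>}" using that r0[of N] by (simp add: \<delta>_def)
    define Y where "Y = omega_scale (z N) (S (t N) x)"
    have "S (t N) x = S \<delta> (S (r N) x)" using S_plus[of "r N" \<delta> x] r0[of N] by (simp add: \<delta>_def)
    \<comment> \<open>\<open>z N\<close> could be 0, so the inequality is multiplied by
      \<open>norm (z N)\<close> instead of solving for \<open>Y\<close>; only \<open>w N\<close> is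
      divided out, and it is non-zero because f(u N) is.\<close>
    then have wY: "omega_scale (w N) Y = omega_scale (z N) (S \<delta> (u N))"
      using \<delta> by (simp add: Y_def u_def S_scale fun_eq_iff)
    have fu: "norm (f x) / 2 \<le> norm (f (u N))"
    proof -
      have "norm (f x - f (u N)) \<le> C * P (u N - x)" using f_near[of x "u N"] by (simp only: P_diff_commute)
      also have "\<dots> \<le> C * \<rho>" using Pu[of N] \<open>0 < C\<close> by simp
      finally show ?thesis using C\<rho> norm_triangle_ineq2[of "f x" "f (u N)"] by linarith
    qed
    have Pu': "P (u N) \<le> Q" using P_le[of "u N" x] Pu[of N] by (simp add: Q_def)
    have "P (S \<delta> (u N)) \<le> K' * Q"
    proof -
      have "P (S \<delta> (u N)) \<le> gain \<delta> * P (u N)" using \<delta> by (intro P_S_le) simp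
      also have "\<dots> \<le> K' * Q"
        using \<delta>1[OF \<delta>] Pu' \<open>0 < K'\<close> by (intro mult_mono P_nonneg) (auto simp: K'_def)
      finally show ?thesis .
    qed
    then have "\<kappa> * P (S \<delta> (u N)) \<le> \<kappa> * (K' * Q)" using \<open>0 < \<kappa>\<close> by (intro mult_left_mono) auto
    also have "\<dots> = a * (norm (f x) / 2)" using \<open>0 < K'\<close> \<open>0 < Q\<close> by (simp add: \<kappa>_def)
    also have "\<dots> \<le> norm (\<alpha> \<delta>) * norm (f (u N))"
      using \<delta>0(2)[OF \<delta>] fu by (intro mult_mono) (auto simp: a_def)
    also have "\<dots> = norm (f (S \<delta> (u N)))" using \<delta> by (simp add: eigen norm_mult)
    finally have "norm (z N) * (\<kappa> * P (S \<delta> (u N))) \<le> norm (z N) * norm (f (S \<delta> (u N)))"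
      by (intro mult_left_mono) auto
    then have "\<kappa> * P (omega_scale (w N) Y) \<le> norm (f (omega_scale (w N) Y))"
      unfolding wY by (simp add: P_scale f_scale norm_mult norm_\<iota> mult.left_commute)
    then have "norm (w N) * (\<kappa> * P Y) \<le> norm (w N) * norm (f Y)"
      by (simp add: P_scale f_scale norm_mult norm_\<iota> mult.left_commute)
    moreover have "w N \<noteq> 0"
    proof
      assume "w N = 0"
      then have "f (u N) = 0" by (simp add: u_def f_scale \<iota>_0)
      then show False using fu fx by simp
    qed
    ultimately show ?thesis by (simp add: Y_def)
  qed
  have small: "\<forall>\<^sub>F n in sequentially. K0 / real (Suc (\<sigma> n)) < e0" if "0 < e0" for K0 e0 :: real
  proof -
    have "(\<lambda>n. K0 * inverse (real (Suc n))) \<longlonglongrightarrow> K0 * 0"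
      by (intro tendsto_mult tendsto_const LIMSEQ_inverse_real_of_nat)
    then have "(\<lambda>n. K0 * inverse (real (Suc (\<sigma> n)))) \<longlonglongrightarrow> 0"
      using LIMSEQ_subseq_LIMSEQ[OF _ \<sigma>] by (fastforce simp: o_def)
    then show ?thesis using order_tendstoD(2)[OF _ that] by (simp add: divide_inverse)
  qed
  have "\<forall>\<^sub>F n in sequentially. P (omega_scale Z (S \<tau> (u (\<sigma> n))) - x) < \<rho> \<and>
      1 / real (Suc (\<sigma> n)) < \<tau> \<and> (\<kappa> + C) / real (Suc (\<sigma> n)) < \<kappa> * P y"
    using \<open>0 < \<kappa>\<close> Py by (intro eventually_conj ev1 small \<tau>) simp
  then obtain n where n: "P (omega_scale Z (S \<tau> (u (\<sigma> n))) - x) < \<rho>" "1 / real (Suc (\<sigma> n)) < \<tau>"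
      "(\<kappa> + C) / real (Suc (\<sigma> n)) < \<kappa> * P y"
    using eventually_happens'[OF sequentially_bot] by blast
  define N where "N = \<sigma> n"
  define Y where "Y = omega_scale (z N) (S (t N) x)"
  have YN: "P (Y - y) < 1 / real (Suc N)" unfolding Y_def by (rule zt(2))
  \<comment> \<open>As f(y) = 0, both P(y) - P(Y) and |f(Y)| are at most multiples of P(Y - y). So
    \<open>\<kappa> * P y\<close> would be arbitrarily small, against P(y) > 0.\<close>
  have "P y \<le> P (Y - y) + P Y" using P_le[of y Y] by (simp only: P_diff_commute)
  then have "\<kappa> * P y \<le> \<kappa> * P (Y - y) + \<kappa> * P Y"
    using \<open>0 < \<kappa>\<close> by (simp flip: distrib_left)
  also have "\<kappa> * P Y \<le> norm (f Y)" unfolding Y_def using short[OF n(1,2)] by (intro lower) (simp add: N_def)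
  also have "norm (f Y) \<le> C * P (Y - y)" using f_near[of Y y] fy by simp
  also have "\<kappa> * P (Y - y) + C * P (Y - y) \<le> (\<kappa> + C) * (1 / real (Suc N))"
    unfolding distrib_right[symmetric]
    using YN \<open>0 < \<kappa>\<close> \<open>0 < C\<close> by (intro mult_left_mono less_imp_le[OF YN]) simp
  finally show False using n(3) by (simp add: N_def)
qed

end

section \<open>The equivalence\<close>

lemma no_supercyclic_semigroup_omega:
  fixes \<iota> :: "'k::{real_normed_field,heine_borel} \<Rightarrow> complex"
  assumes "scalar_embedding \<iota>"
  shows "\<not> has_supercyclic_semigroup (omega_scale :: 'k \<Rightarrow> (nat \<Rightarrow> 'k) \<Rightarrow> nat \<Rightarrow> 'k)"
proof
  let ?mul = "omega_scale :: 'k \<Rightarrow> (nat \<Rightarrow> 'k) \<Rightarrow> nat \<Rightarrow> 'k"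
  interpret scalar_embedding \<iota> by fact
  assume "has_supercyclic_semigroup ?mul"
  then obtain S where S: "operator_semigroup ?mul (top_of_set {0::real..}) S"
    "strongly_continuous (top_of_set {0..}) S" "supercyclic_family ?mul (top_of_set {0..}) S"
    unfolding has_supercyclic_semigroup_def by blast
  have lin: "\<And>t. 0 \<le> t \<Longrightarrow> Vector_Spaces.linear ?mul ?mul (S t)"
    and cont: "\<And>t. 0 \<le> t \<Longrightarrow> continuous_on UNIV (S t)"
    and S_plus: "\<And>s t. 0 \<le> s \<Longrightarrow> 0 \<le> t \<Longrightarrow> S (s + t) = S t \<circ> S s"
    using S(1) by (auto simp: operator_semigroup_def)
  have S_0: "S 0 = id" using S(1) by (auto simp: operator_semigroup_def)
  interpret omega_semigroup S
  proof
    show "S t (x + y) = S t x + S t y" "S t (omega_scale c x) = omega_scale c (S t x)"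
      if "0 \<le> t" for t x y c
      using lin[OF that] unfolding Vector_Spaces.linear_iff by blast+
    show "continuous_on {0..} (\<lambda>t. S t x)" for x
      using S(2) by (auto simp: strongly_continuous_def)
  qed (simp_all add: cont S_0 S_plus)
  obtain x where "closure {omega_scale z (S t x) | z t. t \<in> {0..}} = UNIV"
    using S(3) unfolding supercyclic_family_def topspace_euclidean_subtopology by blast
  then interpret omega_supercyclic S x by unfold_locales
  obtain m G s where "dual_system S x \<iota> m G s"
  proof -
    obtain m :: nat and G s where *: "\<forall>i<m. omega_functional (G i) \<and> 0 \<le> s i"
      "\<forall>i<m. \<forall>j<m. G i (S (s j) x) = of_bool (i = j)"
      "\<forall>i<m. \<forall>t\<ge>0. \<forall>y. G i (S t y) = (\<Sum>l<m. G i (S t (S (s l) x)) * G l y)"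
      "\<forall>y. (\<forall>i<m. G i y = 0) \<longrightarrow> (\<forall>i<3. y i = 0)"
      using dual_system_exists[of 3] by (elim exE conjE) (rule that)
    have "dual_system S x \<iota> m G s"
    proof
      show "omega_functional (G i)" "0 \<le> s i" if "i < m" for i using *(1) that by blast+
      show "G i (S (s j) x) = of_bool (i = j)" if "i < m" "j < m" for i j using *(2) that by blast
      show "G i (S t y) = (\<Sum>l<m. G i (S t (S (s l) x)) * G l y)" if "i < m" "0 \<le> t" for i t y
        using *(3) that by blast
      show "y i = 0" if "\<And>i. i < m \<Longrightarrow> G i y = 0" "i < 3" for y i using *(4) that by blast
    qed
    then show ?thesis by (rule that)
  qed
  then show False by (rule dual_system.contradiction)
qed

text \<open>The semigroup is conjugated by the isomorphism \<open>f\<close>; a continuous surjection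
  maps dense sets to dense sets, so \<open>f x\<close> is supercyclic if \<open>x\<close>
  is.\<close>

lemma has_supercyclic_semigroup_isomorphic:
  fixes mul1 :: "'k::field \<Rightarrow> 'a::{ab_group_add,topological_space} \<Rightarrow> 'a"
    and mul2 :: "'k \<Rightarrow> 'b::{ab_group_add,topological_space} \<Rightarrow> 'b"
  assumes "has_supercyclic_semigroup mul1" "isomorphic_tvs mul1 mul2"
  shows "has_supercyclic_semigroup mul2"
proof -
  obtain f where f: "Vector_Spaces.linear mul1 mul2 f" "homeomorphic_map euclidean euclidean f"
    using assms(2) unfolding isomorphic_tvs_def by blast
  then obtain g where g: "homeomorphic_maps euclidean euclidean f g"
    using homeomorphic_map_maps by blast
  have f_cont: "continuous_on UNIV f" and g_cont: "continuous_on UNIV g"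
    and gf: "\<And>x. g (f x) = x" and fg: "\<And>y. f (g y) = y"
    using g by (auto simp: homeomorphic_maps_def)
  interpret f: Vector_Spaces.linear mul1 mul2 f by (rule f(1))
  have g_lin: "Vector_Spaces.linear mul2 mul1 g"
  proof
    show "g (x + y) = g x + g y" for x y by (metis f.add fg gf)
    show "g (mul2 c x) = mul1 c (g x)" for c x by (metis f.scale fg gf)
  qed
  obtain T where T: "operator_semigroup mul1 (top_of_set {0::real..}) T"
    "strongly_continuous (top_of_set {0..}) T" "supercyclic_family mul1 (top_of_set {0..}) T"
    using assms(1) unfolding has_supercyclic_semigroup_def by blast
  define S where "S t = f \<circ> T t \<circ> g" for t
  have "operator_semigroup mul2 (top_of_set {0..}) S"
    unfolding operator_semigroup_def
  proof (intro conjI ballI)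
    fix t :: real assume t: "t \<in> topspace (top_of_set {0..})"
    then have Tt: "Vector_Spaces.linear mul1 mul1 (T t)" "continuous_on UNIV (T t)"
      using T(1) by (auto simp: operator_semigroup_def)
    show "Vector_Spaces.linear mul2 mul2 (S t)"
      unfolding S_def comp_assoc
      by (intro Vector_Spaces.linear_compose[OF _ f(1)] Vector_Spaces.linear_compose[OF g_lin Tt(1)])
    show "continuous_on UNIV (S t)"
      unfolding S_def
      by (intro continuous_on_compose g_cont continuous_on_subset[OF Tt(2)] continuous_on_subset[OF f_cont]) auto
  next
    show "S 0 = id" using T(1) by (auto simp: operator_semigroup_def S_def fg)
  next
    fix s t :: real
    assume "s \<in> topspace (top_of_set {0..})" "t \<in> topspace (top_of_set {0..})"
    then have "T (s + t) = T t \<circ> T s" using T(1) by (auto simp: operator_semigroup_def)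
    then show "S (s + t) = S t \<circ> S s" by (simp add: S_def fun_eq_iff gf)
  qed
  moreover have "strongly_continuous (top_of_set {0..}) S"
    unfolding strongly_continuous_def
  proof
    fix x
    have "continuous_on {0..} (\<lambda>t. T t (g x))" using T(2) by (auto simp: strongly_continuous_def)
    then have "continuous_on {0..} (\<lambda>t. f (T t (g x)))" by (rule continuous_on_compose2[OF f_cont]) auto
    then show "continuous_map (top_of_set {0..}) euclidean (\<lambda>t. S t x)" by (simp add: S_def)
  qed
  moreover have "supercyclic_family mul2 (top_of_set {0..}) S"
  proof -
    obtain x where x: "closure {mul1 z (T t x) | z t. t \<in> {0..}} = UNIV"
      using T(3) unfolding supercyclic_family_def topspace_euclidean_subtopology by blast
    have img: "f ` {mul1 z (T t x) | z t. t \<in> {0..}} = {mul2 z (S t (f x)) | z t. t \<in> {0..}}"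
      by (force simp: S_def gf f.scale image_def)
    have "f ` closure {mul1 z (T t x) | z t. t \<in> {0..}} \<subseteq> closure (f ` {mul1 z (T t x) | z t. t \<in> {0..}})"
      by (rule continuous_image_closure_subset[OF f_cont]) simp
    then have "range f \<subseteq> closure {mul2 z (S t (f x)) | z t. t \<in> {0..}}" unfolding x img .
    moreover have "range f = UNIV" using fg by (metis surjI)
    ultimately show ?thesis unfolding supercyclic_family_def topspace_euclidean_subtopology by blast
  qed
  ultimately show ?thesis unfolding has_supercyclic_semigroup_def by blast
qed

lemma mixing_supercyclic_omega_equivalence:
  fixes mul :: "'k::{real_normed_field,heine_borel} \<Rightarrow> 'a::{topological_ab_group_add,t2_space} \<Rightarrow> 'a"
    and \<iota> :: "'k \<Rightarrow> complex"
  assumes embedding: "scalar_embedding \<iota>"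
    and functional: "\<And>p x. vector_space mul \<Longrightarrow> seminorm_for mul p \<Longrightarrow> p x \<noteq> 0 \<Longrightarrow>
      \<exists>f C. Vector_Spaces.linear mul (*) f \<and> (\<forall>y. norm (f y) \<le> C * p y) \<and> f x \<noteq> 0"
    and X: "frechet_space mul" "separable_space (euclidean :: 'a topology)" "infinite_dimensional mul"
  shows "(has_mixing_groups mul \<longleftrightarrow> has_supercyclic_semigroup mul) \<and>
    (has_supercyclic_semigroup mul \<longleftrightarrow>
      \<not> isomorphic_tvs mul (omega_scale :: 'k \<Rightarrow> (nat \<Rightarrow> 'k) \<Rightarrow> nat \<Rightarrow> 'k))"
proof -
  interpret frechet_space mul by fact
  have "\<exists>q. graded_frechet mul q"
    by (rule graded_frechet_exists) (rule functional[OF vector_space_axioms])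
  then obtain q where "graded_frechet mul q" ..
  then interpret graded_frechet mul q .
  let ?iso = "isomorphic_tvs mul (omega_scale :: 'k \<Rightarrow> (nat \<Rightarrow> 'k) \<Rightarrow> nat \<Rightarrow> 'k)"
  have 1: "\<not> ?iso \<Longrightarrow> has_mixing_groups mul" by (rule mixing_groups_exist[OF X(2,3)])
  have 2: "has_mixing_groups mul \<Longrightarrow> has_supercyclic_semigroup mul" by (rule supercyclic_of_mixing[OF X(2)])
  have 3: "\<not> ?iso" if "has_supercyclic_semigroup mul"
    using has_supercyclic_semigroup_isomorphic[OF that] no_supercyclic_semigroup_omega[OF embedding] by (rule contrapos_nn[rotated])
  from 1 2 3 show ?thesis by iprover
qed

theorem corollary1p7:
  fixes mul\<^sub>R :: "real \<Rightarrow> 'a::{topological_ab_group_add,t2_space} \<Rightarrow> 'a"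
    and mul\<^sub>C :: "complex \<Rightarrow> 'b::{topological_ab_group_add,t2_space} \<Rightarrow> 'b"
  shows
    "(frechet_space mul\<^sub>R \<and> separable_space (euclidean :: 'a topology) \<and>
      infinite_dimensional mul\<^sub>R \<longrightarrow>
        (has_mixing_groups mul\<^sub>R \<longleftrightarrow> has_supercyclic_semigroup mul\<^sub>R) \<and>
        (has_supercyclic_semigroup mul\<^sub>R \<longleftrightarrow>
           \<not> isomorphic_tvs mul\<^sub>R (omega_scale :: real \<Rightarrow> (nat \<Rightarrow> real) \<Rightarrow> nat \<Rightarrow> real))) \<and>
     (frechet_space mul\<^sub>C \<and> separable_space (euclidean :: 'b topology) \<and>
      infinite_dimensional mul\<^sub>C \<longrightarrow>
        (has_mixing_groups mul\<^sub>C \<longleftrightarrow> has_supercyclic_semigroup mul\<^sub>C) \<and>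
        (has_supercyclic_semigroup mul\<^sub>C \<longleftrightarrow>
           \<not> isomorphic_tvs mul\<^sub>C
               (omega_scale :: complex \<Rightarrow> (nat \<Rightarrow> complex) \<Rightarrow> nat \<Rightarrow> complex)))"
proof -
  have R: "scalar_embedding complex_of_real" and C: "scalar_embedding (\<lambda>x :: complex. x)"
    by unfold_locales simp_all
  show ?thesis
  proof (intro conjI impI)
    assume X: "frechet_space mul\<^sub>R \<and> separable_space (euclidean :: 'a topology) \<and> infinite_dimensional mul\<^sub>R"
    note equiv = mixing_supercyclic_omega_equivalence[OF R seminorm_functional_real
        X[THEN conjunct1] X[THEN conjunct2, THEN conjunct1] X[THEN conjunct2, THEN conjunct2]]
    show "has_mixing_groups mul\<^sub>R \<longleftrightarrow> has_supercyclic_semigroup mul\<^sub>R"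
      by (rule equiv[THEN conjunct1])
    show "has_supercyclic_semigroup mul\<^sub>R \<longleftrightarrow>
        \<not> isomorphic_tvs mul\<^sub>R (omega_scale :: real \<Rightarrow> (nat \<Rightarrow> real) \<Rightarrow> nat \<Rightarrow> real)"
      by (rule equiv[THEN conjunct2])
  next
    assume X: "frechet_space mul\<^sub>C \<and> separable_space (euclidean :: 'b topology) \<and> infinite_dimensional mul\<^sub>C"
    note equiv = mixing_supercyclic_omega_equivalence[OF C seminorm_functional_complex
        X[THEN conjunct1] X[THEN conjunct2, THEN conjunct1] X[THEN conjunct2, THEN conjunct2]]
    show "has_mixing_groups mul\<^sub>C \<longleftrightarrow> has_supercyclic_semigroup mul\<^sub>C"
      by (rule equiv[THEN conjunct1])
    show "has_supercyclic_semigroup mul\<^sub>C \<longleftrightarrow>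
        \<not> isomorphic_tvs mul\<^sub>C (omega_scale :: complex \<Rightarrow> (nat \<Rightarrow> complex) \<Rightarrow> nat \<Rightarrow> complex)"
      by (rule equiv[THEN conjunct2])
  qed
qed

end
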